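(* Let $G$ be a compact Lie group which acts smoothly and freely on a smooth manifold $M$. Suppose that $(X,\mathcal{S})$, $X\subset M$, is a Whitney stratified subset such that $X$ is $G$-invariant and the induced action of $G$ on $X$ is compatible with the stratification $\mathcal{S}$. If $(X,\mathcal{S})$ is a pseudomanifold, then $(X/G,\mathcal{S}/G)$ is a pseudomanifold, where $\mathcal{S}/G=\{S/G\mid S\in\mathcal{S}\}$ and $X/G\subset M/G$.
   Context: A stratification $\mathcal{S}$ of a separable, locally compact Hausdorff space $X$ over a poset $P$ is a partition $\mathcal{S}=\{S_i\mid i\in P\}$ of $X$ into nonempty locally closed subspaces (the strata) such that (S1) $\mathcal{S}$ is locally finite; (S2) every $S_i$ is a smooth manifold; (S3) $S_i\cap\overline{S}_j\neq\varnothing$ if and only if $S_i\subset\overline{S}_j$, and this is the case if and only if $i\le j$. Let $X$ be a closed subset of a smooth manifold $M$ of dimension $n$, stratified by $\mathcal{S}$ such that the strata are smooth submanifolds of $M$. Let $R\neq S$ be strata with $R\subset\overline{S}$ and $x\in R$. The pair $(R,S)$ is Whitney (B)-regular at $x$ if there is a smooth chart $\chi:U\to\mathbb{R}^n$ of $M$ around $x$ such that: whenever $(x_k)$ is a sequence in $R\cap U$ and $(y_k)$ a sequence in $S\cap U$ with $x_k\to x$, $y_k\to x$, such that the lines through the origin spanned by $\chi(y_k)-\chi(x_k)$ converge in $\mathbb{R}\mathbb{P}^{n-1}$ to a line $\ell$ and the tangent planes of $\chi(S\cap U)$ at $\chi(y_k)$, translated to the origin, converge in the Grassmannian of $(\dim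 S)$-planes in $\mathbb{R}^n$ to $\tau$, then $\ell\subset\tau$. The pair $(X,\mathcal{S})$ is a Whitney stratified subset of $M$ if (B)-regularity holds for all such pairs $(R,S)$ at all points of $R$. An action of $G$ on $X$ is compatible with $\mathcal{S}$ if every stratum $S$ is $G$-invariant and the induced action $G\times S\to S$ is smooth. It is known that if a compact Lie group $G$ acts smoothly and freely on a smooth manifold $M$, and $(X,\mathcal{S})$, $X\subset M$, is a Whitney stratified subset such that $X$ is $G$-invariant and the induced action of $G$ on $X$ is compatible with $\mathcal{S}$, then $M/G$ is a smooth manifold and $(X/G,\mathcal{S}/G)$ is a Whitney stratified subset of $M/G$. A Whitney stratified subset $(X,\mathcal{S})$ has dimension $n$ if some stratum has dimension $n$ and all strata have dimension at most $n$. Its regular set $X^{\mathrm{reg}}$ is the complement of the union of all strata of dimension at most $n-1$. $(X,\mathcal{S})$ of dimension $n$ is a pseudomanifold if $X^{\mathrm{reg}}$ is dense in $X$ and every stratum not contained in $X^{\mathrm{reg}}$ has dimension at most $n-2$. *)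

theory Defs
  imports "HOL-Analysis.Analysis" "HOL-Algebra.Group_Action"
begin

section \<open>Smooth maps between subsets of Euclidean spaces\<close>

primrec ck_on ::
  "nat \<Rightarrow> 'a::real_normed_vector set \<Rightarrow> ('a \<Rightarrow> 'b::real_normed_vector) \<Rightarrow> bool" where
  "ck_on 0 U f \<longleftrightarrow> continuous_on U f"
| "ck_on (Suc k) U f \<longleftrightarrow>
     (\<forall>x\<in>U. f differentiable (at x)) \<and> (\<forall>v. ck_on k U (\<lambda>x. frechet_derivative f (at x) v))"

text \<open>Smoothness on an arbitrary subset is the local existence of smooth extensions. On a relatively
  open subset of a linear subspace this is the usual notion (compose with the orthogonal
  projection).\<close>

definition smooth_on ::
  "'a::real_normed_vector set \<Rightarrow> ('a \<Rightarrow> 'b::real_normed_vector) \<Rightarrow> bool" where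
  "smooth_on A f \<longleftrightarrow>
     (\<forall>x\<in>A. \<exists>U g. open U \<and> x \<in> U \<and> (\<forall>k. ck_on k U g) \<and> (\<forall>y\<in>A \<inter> U. g y = f y))"

text \<open>The velocities at \<open>p\<close> of smooth curves in \<open>A\<close>: for a smooth submanifold \<open>A\<close>, this is its
  tangent plane at \<open>p\<close>, translated to the origin.\<close>

definition tangent_plane :: "'a::euclidean_space set \<Rightarrow> 'a \<Rightarrow> 'a set" where
  "tangent_plane A p =
     {v. \<exists>\<gamma> (\<epsilon>::real). \<epsilon> > 0 \<and> smooth_on {-\<epsilon><..<\<epsilon>} \<gamma> \<and> \<gamma> ` {-\<epsilon><..<\<epsilon>} \<subseteq> A \<and> \<gamma> 0 = p \<and>
           (\<gamma> has_vector_derivative v) (at 0)}"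

text \<open>The \<open>k\<close>-dimensional linear subspaces, topologized by embedding them into the space of linear
  maps through their orthogonal projections; on a linear subspace, \<^const>\<open>closest_point\<close> is the
  orthogonal projection. On linear maps of a finite-dimensional space, the product topology of the
  function type is the norm topology. The case \<open>k = 1\<close> is projective space.\<close>

definition grassmannian :: "nat \<Rightarrow> 'a::euclidean_space set topology" where
  "grassmannian k = pullback_topology {V. subspace V \<and> dim V = k} closest_point euclidean"


section \<open>Smooth manifolds\<close>

type_synonym ('p, 'e) chart = "'p set \<times> ('p \<Rightarrow> 'e)"

text \<open>Dimensions have to be able to vary (strata, quotients) and may be \<open>0\<close>, so \<open>\<real>\<^sup>n\<close> cannot be a
  type. Charts of an \<open>n\<close>-manifold are therefore valued in \<open>n\<close>-dimensional linear subspaces of a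
  Euclidean space \<open>'e\<close>, which may depend on the chart; these are linearly isometric to \<open>\<real>\<^sup>n\<close>.
  The field \<open>atlas\<close> need not be a maximal atlas.\<close>

record ('p, 'e) manifold =
  mspace :: "'p topology"
  mdim :: nat
  atlas :: "('p, 'e) chart set"

definition is_chart :: "'p topology \<Rightarrow> nat \<Rightarrow> ('p, 'e::euclidean_space) chart \<Rightarrow> bool" where
  "is_chart T n = (\<lambda>(U, \<phi>).
     openin T U \<and>
     (\<exists>E. subspace E \<and> dim E = n \<and> openin (top_of_set E) (\<phi> ` U)) \<and>
     homeomorphic_map (subtopology T U) (top_of_set (\<phi> ` U)) \<phi>)"

definition compatible_charts ::
  "('p, 'e::euclidean_space) chart \<Rightarrow> ('p, 'e) chart \<Rightarrow> bool" where
  "compatible_charts = (\<lambda>(U, \<phi>) (V, \<psi>).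
     smooth_on (\<phi> ` (U \<inter> V)) (\<psi> \<circ> inv_into U \<phi>) \<and>
     smooth_on (\<psi> ` (U \<inter> V)) (\<phi> \<circ> inv_into V \<psi>))"

definition smooth_manifold :: "('p, 'e::euclidean_space) manifold \<Rightarrow> bool" where
  "smooth_manifold M \<longleftrightarrow>
     Hausdorff_space (mspace M) \<and> second_countable (mspace M) \<and>
     (\<forall>c\<in>atlas M. is_chart (mspace M) (mdim M) c) \<and>
     \<Union>(fst ` atlas M) = topspace (mspace M) \<and>
     (\<forall>c\<in>atlas M. \<forall>c'\<in>atlas M. compatible_charts c c')"

text \<open>The maximal atlas.\<close>

definition smooth_charts :: "('p, 'e::euclidean_space) manifold \<Rightarrow> ('p, 'e) chart set" where
  "smooth_charts M =
     {c. is_chart (mspace M) (mdim M) c \<and> (\<forall>c'\<in>atlas M. compatible_charts c c')}"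

definition smooth_map ::
  "('p, 'e::euclidean_space) manifold \<Rightarrow> ('q, 'f::euclidean_space) manifold \<Rightarrow> ('p \<Rightarrow> 'q) \<Rightarrow> bool"
  where
  "smooth_map M N f \<longleftrightarrow>
     continuous_map (mspace M) (mspace N) f \<and>
     (\<forall>(U, \<phi>)\<in>atlas M. \<forall>(V, \<psi>)\<in>atlas N.
        smooth_on (\<phi> ` (U \<inter> f -` V)) (\<psi> \<circ> f \<circ> inv_into U \<phi>))"

definition prod_manifold ::
  "('p, 'e::euclidean_space) manifold \<Rightarrow> ('q, 'f::euclidean_space) manifold
     \<Rightarrow> ('p \<times> 'q, 'e \<times> 'f) manifold" where
  "prod_manifold M N =
     \<lparr>mspace = prod_topology (mspace M) (mspace N),
      mdim = mdim M + mdim N,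
      atlas = {(U \<times> V, map_prod \<phi> \<psi>) | U \<phi> V \<psi>. (U, \<phi>) \<in> atlas M \<and> (V, \<psi>) \<in> atlas N}\<rparr>"

text \<open>Charts in which \<open>A\<close> becomes a \<open>k\<close>-dimensional linear subspace. For nonempty \<open>U\<close>, the image
  \<open>\<phi> ` U\<close> is open in an \<open>n\<close>-dimensional subspace, which is then its span.\<close>

definition adapted_charts ::
  "('p, 'e::euclidean_space) manifold \<Rightarrow> nat \<Rightarrow> 'p set \<Rightarrow> ('p, 'e) chart set" where
  "adapted_charts M k A =
     {(U, \<phi>) \<in> smooth_charts M.
        \<exists>V. subspace V \<and> dim V = k \<and> V \<subseteq> span (\<phi> ` U) \<and> \<phi> ` (U \<inter> A) = \<phi> ` U \<inter> V}"

definition submanifold ::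
  "('p, 'e::euclidean_space) manifold \<Rightarrow> nat \<Rightarrow> 'p set \<Rightarrow> bool" where
  "submanifold M k A \<longleftrightarrow>
     A \<subseteq> topspace (mspace M) \<and> (\<forall>x\<in>A. \<exists>(U, \<phi>)\<in>adapted_charts M k A. x \<in> U)"

definition submanifold_dim :: "('p, 'e::euclidean_space) manifold \<Rightarrow> 'p set \<Rightarrow> nat" where
  "submanifold_dim M A = (THE k. submanifold M k A)"

definition induced_manifold ::
  "('p, 'e::euclidean_space) manifold \<Rightarrow> 'p set \<Rightarrow> ('p, 'e) manifold" where
  "induced_manifold M A =
     \<lparr>mspace = subtopology (mspace M) A,
      mdim = submanifold_dim M A,
      atlas = {(U \<inter> A, \<phi>) | U \<phi>. (U, \<phi>) \<in> adapted_charts M (submanifold_dim M A) A}\<rparr>"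


section \<open>Stratifications\<close>

definition locally_closed_in :: "'p topology \<Rightarrow> 'p set \<Rightarrow> bool" where
  "locally_closed_in T A \<longleftrightarrow> (\<exists>U C. openin T U \<and> closedin T C \<and> A = U \<inter> C)"

text \<open>A stratification \<open>(S i)\<close>, \<open>i \<in> P\<close>, of the space \<open>T\<close> over the poset \<open>(P, leq)\<close>;
  \<open>N i\<close> is the smooth structure of the stratum \<open>S i\<close>.\<close>

definition stratification ::
  "'p topology \<Rightarrow> 'i set \<Rightarrow> 'i rel \<Rightarrow> ('i \<Rightarrow> 'p set) \<Rightarrow>
     ('i \<Rightarrow> ('p, 'e::euclidean_space) manifold) \<Rightarrow> bool" where
  "stratification T P leq S N \<longleftrightarrow>
     separable_space T \<and> locally_compact_space T \<and> Hausdorff_space T \<and>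
     partial_order_on P leq \<and>
     (\<Union>i\<in>P. S i) = topspace T \<and> disjoint_family_on S P \<and>
     (\<forall>i\<in>P. S i \<noteq> {} \<and> locally_closed_in T (S i)) \<and>
     locally_finite_in T (S ` P) \<and>
     (\<forall>i\<in>P. smooth_manifold (N i) \<and> mspace (N i) = subtopology T (S i)) \<and>
     (\<forall>i\<in>P. \<forall>j\<in>P.
        (S i \<inter> T closure_of S j \<noteq> {} \<longleftrightarrow> S i \<subseteq> T closure_of S j) \<and>
        (S i \<subseteq> T closure_of S j \<longleftrightarrow> (i, j) \<in> leq))"

definition whitney_B ::
  "('p, 'e::euclidean_space) manifold \<Rightarrow> 'p set \<Rightarrow> 'p set \<Rightarrow> 'p \<Rightarrow> bool" where
  "whitney_B M R S x \<longleftrightarrow>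
     (\<exists>(U, \<kappa>)\<in>smooth_charts M. x \<in> U \<and>
        (\<forall>xs ys l \<tau>.
           (\<forall>k. xs k \<in> R \<inter> U) \<and> (\<forall>k. ys k \<in> S \<inter> U) \<and>
           limitin (mspace M) xs x sequentially \<and> limitin (mspace M) ys x sequentially \<and>
           limitin (grassmannian 1) (\<lambda>k. span {\<kappa> (ys k) - \<kappa> (xs k)}) l sequentially \<and>
           limitin (grassmannian (submanifold_dim M S))
             (\<lambda>k. tangent_plane (\<kappa> ` (S \<inter> U)) (\<kappa> (ys k))) \<tau> sequentially
           \<longrightarrow> l \<subseteq> \<tau>))"

definition whitney_stratified ::
  "('p, 'e::euclidean_space) manifold \<Rightarrow> 'p set \<Rightarrow> 'i set \<Rightarrow> 'i rel \<Rightarrow> ('i \<Rightarrow> 'p set) \<Rightarrow> bool" where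
  "whitney_stratified M X P leq S \<longleftrightarrow>
     smooth_manifold M \<and> closedin (mspace M) X \<and>
     (\<forall>i\<in>P. \<exists>k. submanifold M k (S i)) \<and>
     stratification (subtopology (mspace M) X) P leq S (\<lambda>i. induced_manifold M (S i)) \<and>
     (\<forall>i\<in>P. \<forall>j\<in>P. S i \<noteq> S j \<and> S i \<subseteq> mspace M closure_of S j \<longrightarrow>
        (\<forall>x\<in>S i. whitney_B M (S i) (S j) x))"

definition stratified_dim ::
  "('p, 'e::euclidean_space) manifold \<Rightarrow> 'i set \<Rightarrow> ('i \<Rightarrow> 'p set) \<Rightarrow> nat \<Rightarrow> bool" where
  "stratified_dim M P S n \<longleftrightarrow>
     (\<exists>i\<in>P. submanifold_dim M (S i) = n) \<and> (\<forall>i\<in>P. submanifold_dim M (S i) \<le> n)"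

definition regular_set ::
  "('p, 'e::euclidean_space) manifold \<Rightarrow> 'p set \<Rightarrow> 'i set \<Rightarrow> ('i \<Rightarrow> 'p set) \<Rightarrow> nat \<Rightarrow> 'p set" where
  "regular_set M X P S n = X - \<Union>{S i | i. i \<in> P \<and> submanifold_dim M (S i) < n}"

definition pseudomanifold ::
  "('p, 'e::euclidean_space) manifold \<Rightarrow> 'p set \<Rightarrow> 'i set \<Rightarrow> 'i rel \<Rightarrow> ('i \<Rightarrow> 'p set) \<Rightarrow> bool" where
  "pseudomanifold M X P leq S \<longleftrightarrow>
     whitney_stratified M X P leq S \<and>
     (\<exists>n. stratified_dim M P S n \<and>
        subtopology (mspace M) X closure_of regular_set M X P S n = X \<and>
        (\<forall>i\<in>P. \<not> S i \<subseteq> regular_set M X P S n \<longrightarrow> submanifold_dim M (S i) + 2 \<le> n))"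


section \<open>Lie group actions and their quotients\<close>

definition lie_group :: "'g monoid \<Rightarrow> ('g, 'b::euclidean_space) manifold \<Rightarrow> bool" where
  "lie_group G L \<longleftrightarrow>
     group G \<and> smooth_manifold L \<and> topspace (mspace L) = carrier G \<and>
     smooth_map (prod_manifold L L) L (\<lambda>(g, h). g \<otimes>\<^bsub>G\<^esub> h) \<and>
     smooth_map L L (\<lambda>g. inv\<^bsub>G\<^esub> g)"

definition smooth_action ::
  "'g monoid \<Rightarrow> ('g, 'b::euclidean_space) manifold \<Rightarrow> ('p, 'e::euclidean_space) manifold \<Rightarrow>
     ('g \<Rightarrow> 'p \<Rightarrow> 'p) \<Rightarrow> bool" where
  "smooth_action G L M \<alpha> \<longleftrightarrow>
     group_action G (topspace (mspace M)) \<alpha> \<and>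
     smooth_map (prod_manifold L M) M (\<lambda>(g, x). \<alpha> g x)"

definition free_action :: "'g monoid \<Rightarrow> 'p set \<Rightarrow> ('g \<Rightarrow> 'p \<Rightarrow> 'p) \<Rightarrow> bool" where
  "free_action G A \<alpha> \<longleftrightarrow> (\<forall>g\<in>carrier G. \<forall>x\<in>A. \<alpha> g x = x \<longrightarrow> g = \<one>\<^bsub>G\<^esub>)"

definition invariant :: "'g monoid \<Rightarrow> ('g \<Rightarrow> 'p \<Rightarrow> 'p) \<Rightarrow> 'p set \<Rightarrow> bool" where
  "invariant G \<alpha> A \<longleftrightarrow> (\<forall>g\<in>carrier G. \<forall>x\<in>A. \<alpha> g x \<in> A)"

definition compatible_action ::
  "'g monoid \<Rightarrow> ('g, 'b::euclidean_space) manifold \<Rightarrow> ('p, 'e::euclidean_space) manifold \<Rightarrow>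
     ('g \<Rightarrow> 'p \<Rightarrow> 'p) \<Rightarrow> 'i set \<Rightarrow> ('i \<Rightarrow> 'p set) \<Rightarrow> bool" where
  "compatible_action G L M \<alpha> P S \<longleftrightarrow>
     (\<forall>i\<in>P. invariant G \<alpha> (S i) \<and>
        smooth_map (prod_manifold L (induced_manifold M (S i))) (induced_manifold M (S i))
          (\<lambda>(g, x). \<alpha> g x))"

definition orbit_topology ::
  "'g monoid \<Rightarrow> 'p topology \<Rightarrow> ('g \<Rightarrow> 'p \<Rightarrow> 'p) \<Rightarrow> 'p set topology" where
  "orbit_topology G T \<alpha> =
     topology (\<lambda>W. W \<subseteq> orbits G (topspace T) \<alpha> \<and>
                   openin T {x \<in> topspace T. orbit G \<alpha> x \<in> W})"

lemma openin_orbit_topology: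
  "openin (orbit_topology G T \<alpha>) W \<longleftrightarrow>
     W \<subseteq> orbits G (topspace T) \<alpha> \<and> openin T {x \<in> topspace T. orbit G \<alpha> x \<in> W}"
proof -
  have "istopology (\<lambda>W. W \<subseteq> orbits G (topspace T) \<alpha> \<and>
                        openin T {x \<in> topspace T. orbit G \<alpha> x \<in> W})"
    unfolding istopology_def
  proof (intro conjI allI impI)
    fix A B
    assume *: "A \<subseteq> orbits G (topspace T) \<alpha> \<and> openin T {x \<in> topspace T. orbit G \<alpha> x \<in> A}"
      "B \<subseteq> orbits G (topspace T) \<alpha> \<and> openin T {x \<in> topspace T. orbit G \<alpha> x \<in> B}"
    show "A \<inter> B \<subseteq> orbits G (topspace T) \<alpha>" using * by blast
    have eq: "{x \<in> topspace T. orbit G \<alpha> x \<in> A \<inter> B} =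
      {x \<in> topspace T. orbit G \<alpha> x \<in> A} \<inter> {x \<in> topspace T. orbit G \<alpha> x \<in> B}" by blast
    show "openin T {x \<in> topspace T. orbit G \<alpha> x \<in> A \<inter> B}"
      unfolding eq using * by (intro openin_Int) simp_all
  next
    fix \<K>
    assume *: "\<forall>K\<in>\<K>. K \<subseteq> orbits G (topspace T) \<alpha> \<and> openin T {x \<in> topspace T. orbit G \<alpha> x \<in> K}"
    show "\<Union>\<K> \<subseteq> orbits G (topspace T) \<alpha>" using * by blast
    have eq: "{x \<in> topspace T. orbit G \<alpha> x \<in> \<Union>\<K>} =
      \<Union>((\<lambda>K. {x \<in> topspace T. orbit G \<alpha> x \<in> K}) ` \<K>)" by blast
    show "openin T {x \<in> topspace T. orbit G \<alpha> x \<in> \<Union>\<K>}"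
      unfolding eq using * by (intro openin_Union) blast
  qed
  then show ?thesis by (simp add: orbit_topology_def topology_inverse')
qed

text \<open>The local representative of \<open>f\<close> in the charts \<open>(U, \<phi>)\<close>, \<open>(V, \<psi>)\<close> is a smooth map with
  surjective differentials.\<close>

definition submersive ::
  "('p, 'e::euclidean_space) chart \<Rightarrow> ('q, 'f::euclidean_space) chart \<Rightarrow> ('p \<Rightarrow> 'q) \<Rightarrow> bool" where
  "submersive = (\<lambda>(U, \<phi>) (V, \<psi>) f.
     let D = \<phi> ` (U \<inter> f -` V); F = \<psi> \<circ> f \<circ> inv_into U \<phi> in
       smooth_on D F \<and>
       (\<forall>p\<in>D. \<exists>F'. (F has_derivative F') (at p within D) \<and>
          F' ` tangent_plane D p = tangent_plane (\<psi> ` V) (F p)))"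

text \<open>The orbit space \<open>M/G\<close> with the quotient topology and the smooth structure for which the orbit
  projection is a smooth submersion: its atlas consists of all charts of dimension
  \<open>dim M - dim G\<close> in which the projection is one. This is a maximal atlas if the
  action is free and \<open>G\<close> is compact.\<close>

definition quotient_manifold ::
  "'g monoid \<Rightarrow> ('g, 'b::euclidean_space) manifold \<Rightarrow> ('p, 'e::euclidean_space) manifold \<Rightarrow>
     ('g \<Rightarrow> 'p \<Rightarrow> 'p) \<Rightarrow> ('p set, 'e) manifold" where
  "quotient_manifold G L M \<alpha> =
     \<lparr>mspace = orbit_topology G (mspace M) \<alpha>,
      mdim = mdim M - mdim L,
      atlas = {c. is_chart (orbit_topology G (mspace M) \<alpha>) (mdim M - mdim L) c \<and>
                  (\<forall>b\<in>atlas M. submersive b c (orbit G \<alpha>))}\<rparr>"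

end

theory Submission
  imports Defs
begin

text \<open>The action map, restricted to a small slice \<open>\<Sigma>\<close> orthogonal (in a chart \<open>\<kappa>\<close>) to the orbit of a point \<open>x\<close>,
  is a local diffeomorphism, and by compactness and freeness \<open>\<Sigma>\<close> meets every orbit at most once. Hence
  \<open>orbit s \<mapsto> \<kappa> s - \<kappa> x\<close> is a chart of \<open>M/G\<close> for every chart \<open>\<kappa>\<close> of \<open>M\<close>. If \<open>\<kappa>\<close> is adapted to an invariant
  submanifold, so is the slice chart, and the dimension drops by \<open>dim G\<close>. If \<open>\<kappa>\<close> witnesses Whitney's
  condition (B) at \<open>x\<close>, so does the slice chart: secants are unchanged, and along a subsequence the
  tangent planes upstairs converge to a plane \<open>\<tau>'\<close>, which is the direct sum of the tangent space of the orbit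
  and the limit \<open>\<tau>\<close> downstairs; a secant limit lies in \<open>\<tau>'\<close> and in the normal space, hence in \<open>\<tau>\<close>.
  Since all strata drop by the same dimension and the orbit map is open and commutes with closures of
  invariant sets, the density and codimension conditions descend.\<close>

section \<open>Calculus of smooth maps\<close>

text \<open>The action map is a local diffeomorphism near the slice only if orbit maps are
  immersions, and freeness gives no more than their injectivity. At a group element where the rank
  of the orbit map is maximal, a kernel vector would generate a curve on which the map is constant;
  so the kernel vanishes there, and equivariance moves this to the unit. A local diffeomorphism in
  turn controls only group elements near the unit. The others form a compact set, and none of them
  fixes x, so they move a whole neighbourhood of x off another one; this is the source of the
  injectivity of a slice. The atlas of M/G is defined by a property, submersivity of the projection,
  so the compatibility of two of its charts is derived from local sections of submersions and not
  from slices. Finally, model spaces are linear subspaces of varying dimension. Derivatives are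
  therefore taken within subsets and are determined only on the model subspace, and the inverse
  function theorem is moved to subspaces in a form for maps with identity differential; each
  application is arranged to have this form.\<close>

lemma linear_euclidean_representation:
  fixes L :: "'a::euclidean_space \<Rightarrow> 'b::real_vector"
  assumes "linear L"
  shows "L z = (\<Sum>b\<in>Basis. (z \<bullet> b) *\<^sub>R L b)"
proof -
  have "L z = L (\<Sum>b\<in>Basis. (z \<bullet> b) *\<^sub>R b)" by (simp add: euclidean_representation)
  also have "\<dots> = (\<Sum>b\<in>Basis. (z \<bullet> b) *\<^sub>R L b)"
    by (simp add: linear_sum[OF assms] linear_cmul[OF assms])
  finally show ?thesis .
qed

section \<open>Maps of class C^k on open sets, up to the inverse function theorem\<close>

lemma ck_on_mono: "ck_on k U f \<Longrightarrow> V \<subseteq> U \<Longrightarrow> ck_on k V f"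
  by (induction k arbitrary: f) (auto intro: continuous_on_subset)

text \<open>Derivatives at a point of U depend only on nearby values, and these are taken in the
  open set U.\<close>

lemma ck_on_cong:
  assumes "open U" "ck_on k U f" "\<And>x. x \<in> U \<Longrightarrow> f x = g x"
  shows "ck_on k U g"
  using assms(2,3)
proof (induction k arbitrary: f g)
  case 0
  then show ?case by (metis ck_on.simps(1) continuous_on_cong)
next
  case (Suc k)
  have *: "(g has_derivative frechet_derivative f (at x)) (at x)" if "x \<in> U" for x
    using Suc.prems that \<open>open U\<close>
    by (auto simp: frechet_derivative_works intro: has_derivative_transform_within_open)
  then have "frechet_derivative f (at x) = frechet_derivative g (at x)" if "x \<in> U" for x
    using that by (metis frechet_derivative_at)
  with Suc.IH Suc.prems(1) have "ck_on k U (\<lambda>x. frechet_derivative g (at x) v)" for v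
    by (metis (mono_tags, lifting) ck_on.simps(2))
  with * show ?case by (auto simp: differentiable_def)
qed

lemma ck_on_Suc_imp: "ck_on (Suc k) U f \<Longrightarrow> ck_on k U f"
proof (induction k arbitrary: f)
  case 0
  then show ?case
    by (auto intro!: continuous_at_imp_continuous_on differentiable_imp_continuous_within)
next
  case (Suc k)
  then show ?case by (metis ck_on.simps(2))
qed

text \<open>\<open>frechet_derivative\<close> is a choice, but derivatives at a point are unique, so
  any explicit formula for the derivative may replace it.\<close>

lemma ck_on_SucI:
  assumes "open U" "\<And>x. x \<in> U \<Longrightarrow> (f has_derivative f' x) (at x)"
    and "\<And>v. ck_on k U (\<lambda>x. f' x v)"
  shows "ck_on (Suc k) U f"
proof -
  have "f' x = frechet_derivative f (at x)" if "x \<in> U" for x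
    using assms(2)[OF that] by (rule frechet_derivative_at)
  then have "ck_on k U (\<lambda>x. frechet_derivative f (at x) v)" for v
    by (intro ck_on_cong[OF \<open>open U\<close> assms(3)[of v]]) simp
  then show ?thesis using assms(2) by (auto simp: differentiable_def)
qed

lemma ck_on_SucE:
  assumes "ck_on (Suc k) U f" "x \<in> U"
  shows "(f has_derivative frechet_derivative f (at x)) (at x)"
  using assms by (simp add: frechet_derivative_works)

lemma ck_on_continuous: "ck_on k U f \<Longrightarrow> continuous_on U f"
  by (induction k) (use ck_on_Suc_imp in auto)

lemma ck_on_const: "open U \<Longrightarrow> ck_on k U (\<lambda>x. c)"
proof (induction k arbitrary: c)
  case (Suc k)
  show ?case by (rule ck_on_SucI[OF Suc.prems, where f' = "\<lambda>x v. 0"]) (auto simp: Suc)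
qed auto

lemma ck_on_add:
  assumes "open U"
  shows "ck_on k U f \<Longrightarrow> ck_on k U g \<Longrightarrow> ck_on k U (\<lambda>x. f x + g x)"
proof (induction k arbitrary: f g)
  case 0
  then show ?case by (auto intro: continuous_intros)
next
  case (Suc k)
  show ?case
    by (rule ck_on_SucI[OF assms, where
          f' = "\<lambda>x v. frechet_derivative f (at x) v + frechet_derivative g (at x) v"])
      (use Suc in \<open>auto intro!: has_derivative_add simp: frechet_derivative_works[symmetric]\<close>)
qed

lemma ck_on_sum:
  assumes "open U" "\<And>i. i \<in> I \<Longrightarrow> ck_on k U (f i)"
  shows "ck_on k U (\<lambda>x. \<Sum>i\<in>I. f i x)"
  using assms(2)
  by (induction I rule: infinite_finite_induct) (auto intro: ck_on_const ck_on_add assms(1))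

lemma ck_on_bounded_linear:
  assumes "open U" "bounded_linear L"
  shows "ck_on k U f \<Longrightarrow> ck_on k U (\<lambda>x. L (f x))"
proof (induction k arbitrary: f)
  case 0
  then show ?case using assms(2) by (auto intro: linear_continuous_on_compose bounded_linear.continuous_on)
next
  case (Suc k)
  show ?case
  proof (rule ck_on_SucI[OF assms(1), where f' = "\<lambda>x v. L (frechet_derivative f (at x) v)"])
    show "((\<lambda>x. L (f x)) has_derivative (\<lambda>v. L (frechet_derivative f (at x) v))) (at x)" if "x \<in> U" for x
      by (rule bounded_linear.has_derivative[OF assms(2) ck_on_SucE[OF Suc.prems that]])
    show "ck_on k U (\<lambda>x. L (frechet_derivative f (at x) v))" for v
      using Suc by simp
  qed
qed

lemma ck_on_bounded_bilinear:
  assumes "open U" "bounded_bilinear B"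
  shows "ck_on k U f \<Longrightarrow> ck_on k U g \<Longrightarrow> ck_on k U (\<lambda>x. B (f x) (g x))"
proof (induction k arbitrary: f g)
  case 0
  then show ?case using assms(2) by (auto intro: bounded_bilinear.continuous_on)
next
  case (Suc k)
  show ?case
  proof (rule ck_on_SucI[OF assms(1), where f' = "\<lambda>x v. B (f x) (frechet_derivative g (at x) v)
      + B (frechet_derivative f (at x) v) (g x)"])
    show "((\<lambda>x. B (f x) (g x)) has_derivative (\<lambda>v. B (f x) (frechet_derivative g (at x) v)
      + B (frechet_derivative f (at x) v) (g x))) (at x)" if "x \<in> U" for x
      by (rule bounded_bilinear.FDERIV[OF assms(2) ck_on_SucE[OF Suc.prems(1) that] ck_on_SucE[OF Suc.prems(2) that]])
    show "ck_on k U (\<lambda>x. B (f x) (frechet_derivative g (at x) v)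
      + B (frechet_derivative f (at x) v) (g x))" for v
      using Suc.prems ck_on_Suc_imp[OF Suc.prems(1)] ck_on_Suc_imp[OF Suc.prems(2)]
      by (intro ck_on_add[OF assms(1)] Suc.IH) auto
  qed
qed

lemma ck_on_linear:
  fixes L :: "'a::euclidean_space \<Rightarrow> 'b::real_normed_vector"
  assumes "open U" "linear L"
  shows "ck_on k U L"
proof (cases k)
  case 0
  then show ?thesis using assms by (simp add: linear_continuous_on linear_conv_bounded_linear)
next
  case (Suc m)
  show ?thesis
    unfolding Suc using assms
    by (intro ck_on_SucI[where f' = "\<lambda>x. L"])
      (auto simp: linear_conv_bounded_linear intro: ck_on_const bounded_linear_imp_has_derivative)
qed

text \<open>By the chain rule the derivative along v is Dg at \<open>f x\<close> applied to the
  moving vector Df v, whereas \<open>ck_on\<close> speaks only of fixed directions. Expanding that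
  vector in \<open>Basis\<close> leaves products of C^k functions, and the induction hypothesis
  applies to the directional derivatives of g; this is why g alone is generalized.\<close>

lemma ck_on_compose:
  fixes f :: "'a::real_normed_vector \<Rightarrow> 'b::euclidean_space"
  assumes "open U" "open V" "f ` U \<subseteq> V"
  shows "ck_on k U f \<Longrightarrow> ck_on k V g \<Longrightarrow> ck_on k U (\<lambda>x. g (f x))"
proof (induction k arbitrary: g)
  case 0
  then show ?case using assms by (auto intro: continuous_on_compose2)
next
  case (Suc k)
  let ?Df = "\<lambda>x. frechet_derivative f (at x)" and ?Dg = "\<lambda>x. frechet_derivative g (at x)"
  show ?case
  proof (rule ck_on_SucI[OF assms(1), where f' = "\<lambda>x v. ?Dg (f x) (?Df x v)"])
    show "((\<lambda>x. g (f x)) has_derivative (\<lambda>v. ?Dg (f x) (?Df x v))) (at x)" if "x \<in> U" for x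
      using assms(3) that
      by (intro has_derivative_compose[of f "?Df x" x UNIV g "?Dg (f x)"] ck_on_SucE[OF Suc.prems(1)]
          ck_on_SucE[OF Suc.prems(2)]) auto
    fix v
    have "ck_on k U (\<lambda>x. \<Sum>b\<in>Basis. (?Df x v \<bullet> b) *\<^sub>R ?Dg (f x) b)"
    proof (intro ck_on_sum ck_on_bounded_bilinear[OF \<open>open U\<close> bounded_bilinear_scaleR] assms(1))
      fix b :: 'b
      show "ck_on k U (\<lambda>x. ?Df x v \<bullet> b)"
        using Suc.prems by (intro ck_on_bounded_linear[OF assms(1) bounded_linear_inner_left]) simp
      show "ck_on k U (\<lambda>x. ?Dg (f x) b)"
        using Suc.prems(2) Suc.IH[OF ck_on_Suc_imp[OF Suc.prems(1)], of "\<lambda>y. ?Dg y b"] by simp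
    qed
    moreover have "(\<Sum>b\<in>Basis. (?Df x v \<bullet> b) *\<^sub>R ?Dg (f x) b) = ?Dg (f x) (?Df x v)" if "x \<in> U" for x
    proof -
      have "linear (?Dg (f x))"
        using ck_on_SucE[OF Suc.prems(2), of "f x"] assms(3) that
        by (auto intro: has_derivative_linear)
      then show ?thesis
        using linear_euclidean_representation by metis
    qed
    ultimately show "ck_on k U (\<lambda>x. ?Dg (f x) (?Df x v))"
      by (rule ck_on_cong[OF assms(1)])
  qed
qed

lemma ck_on_Pair:
  assumes "open U" "ck_on k U f" "ck_on k U g"
  shows "ck_on k U (\<lambda>x. (f x, g x))"
proof -
  have "ck_on k U (\<lambda>x. (f x, 0) + (0, g x))"
    using assms by (intro ck_on_add ck_on_bounded_linear[where L = "\<lambda>z. (z, 0)"]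
        ck_on_bounded_linear[where L = "\<lambda>z. (0, z)"] bounded_linear_Pair bounded_linear_ident bounded_linear_zero)
  then show ?thesis by simp
qed

text \<open>A product rule whose second factor is only continuous: since the first one vanishes at
  p, the norm of \<phi> y (c y - c p) is at most a constant times |y - p| times a quantity tending
  to 0. It permits differentiating an inverse family that is so far only known to be
  continuous.\<close>

lemma has_derivative_scaleR_vanishing:
  fixes c :: "'a::real_normed_vector \<Rightarrow> 'b::real_normed_vector"
  assumes \<phi>: "(\<phi> has_derivative D) (at p)" and "\<phi> p = 0" and c: "isCont c p"
  shows "((\<lambda>y. \<phi> y *\<^sub>R c y) has_derivative (\<lambda>h. D h *\<^sub>R c p)) (at p)"
proof -
  have "((\<lambda>y. \<phi> y *\<^sub>R (c y - c p)) has_derivative (\<lambda>h. 0)) (at p)"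
    unfolding has_derivative_iff_norm
  proof (intro conjI)
    obtain e B where eB: "e > 0" "B > 0" and B: "\<And>y. 0 < norm (y - p) \<Longrightarrow> norm (y - p) < e \<Longrightarrow> norm (\<phi> y - \<phi> p) / norm (y - p) \<le> B"
    proof -
      obtain e B where e: "e > 0" and B: "\<forall>y. norm (y - p) < e \<longrightarrow> norm (\<phi> y - \<phi> p) \<le> B * norm (y - p)" "B > 0"
      proof -
        obtain B0 where B0: "\<And>h. norm (D h) \<le> norm h * B0" "B0 > 0"
          using has_derivative_bounded_linear[OF \<phi>] bounded_linear.pos_bounded by blast
        obtain e where e: "e > 0" "\<forall>y. norm (y - p) < e \<longrightarrow> norm (\<phi> y - \<phi> p - D (y - p)) \<le> 1 * norm (y - p)"
          using \<phi> unfolding has_derivative_at_alt by (meson zero_less_one)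
        have "norm (\<phi> y - \<phi> p) \<le> (1 + B0) * norm (y - p)" if "norm (y - p) < e" for y
          using e(2)[rule_format, OF that] B0(1)[of "y - p"]
            norm_triangle_sub[of "\<phi> y - \<phi> p" "D (y - p)"] by (simp add: algebra_simps)
        then show thesis using that[of e "1 + B0"] e B0(2) by simp
      qed
      show thesis
        by (rule that[OF e B(2)]) (use B(1) in \<open>auto simp: divide_le_eq\<close>)
    qed
    have "((\<lambda>y. norm (\<phi> y) / norm (y - p) * norm (c y - c p)) \<longlongrightarrow> 0) (at p)"
    proof (rule Lim_null_comparison)
      show "\<forall>\<^sub>F y in at p. norm (norm (\<phi> y) / norm (y - p) * norm (c y - c p)) \<le> B * norm (c y - c p)"
        unfolding eventually_at using eB(1) B assms(2)
      proof (intro exI[of _ e] conjI ballI impI)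
        fix y assume y: "y \<noteq> p \<and> dist y p < e"
        then have "norm (\<phi> y) / norm (y - p) \<le> B"
          using B[of y] assms(2) by (simp add: dist_norm)
        then show "norm (norm (\<phi> y) / norm (y - p) * norm (c y - c p)) \<le> B * norm (c y - c p)"
          by (simp add: mult_right_mono del: times_divide_eq_left)
      qed (use eB in simp)
      show "((\<lambda>y. B * norm (c y - c p)) \<longlongrightarrow> 0) (at p)"
        using c by (auto simp: isCont_def intro!: tendsto_mult_right_zero tendsto_norm_zero LIM_zero)
    qed
    then show "((\<lambda>y. norm (\<phi> y *\<^sub>R (c y - c p) - \<phi> p *\<^sub>R (c p - c p) - 0) / norm (y - p)) \<longlongrightarrow> 0) (at p)"
      by (simp add: assms(2))
  qed (rule bounded_linear_zero)
  moreover have "((\<lambda>y. \<phi> y *\<^sub>R c p) has_derivative (\<lambda>h. D h *\<^sub>R c p)) (at p)"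
    by (intro derivative_intros \<phi>)
  ultimately have "((\<lambda>y. \<phi> y *\<^sub>R (c y - c p) + \<phi> y *\<^sub>R c p) has_derivative (\<lambda>h. 0 + D h *\<^sub>R c p)) (at p)"
    by (rule has_derivative_add)
  then show ?thesis by (simp add: scaleR_right_diff_distrib)
qed

text \<open>\<open>s\<close> bounds the operator norm of A y - A p and tends to 0, so the lower
  bound |u| <= 2K |A y u| holds uniformly for y near p. It is applied to u = N y v - N p v, whose
  image under A y is a difference of values of A at p and at y.\<close>

lemma isCont_inverse_family:
  fixes A N :: "'a::real_normed_vector \<Rightarrow> 'e::euclidean_space \<Rightarrow> 'e"
  assumes V: "open V" "p \<in> V"
    and lin: "\<And>y. y \<in> V \<Longrightarrow> linear (A y)" "\<And>y. y \<in> V \<Longrightarrow> linear (N y)"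
    and inv: "\<And>y v. y \<in> V \<Longrightarrow> A y (N y v) = v" "\<And>y v. y \<in> V \<Longrightarrow> N y (A y v) = v"
    and cont: "\<And>v. isCont (\<lambda>y. A y v) p"
  shows "isCont (\<lambda>y. N y v) p"
proof -
  obtain K where K: "K > 0" "\<And>w. norm (N p w) \<le> K * norm w"
    using linear_bounded_pos[OF lin(2)[OF V(2)]] by blast
  define s where "s y = (\<Sum>b\<in>Basis. norm (A y b - A p b))" for y
  have s: "norm (A y u - A p u) \<le> s y * norm u" if "y \<in> V" for y u
  proof -
    have rep: "A z u = (\<Sum>b\<in>Basis. (u \<bullet> b) *\<^sub>R A z b)" if "z \<in> V" for z
      by (rule linear_euclidean_representation[OF lin(1)[OF that]])
    have "norm (A y u - A p u) = norm (\<Sum>b\<in>Basis. (u \<bullet> b) *\<^sub>R (A y b - A p b))"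
      by (simp add: rep[OF that] rep[OF V(2)] sum_subtractf scaleR_right_diff_distrib)
    also have "\<dots> \<le> (\<Sum>b\<in>Basis. norm u * norm (A y b - A p b))"
      by (rule sum_norm_le) (simp add: Basis_le_norm mult_right_mono)
    finally show ?thesis by (simp add: s_def sum_distrib_left mult.commute)
  qed
  have "(s \<longlongrightarrow> (\<Sum>b\<in>Basis. norm (A p b - A p b))) (at p)"
    unfolding s_def using cont by (intro tendsto_intros) (auto simp: isCont_def)
  then have "(s \<longlongrightarrow> 0) (at p)" by simp
  \<comment> \<open>This threshold makes \<open>K * s y * norm u\<close> at most half of
    \<open>norm u\<close>, which can then be absorbed on the left.\<close>
  then have "\<forall>\<^sub>F y in at p. s y < 1 / (2 * K)"
    using K(1) by (intro order_tendstoD) auto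
  moreover have "\<forall>\<^sub>F y in at p. y \<in> V"
    using V by (intro eventually_at_in_open')
  ultimately have ev: "\<forall>\<^sub>F y in at p. norm (N y v - N p v) \<le> 2 * K * norm (A y (N p v) - A p (N p v))"
  proof eventually_elim
    case (elim y)
    have bound: "norm u \<le> 2 * K * norm (A y u)" for u
    proof -
      have "norm u = norm (N p (A p u))" using inv V by simp
      also have "\<dots> \<le> K * norm (A p u)" by (rule K)
      also have "norm (A p u) \<le> norm (A y u) + s y * norm u"
        using s[OF elim(2), of u] norm_triangle_sub[of "A p u" "A y u"] by (simp add: norm_minus_commute)
      also have "s y * norm u \<le> norm u * (1 / (2 * K))"
        using mult_right_mono[OF less_imp_le[OF elim(1)], of "norm u"] by (simp add: mult.commute)
      finally show ?thesis using K(1) by (simp add: field_simps)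
    qed
    have "A y (N y v - N p v) = A p (N p v) - A y (N p v)"
      using inv elim(2) V lin(1)[OF elim(2)] by (simp add: linear_diff)
    then show ?case using bound[of "N y v - N p v"] by (simp add: norm_minus_commute)
  qed
  have "((\<lambda>y. 2 * K * norm (A y (N p v) - A p (N p v))) \<longlongrightarrow> 0) (at p)"
    using cont[of "N p v"] by (auto simp: isCont_def intro!: tendsto_mult_right_zero tendsto_norm_zero LIM_zero)
  from Lim_null_comparison[OF ev this] show ?thesis
    by (simp add: isCont_def LIM_zero_iff)
qed

text \<open>The derivative of inversion, D(N v) = - N (DA (N v)), is read off from N y v = u - N y
  (A y u - A p u) with u = N p v, where the argument of N y vanishes at y = p. The formula expresses
  the derivative through N and DA, so each order of differentiability of N yields the next.\<close>

lemma ck_on_inverse_family: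
  fixes A N :: "'a::real_normed_vector \<Rightarrow> 'e::euclidean_space \<Rightarrow> 'e"
  assumes V: "open V"
    and lin: "\<And>y. y \<in> V \<Longrightarrow> linear (A y)" "\<And>y. y \<in> V \<Longrightarrow> linear (N y)"
    and inv: "\<And>y v. y \<in> V \<Longrightarrow> A y (N y v) = v" "\<And>y v. y \<in> V \<Longrightarrow> N y (A y v) = v"
    and A: "\<And>v. ck_on k V (\<lambda>y. A y v)"
  shows "ck_on k V (\<lambda>y. N y v)"
  using A
proof (induction k arbitrary: v)
  case 0
  have "isCont (\<lambda>y. N y v) p" if "p \<in> V" for p
    using V that lin inv
    by (rule isCont_inverse_family) (use 0 V that in \<open>auto simp: continuous_on_eq_continuous_at\<close>)
  then show ?case by (auto intro: continuous_at_imp_continuous_on)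
next
  case (Suc k)
  define D where "D p v = frechet_derivative (\<lambda>y. A y v) (at p)" for p v
  have D: "((\<lambda>y. A y v) has_derivative D p v) (at p)" if "p \<in> V" for p v
    unfolding D_def using Suc.prems that by (rule ck_on_SucE)
  have IH: "ck_on k V (\<lambda>y. N y v)" for v
    using Suc.IH Suc.prems ck_on_Suc_imp by blast
  show ?case
  proof (rule ck_on_SucI[OF V, where f' = "\<lambda>p h. - N p (D p (N p v) h)"])
    fix p assume p: "p \<in> V"
    define u where "u = N p v"
    have Nc: "isCont (\<lambda>y. N y b) p" for b
      using ck_on_continuous[OF IH] V p by (simp add: continuous_on_eq_continuous_at)
    have "((\<lambda>y. \<Sum>b\<in>Basis. ((A y u - A p u) \<bullet> b) *\<^sub>R N y b) has_derivative
        (\<lambda>h. \<Sum>b\<in>Basis. (D p u h \<bullet> b) *\<^sub>R N p b)) (at p)"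
    proof (intro has_derivative_sum has_derivative_scaleR_vanishing Nc)
      fix b :: 'e
      have "((\<lambda>y. (A y u - A p u) \<bullet> b) has_derivative (\<lambda>h. (D p u h - 0) \<bullet> b)) (at p)"
        by (intro has_derivative_inner_left has_derivative_diff D p has_derivative_const)
      then show "((\<lambda>y. (A y u - A p u) \<bullet> b) has_derivative (\<lambda>h. D p u h \<bullet> b)) (at p)" by simp
    qed simp
    moreover have rep: "N y z = (\<Sum>b\<in>Basis. (z \<bullet> b) *\<^sub>R N y b)" if "y \<in> V" for y z
      by (rule linear_euclidean_representation[OF lin(2)[OF that]])
    ultimately have "((\<lambda>y. \<Sum>b\<in>Basis. ((A y u - A p u) \<bullet> b) *\<^sub>R N y b) has_derivative (\<lambda>h. N p (D p u h))) (at p)"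
      using p by simp
    then have "((\<lambda>y. N y (A y u - A p u)) has_derivative (\<lambda>h. N p (D p u h))) (at p)"
      by (rule has_derivative_transform_within_open[OF _ V p]) (use rep in auto)
    then have "((\<lambda>y. u - N y (A y u - A p u)) has_derivative (\<lambda>h. 0 - N p (D p u h))) (at p)"
      by (intro has_derivative_diff has_derivative_const)
    then have "((\<lambda>y. N y v) has_derivative (\<lambda>h. 0 - N p (D p u h))) (at p)"
    proof (rule has_derivative_transform_within_open[OF _ V p])
      fix y assume y: "y \<in> V"
      show "u - N y (A y u - A p u) = N y v"
        using inv y p lin(2)[OF y] by (simp add: linear_diff u_def)
    qed
    then show "((\<lambda>y. N y v) has_derivative (\<lambda>h. - N p (D p (N p v) h))) (at p)"
      by (simp add: u_def)
  next
    fix h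
    \<comment> \<open>Both vectors fed into a linear map move with p. Expanding twice in
      \<open>Basis\<close> leaves sums of products of C^k functions with fixed directions.\<close>
    have "ck_on k V (\<lambda>p. - (\<Sum>c\<in>Basis. (N p v \<bullet> c) *\<^sub>R (\<Sum>b\<in>Basis. (D p c h \<bullet> b) *\<^sub>R N p b)))"
    proof (intro ck_on_bounded_linear[OF V bounded_linear_minus[OF bounded_linear_ident]] ck_on_sum[OF V]
        ck_on_bounded_bilinear[OF V bounded_bilinear_scaleR] IH
        ck_on_bounded_linear[OF V bounded_linear_inner_left])
      show "ck_on k V (\<lambda>p. D p c h)" for c
        using Suc.prems by (simp add: D_def)
    qed
    moreover have "- (\<Sum>c\<in>Basis. (N p v \<bullet> c) *\<^sub>R (\<Sum>b\<in>Basis. (D p c h \<bullet> b) *\<^sub>R N p b)) = - N p (D p (N p v) h)"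
      if p: "p \<in> V" for p
    proof -
      have rep: "N p z = (\<Sum>b\<in>Basis. (z \<bullet> b) *\<^sub>R N p b)" for z
        by (rule linear_euclidean_representation[OF lin(2)[OF p]])
      have repA: "A y u = (\<Sum>c\<in>Basis. (u \<bullet> c) *\<^sub>R A y c)" if "y \<in> V" for y u
        by (rule linear_euclidean_representation[OF lin(1)[OF that]])
      have "((\<lambda>y. \<Sum>c\<in>Basis. (u \<bullet> c) *\<^sub>R A y c) has_derivative (\<lambda>h. \<Sum>c\<in>Basis. (u \<bullet> c) *\<^sub>R D p c h)) (at p)" for u
        by (intro derivative_intros D p)
      then have "((\<lambda>y. A y u) has_derivative (\<lambda>h. \<Sum>c\<in>Basis. (u \<bullet> c) *\<^sub>R D p c h)) (at p)" for u
        by (rule has_derivative_transform_within_open[OF _ V p]) (simp add: repA)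
      then have "D p u = (\<lambda>h. \<Sum>c\<in>Basis. (u \<bullet> c) *\<^sub>R D p c h)" for u
        using D[OF p] has_derivative_unique by blast
      then have "D p (N p v) h = (\<Sum>c\<in>Basis. (N p v \<bullet> c) *\<^sub>R D p c h)" by metis
      then have "N p (D p (N p v) h) = (\<Sum>c\<in>Basis. (N p v \<bullet> c) *\<^sub>R N p (D p c h))"
        using lin(2)[OF p] by (simp add: linear_sum linear_cmul)
      then show ?thesis by (simp only: rep[symmetric])
    qed
    ultimately show "ck_on k V (\<lambda>p. - N p (D p (N p v) h))"
      by (rule ck_on_cong[OF V])
  qed
qed

text \<open>Bootstrapping: the C^1 theorem gives an inverse g whose derivative at y inverts Df at g
  y. If g is C^k, so is this family by \<open>ck_on_inverse_family\<close>, and g is C^(k+1). As the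
  derivative at p is normalized, \<open>id_blinfun\<close> serves as its inverse.\<close>

lemma smooth_inverse_function:
  fixes f :: "'e::euclidean_space \<Rightarrow> 'e"
  assumes U: "open U" "p \<in> U" and f: "\<And>k. ck_on k U f" and id: "frechet_derivative f (at p) = id"
  obtains U' V g where "open U'" "U' \<subseteq> U" "p \<in> U'" "open V" "homeomorphism U' V f g" "\<And>k. ck_on k V g"
proof -
  define f' where "f' x = Blinfun (frechet_derivative f (at x))" for x
  have D: "(f has_derivative frechet_derivative f (at x)) (at x)" if "x \<in> U" for x
    using ck_on_SucE[OF f that] .
  then have f': "blinfun_apply (f' x) = frechet_derivative f (at x)" if "x \<in> U" for x
    unfolding f'_def using that by (intro bounded_linear_Blinfun_apply has_derivative_bounded_linear)
  have "continuous_on U f'"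
  proof (rule continuous_on_blinfun_componentwise)
    fix i :: 'e
    have "continuous_on U (\<lambda>x. frechet_derivative f (at x) i)"
      using f[of 1] by simp
    then show "continuous_on U (\<lambda>x. blinfun_apply (f' x) i)"
      using f' by (simp cong: continuous_on_cong)
  qed
  moreover have "id_blinfun o\<^sub>L f' p = id_blinfun"
    by (rule blinfun_eqI) (simp add: f'[OF U(2)] id)
  ultimately obtain U' V g g' where *: "open U'" "U' \<subseteq> U" "p \<in> U'" "open V" "homeomorphism U' V f g"
    and g': "\<And>y. y \<in> V \<Longrightarrow> (g has_derivative g' y) (at y)"
    "\<And>y. y \<in> V \<Longrightarrow> g' y = inv_into UNIV (blinfun_apply (f' (g y)))"
    "\<And>y. y \<in> V \<Longrightarrow> bij (blinfun_apply (f' (g y)))"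
    using inverse_function_theorem[OF U(1) _ _ U(2), of f f' id_blinfun] D f' by metis
  have gU: "g y \<in> U" if "y \<in> V" for y
    using *(2,5) that unfolding homeomorphism_def by blast
  have "ck_on k V g" for k
  proof (induction k)
    case 0
    then show ?case using *(5) by (simp add: homeomorphism_def)
  next
    case (Suc k)
    show ?case
    proof (rule ck_on_SucI[OF *(4) g'(1)])
      fix v
      show "ck_on k V (\<lambda>y. g' y v)"
      proof (rule ck_on_inverse_family[OF *(4), where A = "\<lambda>y. frechet_derivative f (at (g y))"])
        fix y assume y: "y \<in> V"
        show "linear (frechet_derivative f (at (g y)))"
          using D[OF gU[OF y]] by (rule has_derivative_linear)
        show "linear (g' y)" using g'(1)[OF y] by (rule has_derivative_linear)
        show "frechet_derivative f (at (g y)) (g' y v) = v" "g' y (frechet_derivative f (at (g y)) v) = v" for v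
          using g'(2,3)[OF y] f'[OF gU[OF y]] by (simp_all add: bij_is_surj surj_f_inv_f bij_is_inj)
      next
        show "ck_on k V (\<lambda>y. frechet_derivative f (at (g y)) v)" for v
          using f[of "Suc k"] gU
          by (intro ck_on_compose[OF *(4) U(1) _ Suc, of "\<lambda>x. frechet_derivative f (at x) v"]) auto
      qed
    qed
  qed
  then show thesis using * that by blast
qed

section \<open>Smooth maps on arbitrary subsets\<close>

lemma smooth_onE:
  assumes "smooth_on A f" "p \<in> A"
  obtains U g where "open U" "p \<in> U" "\<And>k. ck_on k U g" "\<And>y. y \<in> A \<Longrightarrow> y \<in> U \<Longrightarrow> g y = f y"
proof -
  from assms obtain U g where "open U \<and> p \<in> U \<and> (\<forall>k. ck_on k U g) \<and> (\<forall>y\<in>A \<inter> U. g y = f y)"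
    unfolding smooth_on_def by blast
  then show thesis using that[of U g] by blast
qed

lemma smooth_onI:
  assumes "\<And>x. x \<in> A \<Longrightarrow> \<exists>U g. open U \<and> x \<in> U \<and> (\<forall>k. ck_on k U g) \<and> (\<forall>y\<in>A \<inter> U. g y = f y)"
  shows "smooth_on A f"
  using assms unfolding smooth_on_def by blast

lemma smooth_on_subset: "smooth_on A f \<Longrightarrow> B \<subseteq> A \<Longrightarrow> smooth_on B f"
  by (rule smooth_onI, erule smooth_onE, erule subsetD, assumption) blast

lemma smooth_on_cong:
  assumes "smooth_on A f" "\<And>x. x \<in> A \<Longrightarrow> f x = g x"
  shows "smooth_on A g"
  by (rule smooth_onI, erule smooth_onE[OF assms(1)]) (use assms(2) in auto)

lemma smooth_on_local:
  assumes "\<And>x. x \<in> A \<Longrightarrow> \<exists>B. openin (top_of_set A) B \<and> x \<in> B \<and> smooth_on B f"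
  shows "smooth_on A f"
proof (rule smooth_onI)
  fix x assume "x \<in> A"
  then obtain B where B: "openin (top_of_set A) B" "x \<in> B" "smooth_on B f"
    using assms by blast
  then obtain W where W: "open W" "B = A \<inter> W" by (auto simp: openin_open)
  obtain U g where U: "open U" "x \<in> U" "\<And>k. ck_on k U g" "\<And>y. y \<in> B \<Longrightarrow> y \<in> U \<Longrightarrow> g y = f y"
    using smooth_onE[OF B(3,2)] by blast
  have "ck_on k (U \<inter> W) g" for k using U(3) by (rule ck_on_mono) auto
  then show "\<exists>U g. open U \<and> x \<in> U \<and> (\<forall>k. ck_on k U g) \<and> (\<forall>y\<in>A \<inter> U. g y = f y)"
    using U W B(2) by (intro exI[of _ "U \<inter> W"] exI[of _ g]) auto
qed

lemma smooth_on_compose: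
  fixes f :: "'a::real_normed_vector \<Rightarrow> 'b::euclidean_space"
  assumes "smooth_on A f" "smooth_on B g" "f ` A \<subseteq> B"
  shows "smooth_on A (\<lambda>x. g (f x))"
proof (rule smooth_onI)
  fix x assume x: "x \<in> A"
  obtain U F where U: "open U" "x \<in> U" "\<And>k. ck_on k U F" "\<And>y. y \<in> A \<Longrightarrow> y \<in> U \<Longrightarrow> F y = f y"
    using smooth_onE[OF assms(1) x] by blast
  obtain V H where V: "open V" "f x \<in> V" "\<And>k. ck_on k V H" "\<And>y. y \<in> B \<Longrightarrow> y \<in> V \<Longrightarrow> H y = g y"
    using smooth_onE[OF assms(2), of "f x"] x assms(3) by blast
  let ?W = "U \<inter> F -` V"
  have W: "open ?W"
    using ck_on_continuous[OF U(3)] U(1) V(1) by (rule continuous_open_preimage)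
  have "ck_on k ?W (\<lambda>x. H (F x))" for k
    by (rule ck_on_compose[OF W V(1) _ ck_on_mono[OF U(3)] V(3)]) auto
  moreover have "H (F y) = g (f y)" if "y \<in> A" "y \<in> ?W" for y
    using that U(4) V(4) assms(3) by auto
  ultimately show "\<exists>U h. open U \<and> x \<in> U \<and> (\<forall>k. ck_on k U h) \<and> (\<forall>y\<in>A \<inter> U. h y = g (f y))"
    using W U(2,4) V(2) x by (intro exI[of _ ?W] exI[of _ "\<lambda>x. H (F x)"]) auto
qed

lemma smooth_on_linear:
  fixes L :: "'a::euclidean_space \<Rightarrow> 'b::real_normed_vector"
  shows "linear L \<Longrightarrow> smooth_on A L"
  by (intro smooth_onI exI[of _ UNIV] exI[of _ L]) (simp add: ck_on_linear)

lemma smooth_on_const: "smooth_on A (\<lambda>x. c)"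
  by (intro smooth_onI exI[of _ UNIV] exI[of _ "\<lambda>x. c"]) (simp add: ck_on_const)

lemma smooth_on_ident: "smooth_on A (\<lambda>x::'a::euclidean_space. x)"
  using smooth_on_linear[of "\<lambda>x. x"] by (simp add: linear_iff)

text \<open>One argument for all binary operations: local smooth extensions of both maps are
  combined on the intersection of their domains.\<close>

lemma smooth_on_combine:
  fixes f :: "'a::real_normed_vector \<Rightarrow> 'b::real_normed_vector" and g :: "'a \<Rightarrow> 'c::real_normed_vector"
    and c :: "'b \<Rightarrow> 'c \<Rightarrow> 'd::real_normed_vector"
  assumes "smooth_on A f" "smooth_on A g"
    and "\<And>(U :: 'a set) F H k. open U \<Longrightarrow> (\<And>k. ck_on k U F) \<Longrightarrow> (\<And>k. ck_on k U H) \<Longrightarrow> ck_on k U (\<lambda>x. c (F x) (H x))"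
  shows "smooth_on A (\<lambda>x. c (f x) (g x))"
proof (rule smooth_onI)
  fix x assume x: "x \<in> A"
  obtain U F where U: "open U" "x \<in> U" "\<And>k. ck_on k U F" "\<And>y. y \<in> A \<Longrightarrow> y \<in> U \<Longrightarrow> F y = f y"
    using smooth_onE[OF assms(1) x] by blast
  obtain V H where V: "open V" "x \<in> V" "\<And>k. ck_on k V H" "\<And>y. y \<in> A \<Longrightarrow> y \<in> V \<Longrightarrow> H y = g y"
    using smooth_onE[OF assms(2) x] by blast
  have "ck_on k (U \<inter> V) (\<lambda>x. c (F x) (H x))" for k
    by (rule assms(3)[OF open_Int[OF U(1) V(1)] ck_on_mono[OF U(3)] ck_on_mono[OF V(3)]]) auto
  then show "\<exists>U h. open U \<and> x \<in> U \<and> (\<forall>k. ck_on k U h) \<and> (\<forall>y\<in>A \<inter> U. h y = c (f y) (g y))"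
    using U V by (intro exI[of _ "U \<inter> V"] exI[of _ "\<lambda>x. c (F x) (H x)"]) auto
qed

lemma smooth_on_add: "smooth_on A f \<Longrightarrow> smooth_on A g \<Longrightarrow> smooth_on A (\<lambda>x. f x + g x)"
  by (erule (1) smooth_on_combine) (rule ck_on_add)

lemma smooth_on_Pair: "smooth_on A f \<Longrightarrow> smooth_on A g \<Longrightarrow> smooth_on A (\<lambda>x. (f x, g x))"
  by (erule (1) smooth_on_combine) (rule ck_on_Pair)

lemma smooth_on_compose_linear:
  fixes f :: "'a::real_normed_vector \<Rightarrow> 'b::euclidean_space"
  shows "linear L \<Longrightarrow> smooth_on A f \<Longrightarrow> smooth_on A (\<lambda>x. L (f x))"
  using smooth_on_compose[of A f UNIV L] smooth_on_linear by blast

lemma smooth_on_minus: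
  fixes f :: "'a::real_normed_vector \<Rightarrow> 'b::euclidean_space"
  shows "smooth_on A f \<Longrightarrow> smooth_on A (\<lambda>x. - f x)"
  by (rule smooth_on_compose_linear) (simp_all add: linear_iff)

lemma smooth_on_diff:
  fixes f :: "'a::real_normed_vector \<Rightarrow> 'b::euclidean_space"
  shows "smooth_on A f \<Longrightarrow> smooth_on A g \<Longrightarrow> smooth_on A (\<lambda>x. f x - g x)"
  using smooth_on_add[OF _ smooth_on_minus, of A f g] by simp

lemma smooth_on_line: "smooth_on A (\<lambda>t::real. p + t *\<^sub>R v)"
  by (intro smooth_on_add smooth_on_const smooth_on_linear) (simp add: linear_iff scaleR_left_distrib)

lemma smooth_on_continuous_on:
  assumes "smooth_on A f"
  shows "continuous_on A f"
  unfolding continuous_on_eq_continuous_within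
proof
  fix x assume x: "x \<in> A"
  obtain U F where U: "open U" "x \<in> U" "\<And>k. ck_on k U F" "\<And>y. y \<in> A \<Longrightarrow> y \<in> U \<Longrightarrow> F y = f y"
    using smooth_onE[OF assms x] by blast
  have "isCont F x" using ck_on_continuous[OF U(3)] U(1,2) by (simp add: continuous_on_eq_continuous_at)
  then have "continuous (at x within A) F" by (rule continuous_at_imp_continuous_at_within)
  then have "(F \<longlongrightarrow> f x) (at x within A)" using U(2,4) x by (simp add: continuous_within)
  moreover have "\<forall>\<^sub>F y in at x within A. F y = f y"
    using U by (auto simp: eventually_at_topological)
  ultimately show "continuous (at x within A) f"
    unfolding continuous_within by (rule Lim_transform_eventually)
qed

section \<open>Derivatives within a subset, and inverse functions on subspaces\<close>

lemma has_derivative_within_extension: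
  assumes "open U" "p \<in> U" "p \<in> A" "\<And>y. y \<in> A \<Longrightarrow> y \<in> U \<Longrightarrow> g y = f y" "(g has_derivative g') (at p)"
  shows "(f has_derivative g') (at p within A)"
proof -
  have "(f has_derivative g') (at p within (U \<inter> A))"
    using has_derivative_at_withinI[OF assms(5)] assms
    by (rule_tac has_derivative_transform[of p "U \<inter> A" f g]) auto
  moreover have "at p within (U \<inter> A) = at p within A"
    using at_within_open_NO_MATCH at_within_nhd[OF assms(2,1), of A "U \<inter> A"] assms by (metis inf.commute inf.left_idem)
  ultimately show ?thesis by simp
qed

lemma smooth_on_has_derivative:
  assumes "smooth_on A f" "p \<in> A"
  obtains f' where "(f has_derivative f') (at p within A)"
proof -
  obtain U F where U: "open U" "p \<in> U" "\<And>k. ck_on k U F" "\<And>y. y \<in> A \<Longrightarrow> y \<in> U \<Longrightarrow> F y = f y"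
    using smooth_onE[OF assms] by blast
  have "(F has_derivative frechet_derivative F (at p)) (at p)"
    using ck_on_SucE[OF U(3,2)] .
  then show thesis
    using has_derivative_within_extension[OF U(1,2) assms(2), of F f] U(4) that by blast
qed

lemma has_derivative_compose_within:
  assumes "(f has_derivative f') (at x within s)" "(g has_derivative g') (at (f x) within t)" "f ` s \<subseteq> t"
  shows "((\<lambda>x. g (f x)) has_derivative (\<lambda>h. g' (f' h))) (at x within s)"
  using has_derivative_in_compose[OF assms(1) has_derivative_subset[OF assms(2,3)]] .

lemma has_vector_derivative_compose_within:
  assumes "(c has_vector_derivative v) (at t within s)" "(g has_derivative g') (at (c t) within A)" "c ` s \<subseteq> A"
  shows "((\<lambda>x. g (c x)) has_vector_derivative g' v) (at t within s)"
proof -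
  interpret g': bounded_linear g' using assms(2) by (rule has_derivative_bounded_linear)
  show ?thesis
    using has_derivative_compose_within[OF assms(1)[unfolded has_vector_derivative_def] assms(2,3)]
    by (simp add: has_vector_derivative_def g'.scaleR)
qed

lemma line_in_open_subspace:
  fixes p :: "'a::real_normed_vector"
  assumes "subspace E" "openin (top_of_set E) D" "p \<in> D" "v \<in> E"
  obtains \<epsilon> :: real where "\<epsilon> > 0" "\<And>t. t \<in> {-\<epsilon><..<\<epsilon>} \<Longrightarrow> p + t *\<^sub>R v \<in> D"
proof -
  obtain e where e: "e > 0" "ball p e \<inter> E \<subseteq> D" "p \<in> E"
    using assms(2,3) unfolding openin_contains_ball by blast
  \<comment> \<open>The 1 in the denominator covers v = 0.\<close>
  have "p + t *\<^sub>R v \<in> D" if "t \<in> {- (e / (norm v + 1)) <..< e / (norm v + 1)}" for t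
  proof -
    have "\<bar>t\<bar> < e / (norm v + 1)" using that by auto
    then have "\<bar>t\<bar> * (norm v + 1) < e" by (simp add: pos_less_divide_eq add_nonneg_pos)
    moreover have "\<bar>t\<bar> * norm v \<le> \<bar>t\<bar> * (norm v + 1)" by (simp add: mult_left_mono)
    ultimately have "dist p (p + t *\<^sub>R v) < e" by (simp add: dist_norm)
    moreover have "p + t *\<^sub>R v \<in> E" using e(3) assms by (simp add: subspace_add subspace_scale)
    ultimately show ?thesis using e(2) by auto
  qed
  moreover have "e / (norm v + 1) > 0" using e(1) by (simp add: add_nonneg_pos)
  ultimately show thesis using that by blast
qed

lemma has_vector_derivative_line: "((\<lambda>t. p + t *\<^sub>R v) has_vector_derivative v) (at t within s)"
  by (auto intro!: derivative_eq_intros)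

text \<open>Within a thin set a derivative is determined only in the directions of E: a short
  segment through p in such a direction lies in D, and both derivatives give the velocity of the
  same curve, the image of this segment.\<close>

lemma has_derivative_unique_on_subspace:
  fixes f :: "'a::real_normed_vector \<Rightarrow> 'b::real_normed_vector"
  assumes "subspace E" "openin (top_of_set E) D" "p \<in> D" "v \<in> E"
    and "(f has_derivative f1) (at p within D)" "(f has_derivative f2) (at p within D)"
  shows "f1 v = f2 v"
proof -
  obtain \<epsilon> where \<epsilon>: "\<epsilon> > 0" "\<And>t. t \<in> {-\<epsilon><..<\<epsilon>} \<Longrightarrow> p + t *\<^sub>R v \<in> D"
    using line_in_open_subspace[OF assms(1-4)] by blast
  have *: "((\<lambda>t. f (p + t *\<^sub>R v)) has_vector_derivative f' v) (at 0)" if "(f has_derivative f') (at p within D)" for f'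
  proof -
    have "((\<lambda>t. f (p + t *\<^sub>R v)) has_vector_derivative f' v) (at 0 within {-\<epsilon><..<\<epsilon>})"
      by (rule has_vector_derivative_compose_within[OF has_vector_derivative_line])
        (use that \<epsilon> in auto)
    moreover have "at (0::real) within {-\<epsilon><..<\<epsilon>} = at 0"
      using \<epsilon>(1) by (intro at_within_open) auto
    ultimately show ?thesis by simp
  qed
  show ?thesis by (rule vector_derivative_unique_at[OF *[OF assms(5)] *[OF assms(6)]])
qed

text \<open>With a linear projection \<pi> onto E and a local extension F of f, the map z \<mapsto>
  F (\<pi> z) + (z - \<pi> z) extends f to an open set of the whole space. Its derivative at p is
  the identity, on E by hypothesis and on the kernel of \<pi> by construction.\<close>

lemma subspace_inverse_function:
  fixes f :: "'e::euclidean_space \<Rightarrow> 'e"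
  assumes E: "subspace E" and D: "openin (top_of_set E) D" "p \<in> D"
    and f: "smooth_on D f" "f ` D \<subseteq> E"
    and f': "(f has_derivative f') (at p within D)" "\<And>v. v \<in> E \<Longrightarrow> f' v = v"
  obtains D' V g where "openin (top_of_set E) D'" "D' \<subseteq> D" "p \<in> D'" "openin (top_of_set E) V"
    "homeomorphism D' V f g" "smooth_on V g"
proof -
  obtain \<pi> where \<pi>: "linear \<pi>" "range \<pi> \<subseteq> E" "\<And>v. v \<in> E \<Longrightarrow> \<pi> v = v"
    using linear_exists_left_inverse_on[OF linear_ident E inj_on_id2] by blast
  obtain W where W: "open W" "D = E \<inter> W" using D(1) by (auto simp: openin_open)
  obtain U F where U: "open U" "p \<in> U" "\<And>k. ck_on k U F" "\<And>y. y \<in> D \<Longrightarrow> y \<in> U \<Longrightarrow> F y = f y"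
    using smooth_onE[OF f(1) D(2)] by blast
  define U1 where "U1 = \<pi> -` (U \<inter> W)"
  define H where "H z = F (\<pi> z) + (z - \<pi> z)" for z
  have U1: "open U1"
    unfolding U1_def using \<pi>(1) U(1) W(1)
    by (intro open_vimage linear_continuous_on) (auto simp: linear_conv_bounded_linear)
  have pE: "p \<in> E" "\<pi> p = p" using W D(2) \<pi>(3) by auto
  have p: "p \<in> U1" using pE U(2) W D(2) by (auto simp: U1_def)
  have "ck_on k U1 H" for k
    unfolding H_def
  proof (rule ck_on_add[OF U1])
    show "ck_on k U1 (\<lambda>z. F (\<pi> z))"
      by (rule ck_on_compose[OF U1 U(1)]) (use U(3) ck_on_linear[OF U1 \<pi>(1)] U1_def in auto)
    show "ck_on k U1 (\<lambda>z. z - \<pi> z)"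
      by (rule ck_on_linear[OF U1]) (use \<pi>(1) in \<open>intro linear_compose_sub linear_ident\<close>)
  qed
  moreover have "frechet_derivative H (at p) = id"
  proof -
    define F' where "F' = frechet_derivative F (at p)"
    have F': "(F has_derivative F') (at p)"
      unfolding F'_def using ck_on_SucE[OF U(3,2)] .
    have "(f has_derivative F') (at p within D)"
      using has_derivative_within_extension[OF U(1,2) D(2) U(4) F'] by blast
    then have F'v: "F' v = v" if "v \<in> E" for v
      using has_derivative_unique_on_subspace[OF E D that _ f'(1)] f'(2)[OF that] by metis
    have d\<pi>: "(\<pi> has_derivative \<pi>) (at p)"
      using \<pi>(1) by (simp add: linear_conv_bounded_linear bounded_linear_imp_has_derivative)
    have "(H has_derivative (\<lambda>v. F' (\<pi> v) + (v - \<pi> v))) (at p)"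
      unfolding H_def
      by (intro has_derivative_add has_derivative_diff has_derivative_ident d\<pi>
          has_derivative_compose[OF d\<pi>]) (simp add: pE F')
    moreover have "(\<lambda>v. F' (\<pi> v) + (v - \<pi> v)) = id"
      using \<pi>(2) F'v by (auto simp: fun_eq_iff)
    ultimately show ?thesis by (metis frechet_derivative_at)
  qed
  ultimately obtain U' V' g where I: "open U'" "U' \<subseteq> U1" "p \<in> U'" "open V'" "homeomorphism U' V' H g"
    "\<And>k. ck_on k V' g"
    using smooth_inverse_function[OF U1 p] by blast
  have H: "z \<in> D" "H z = f z" if "z \<in> E" "z \<in> U1" for z
    using that U(4) W \<pi>(3) by (auto simp: U1_def H_def)
  \<comment> \<open>The inverse preserves E: solving H (g y) = y for g y leaves only terms in
    E.\<close>
  have g: "g y \<in> E \<inter> U'" "f (g y) = y" if "y \<in> E" "y \<in> V'" for y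
  proof -
    have gU: "g y \<in> U'" "H (g y) = y" using I(5) that by (auto simp: homeomorphism_def)
    then have "\<pi> (g y) \<in> D \<inter> U" using I(2) \<pi>(2) W by (auto simp: U1_def)
    then have "F (\<pi> (g y)) \<in> E" using U(4) f(2) by auto
    moreover have "g y = y - F (\<pi> (g y)) + \<pi> (g y)" using gU(2) by (simp add: H_def algebra_simps)
    ultimately show 1: "g y \<in> E \<inter> U'"
      using that gU(1) \<pi>(2) by (metis E IntI range_subsetD subspace_add subspace_diff)
    show "f (g y) = y" using H(2)[of "g y"] 1 I(2) gU by auto
  qed
  have fz: "f z \<in> E \<inter> V'" "g (f z) = z" if "z \<in> E" "z \<in> U'" for z
  proof -
    have "z \<in> D" "H z = f z" using H that I(2) by auto
    moreover have "H z \<in> V'" "g (H z) = z" using I(5) that by (auto simp: homeomorphism_def)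
    ultimately show "f z \<in> E \<inter> V'" "g (f z) = z"
      using f(2) by auto
  qed
  have gsm: "smooth_on (E \<inter> V') g"
    by (rule smooth_onI) (use I(4,6) in blast)
  have "homeomorphism (E \<inter> U') (E \<inter> V') f g"
  proof (rule homeomorphismI)
    have "E \<inter> U' \<subseteq> D" using H(1) I(2) by auto
    then show "continuous_on (E \<inter> U') f"
      using smooth_on_continuous_on[OF f(1)] continuous_on_subset by blast
    show "continuous_on (E \<inter> V') g"
      using gsm by (rule smooth_on_continuous_on)
  qed (use g fz in auto)
  then show thesis
    using that[of "E \<inter> U'" "E \<inter> V'" g] gsm I H(1) pE(1) by (auto simp: openin_open)
qed

text \<open>This turns an identity between maps into injectivity or surjectivity of differentials on
  the model subspace.\<close>

lemma has_derivative_inverse_within: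
  assumes "subspace E" "openin (top_of_set E) D" "p \<in> D" "v \<in> E"
    and "(f has_derivative f') (at p within D)" "(g has_derivative g') (at (f p) within V)"
    and "f ` D \<subseteq> V" "\<And>x. x \<in> D \<Longrightarrow> g (f x) = x"
  shows "g' (f' v) = v"
proof -
  have "((\<lambda>x. g (f x)) has_derivative (\<lambda>v. g' (f' v))) (at p within D)"
    by (rule has_derivative_compose_within[OF assms(5-7)])
  then have "((\<lambda>x. x) has_derivative (\<lambda>v. g' (f' v))) (at p within D)"
    by (rule has_derivative_transform[OF assms(3), rotated]) (use assms(8) in auto)
  from has_derivative_unique_on_subspace[OF assms(1-4) this has_derivative_ident]
  show ?thesis .
qed

text \<open>At a point of maximal rank the map is, in suitable coordinates, constant along the kernel
  (constant rank theorem); injectivity therefore forces the kernel to vanish there.\<close>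

lemma injective_smooth_imp_immersion_point:
  fixes f :: "'b::euclidean_space \<Rightarrow> 'e::euclidean_space"
  assumes B: "subspace B" and D: "openin (top_of_set B) D" "D \<noteq> {}"
    and f: "smooth_on D f" and inj: "inj_on f D"
  obtains p f' where "p \<in> D" "(f has_derivative f') (at p within D)" "\<And>v. v \<in> B \<Longrightarrow> f' v = 0 \<Longrightarrow> v = 0"
proof -
  define df where "df p = (SOME f'. (f has_derivative f') (at p within D))" for p
  have df: "(f has_derivative df p) (at p within D)" if "p \<in> D" for p
    unfolding df_def using smooth_on_has_derivative[OF f that] by (metis someI)
  have lin: "linear (df p)" if "p \<in> D" for p
    using df[OF that] by (rule has_derivative_linear)
  have "\<exists>p0. p0 \<in> D \<and> (\<forall>q. q \<in> D \<longrightarrow> dim (df q ` B) \<le> dim (df p0 ` B))"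
  proof -
    obtain q where "q \<in> D" using D(2) by blast
    then show ?thesis
      by (intro ex_has_greatest_nat[where k = q and b = "Suc DIM('e)"]) (auto simp: less_Suc_eq_le dim_subset_UNIV)
  qed
  then obtain p0 where p0: "p0 \<in> D" and max: "\<And>q. q \<in> D \<Longrightarrow> dim (df q ` B) \<le> dim (df p0 ` B)"
    by blast
  define f0 where "f0 = df p0"
  have f0: "linear f0" unfolding f0_def using p0 by (rule lin)
  obtain S0 where S0: "range S0 \<subseteq> B" "linear S0" "\<And>v. v \<in> f0 ` B \<Longrightarrow> f0 (S0 v) = v"
    using linear_exists_right_inverse_on[OF f0 B] by blast
  \<comment> \<open>\<open>S0\<close> inverts f0 only on the image of B. The sandwiched
    \<open>S\<close> is a generalized inverse in both senses: f0 S f0 = f0 on B and S f0 S = S. So S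
    f0 projects B onto a complement of the kernel of f0 in B.\<close>
  define S where "S w = S0 (f0 (S0 w))" for w
  have S: "linear S"
    unfolding S_def using linear_compose[OF linear_compose[OF S0(2) f0] S0(2)] by (simp add: o_def)
  have SB: "S w \<in> B" for w using S0(1) by (auto simp: S_def)
  have fS: "f0 (S (f0 b)) = f0 b" if "b \<in> B" for b
    using S0 that by (simp add: S_def)
  have Sf: "S (f0 (S w)) = S w" for w
    using S0 by (simp add: S_def image_subset_iff)
  have "k = 0" if k: "k \<in> B" "f0 k = 0" for k
  proof -
    \<comment> \<open>New coordinates in which S f becomes linear, because S f0 \<Phi> = S f on D.
      The derivative at p0 is the identity.\<close>
    define \<Phi> where "\<Phi> b = b - S (f0 b) + S (f b)" for b
    have linSf: "linear (\<lambda>b. S (f0 b))" using linear_compose[OF f0 S] by (simp add: o_def)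
    have "smooth_on D \<Phi>"
      unfolding \<Phi>_def
      by (rule smooth_on_add[OF smooth_on_diff[OF smooth_on_ident smooth_on_linear[OF linSf]]
            smooth_on_compose_linear[OF S f]])
    moreover have "\<Phi> ` D \<subseteq> B"
      using SB openin_imp_subset[OF D(1)] by (auto simp: \<Phi>_def intro!: subspace_add subspace_diff B)
    moreover have d\<Phi>: "(\<Phi> has_derivative (\<lambda>v. v - S (f0 v) + S (df p v))) (at p within D)" if "p \<in> D" for p
    proof -
      have bl: "bounded_linear S" "bounded_linear (\<lambda>b. S (f0 b))"
        using S linSf by (simp_all add: linear_conv_bounded_linear)
      show ?thesis
        unfolding \<Phi>_def
        by (rule has_derivative_add[OF has_derivative_diff[OF has_derivative_ident
              bounded_linear_imp_has_derivative[OF bl(2)]] bounded_linear.has_derivative[OF bl(1) df[OF that]]])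
    qed
    moreover have "v - S (f0 v) + S (df p0 v) = v" for v by (simp add: f0_def)
    ultimately obtain D' V \<Psi> where D': "openin (top_of_set B) D'" "D' \<subseteq> D" "p0 \<in> D'"
      "openin (top_of_set B) V" "homeomorphism D' V \<Phi> \<Psi>" "smooth_on V \<Psi>"
      using subspace_inverse_function[OF B D(1) p0 _ _ d\<Phi>[OF p0]] by metis
    have \<Phi>\<Psi>: "\<Psi> (\<Phi> x) = x" "\<Phi> x \<in> V" if "x \<in> D'" for x
      using D'(5) that unfolding homeomorphism_def by auto
    have \<Psi>\<Phi>: "\<Phi> (\<Psi> y) = y" "\<Psi> y \<in> D'" if "y \<in> V" for y
      using D'(5) that unfolding homeomorphism_def by auto
    \<comment> \<open>The direction u corresponds to k in the new coordinates, whence S (df p u) =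
      0. On the complement C the map S (df p) is injective, so df p attains the maximal rank already
      on C. Hence df p u is the image of some c in C, and injectivity gives c = 0.\<close>
    have d0: "df p u = 0" if p: "p \<in> D'" and u: "u \<in> B" "u - S (f0 u) + S (df p u) = k" for p u
    proof -
      let ?dP = "\<lambda>v. v - S (f0 v) + S (df p v)"
      have pD: "p \<in> D" using p D'(2) by auto
      obtain \<Psi>' where \<Psi>': "(\<Psi> has_derivative \<Psi>') (at (\<Phi> p) within V)"
        using smooth_on_has_derivative[OF D'(6) \<Phi>\<Psi>(2)[OF p]] by blast
      have "S (f0 u) - S (f0 (S (f0 u))) + S (f0 (S (df p u))) = S (f0 k)"
        using u(2)[symmetric] by (simp add: linear_add linear_diff f0 S)
      then have z: "S (df p u) = 0"
        using k(2) Sf S by (simp add: linear_0)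
      have injd: "v = 0" if "v \<in> B" "?dP v = 0" for v
      proof -
        have "\<Psi>' (?dP v) = v"
          by (rule has_derivative_inverse_within[OF B D'(1) p that(1)
                has_derivative_subset[OF d\<Phi>[OF pD] D'(2)] \<Psi>']) (use \<Phi>\<Psi> in auto)
        then show ?thesis using that(2) \<Psi>' by (metis has_derivative_linear linear_0)
      qed
      define C where "C = (\<lambda>b. S (f0 b)) ` B"
      have C: "subspace C" "C \<subseteq> B" using SB linSf B by (auto simp: C_def intro: linear_subspace_image)
      have injC: "v = 0" if "v \<in> C" "S (df p v) = 0" for v
      proof (rule injd)
        show "v \<in> B" using that C by auto
        have "S (f0 v) = v" using that(1) Sf by (auto simp: C_def)
        then show "?dP v = 0" using that(2) by simp
      qed
      have dimC: "dim C = dim (f0 ` B)"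
      proof -
        have "inj_on S (f0 ` B)" using fS by (intro inj_on_inverseI[of _ f0]) auto
        then have "dim (S ` f0 ` B) = dim (f0 ` B)"
          using S linear_subspace_image[OF f0 B] by (intro dim_image_eq) (auto simp: span_eq_iff[THEN iffD2])
        then show ?thesis by (simp add: C_def image_image)
      qed
      have "inj_on (df p) C"
        using injC S lin[OF pD] C(1) by (intro linear_inj_on_iff_eq_0[THEN iffD2]) (auto simp: linear_0)
      then have "dim (df p ` C) = dim C"
        using lin[OF pD] C(1) by (intro dim_image_eq) (auto simp: span_eq_iff[THEN iffD2])
      then have "dim (df p ` B) \<le> dim (df p ` C)"
        using max[OF pD] dimC by (simp add: f0_def)
      then have "df p ` C = df p ` B"
        using C lin[OF pD] B by (intro subspace_dim_equal linear_subspace_image) auto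
      then obtain c where "c \<in> C" "df p u = df p c" using u(1) by (metis imageE imageI)
      then show ?thesis using injC[of c] z lin[OF pD] by (simp add: linear_0)
    qed
    \<comment> \<open>By \<open>d0\<close>, f is constant along the coordinate line in direction k,
      so injectivity of f forces k = 0.\<close>
    obtain \<epsilon> where \<epsilon>: "\<epsilon> > 0" "\<And>t. t \<in> {-\<epsilon><..<\<epsilon>} \<Longrightarrow> \<Phi> p0 + t *\<^sub>R k \<in> V"
      using line_in_open_subspace[OF B D'(4) \<Phi>\<Psi>(2)[OF D'(3)] k(1)] by blast
    let ?I = "{-\<epsilon><..<\<epsilon>}" and ?c = "\<lambda>t. \<Psi> (\<Phi> p0 + t *\<^sub>R k)"
    have "((\<lambda>t. f (?c t)) has_derivative (\<lambda>h. 0)) (at t within ?I)" if t: "t \<in> ?I" for t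
    proof -
      let ?q = "\<Phi> p0 + t *\<^sub>R k"
      have q: "?q \<in> V" using \<epsilon>(2)[OF t] .
      then have cD: "?c t \<in> D'" "?c t \<in> D" using \<Psi>\<Phi> D'(2) by auto
      obtain \<Psi>' where \<Psi>': "(\<Psi> has_derivative \<Psi>') (at ?q within V)"
        using smooth_on_has_derivative[OF D'(6) q] by blast
      have c': "(?c has_vector_derivative \<Psi>' k) (at t within ?I)"
        by (rule has_vector_derivative_compose_within[OF has_vector_derivative_line \<Psi>']) (use \<epsilon>(2) in auto)
      have "df (?c t) (\<Psi>' k) = 0"
      proof (rule d0[OF cD(1)])
        show "\<Psi>' k - S (f0 (\<Psi>' k)) + S (df (?c t) (\<Psi>' k)) = k"
          using has_derivative_inverse_within[OF B D'(4) q k(1) \<Psi>'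
                has_derivative_subset[OF d\<Phi>[OF cD(2)] D'(2)]] \<Psi>\<Phi> by blast
        then have "\<Psi>' k = k + S (f0 (\<Psi>' k)) - S (df (?c t) (\<Psi>' k))" by (simp add: algebra_simps)
        moreover have "k + S (f0 (\<Psi>' k)) - S (df (?c t) (\<Psi>' k)) \<in> B"
          by (intro subspace_add subspace_diff B k(1) SB)
        ultimately show "\<Psi>' k \<in> B" by simp
      qed
      moreover have "((\<lambda>t. f (?c t)) has_vector_derivative df (?c t) (\<Psi>' k)) (at t within ?I)"
        by (rule has_vector_derivative_compose_within[OF c' df[OF cD(2)]]) (use \<epsilon>(2) \<Psi>\<Phi> D'(2) in auto)
      ultimately show ?thesis by (simp add: has_vector_derivative_def)
    qed
    then have "\<exists>z. \<forall>t\<in>?I. f (?c t) = z"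
      by (intro has_derivative_zero_constant) auto
    then obtain z where z: "\<And>t. t \<in> ?I \<Longrightarrow> f (?c t) = z" by blast
    have I: "\<epsilon> / 2 \<in> ?I" "0 \<in> ?I" using \<epsilon>(1) by auto
    have mem: "?c (\<epsilon>/2) \<in> D" "?c 0 \<in> D" using \<epsilon>(2) I \<Psi>\<Phi>(2) D'(2) by (auto simp del: scaleR_zero_left)
    have "f (?c (\<epsilon>/2)) = f (?c 0)" using z I by metis
    then have "?c (\<epsilon>/2) = ?c 0" using inj mem by (meson inj_onD)
    then have "\<Phi> p0 + (\<epsilon>/2) *\<^sub>R k = \<Phi> p0 + 0 *\<^sub>R k" using \<Psi>\<Phi>(1) \<epsilon>(2) I by metis
    then show "k = 0" using \<epsilon>(1) by simp
  qed
  then show thesis using that[OF p0 df[OF p0]] by (simp add: f0_def)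
qed

section \<open>Tangent planes\<close>

lemma tangent_planeI:
  assumes "\<epsilon> > 0" "smooth_on {-\<epsilon><..<\<epsilon>} \<gamma>" "\<And>t. t \<in> {-\<epsilon><..<\<epsilon>} \<Longrightarrow> \<gamma> t \<in> A" "\<gamma> 0 = p"
    "(\<gamma> has_vector_derivative v) (at 0)"
  shows "v \<in> tangent_plane A p"
  unfolding tangent_plane_def using assms by blast

lemma tangent_planeE:
  assumes "v \<in> tangent_plane A p"
  obtains \<epsilon> :: real and \<gamma> where "\<epsilon> > 0" "smooth_on {-\<epsilon><..<\<epsilon>} \<gamma>" "\<And>t. t \<in> {-\<epsilon><..<\<epsilon>} \<Longrightarrow> \<gamma> t \<in> A" "\<gamma> 0 = p"
    "(\<gamma> has_vector_derivative v) (at 0)"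
  using assms unfolding tangent_plane_def by blast

lemma tangent_plane_mono: "A \<subseteq> B \<Longrightarrow> tangent_plane A p \<subseteq> tangent_plane B p"
  unfolding tangent_plane_def by blast

lemma at_zero_within_interval: "\<epsilon> > 0 \<Longrightarrow> at (0::real) within {-\<epsilon><..<\<epsilon>} = at 0"
  by (intro at_within_open) auto

lemma tangent_plane_image:
  assumes "smooth_on A f" "(f has_derivative f') (at p within A)" "v \<in> tangent_plane A p"
  shows "f' v \<in> tangent_plane (f ` A) (f p)"
proof -
  obtain \<epsilon> \<gamma> where \<gamma>: "\<epsilon> > 0" "smooth_on {-\<epsilon><..<\<epsilon>} \<gamma>" "\<And>t. t \<in> {-\<epsilon><..<\<epsilon>} \<Longrightarrow> \<gamma> t \<in> A" "\<gamma> 0 = p"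
    "(\<gamma> has_vector_derivative v) (at 0)"
    using tangent_planeE[OF assms(3)] by blast
  have sub: "\<gamma> ` {-\<epsilon><..<\<epsilon>} \<subseteq> A" using \<gamma>(3) by blast
  have "((\<lambda>t. f (\<gamma> t)) has_vector_derivative f' v) (at 0 within {-\<epsilon><..<\<epsilon>})"
    by (rule has_vector_derivative_compose_within[OF has_vector_derivative_at_within[OF \<gamma>(5)] _ sub])
      (simp add: \<gamma>(4) assms(2))
  then have "((\<lambda>t. f (\<gamma> t)) has_vector_derivative f' v) (at 0)"
    by (simp add: at_zero_within_interval[OF \<gamma>(1)])
  moreover have "smooth_on {-\<epsilon><..<\<epsilon>} (\<lambda>t. f (\<gamma> t))"
    by (rule smooth_on_compose[OF \<gamma>(2) assms(1) sub])
  ultimately show ?thesis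
    using \<gamma>(1,3,4) by (intro tangent_planeI[of \<epsilon> "\<lambda>t. f (\<gamma> t)"]) auto
qed

text \<open>A linear projection onto E fixes the curve, hence also its velocity.\<close>

lemma tangent_plane_subset_subspace:
  assumes "subspace E" "A \<subseteq> E"
  shows "tangent_plane A p \<subseteq> E"
proof
  fix v assume "v \<in> tangent_plane A p"
  then obtain \<epsilon> \<gamma> where \<gamma>: "\<epsilon> > 0" "\<And>t. t \<in> {-\<epsilon><..<\<epsilon>} \<Longrightarrow> \<gamma> t \<in> A" "(\<gamma> has_vector_derivative v) (at 0)"
    by (rule tangent_planeE) (rule that)
  obtain \<pi> where \<pi>: "linear \<pi>" "range \<pi> \<subseteq> E" "\<And>v. v \<in> E \<Longrightarrow> \<pi> v = v"
    using linear_exists_left_inverse_on[OF linear_ident assms(1) inj_on_id2] by blast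
  have "((\<lambda>t. \<pi> (\<gamma> t)) has_vector_derivative \<pi> v) (at 0)"
    using \<pi>(1) \<gamma>(3) by (simp add: bounded_linear.has_vector_derivative linear_conv_bounded_linear)
  then have "((\<lambda>t. \<pi> (\<gamma> t)) has_vector_derivative \<pi> v) (at 0 within {-\<epsilon><..<\<epsilon>})"
    by (rule has_vector_derivative_at_within)
  then have "(\<gamma> has_vector_derivative \<pi> v) (at 0 within {-\<epsilon><..<\<epsilon>})"
  proof (rule has_vector_derivative_transform[rotated 2])
    show "\<gamma> x = \<pi> (\<gamma> x)" if "x \<in> {-\<epsilon><..<\<epsilon>}" for x
      using \<gamma>(2)[OF that] assms(2) \<pi>(3)[of "\<gamma> x"] by (simp add: subset_iff)
  qed (use \<gamma>(1) in simp)
  then have "(\<gamma> has_vector_derivative \<pi> v) (at 0)"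
    by (simp add: at_zero_within_interval[OF \<gamma>(1)])
  then have "\<pi> v = v" by (rule vector_derivative_unique_at[OF _ \<gamma>(3)])
  moreover have "\<pi> v \<in> E" using \<pi>(2) by blast
  ultimately show "v \<in> E" by simp
qed

lemma tangent_plane_openin_subspace:
  assumes "subspace E" "openin (top_of_set E) D" "p \<in> D"
  shows "tangent_plane D p = E"
proof
  show "tangent_plane D p \<subseteq> E"
    by (rule tangent_plane_subset_subspace[OF assms(1) openin_imp_subset[OF assms(2)]])
  show "E \<subseteq> tangent_plane D p"
  proof
    fix v assume "v \<in> E"
    then obtain \<epsilon> where \<epsilon>: "\<epsilon> > 0" "\<And>t. t \<in> {-\<epsilon><..<\<epsilon>} \<Longrightarrow> p + t *\<^sub>R v \<in> D"
      using line_in_open_subspace[OF assms] by blast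
    then show "v \<in> tangent_plane D p"
      by (intro tangent_planeI[of \<epsilon> "\<lambda>t. p + t *\<^sub>R v"] smooth_on_line has_vector_derivative_line) auto
  qed
qed

text \<open>By continuity, a curve through p stays in B for a short time.\<close>

lemma tangent_plane_local:
  assumes "openin (top_of_set A) B" "p \<in> B"
  shows "tangent_plane B p = tangent_plane A p"
proof
  show "tangent_plane B p \<subseteq> tangent_plane A p"
    by (rule tangent_plane_mono[OF openin_imp_subset[OF assms(1)]])
  show "tangent_plane A p \<subseteq> tangent_plane B p"
  proof
    fix v assume "v \<in> tangent_plane A p"
    then obtain \<epsilon> \<gamma> where \<gamma>: "\<epsilon> > 0" "smooth_on {-\<epsilon><..<\<epsilon>} \<gamma>" "\<And>t. t \<in> {-\<epsilon><..<\<epsilon>} \<Longrightarrow> \<gamma> t \<in> A" "\<gamma> 0 = p"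
      "(\<gamma> has_vector_derivative v) (at 0)"
      using tangent_planeE by blast
    obtain W where W: "open W" "B = A \<inter> W" using assms(1) by (auto simp: openin_open)
    have "isCont \<gamma> 0"
      using \<gamma>(5) by (rule has_vector_derivative_continuous)
    then have "\<forall>\<^sub>F t in at 0. \<gamma> t \<in> W"
      using W assms(2) \<gamma>(4) by (auto simp: isCont_def tendsto_def)
    then obtain \<delta> where \<delta>: "\<delta> > 0" "\<And>t. t \<noteq> 0 \<Longrightarrow> dist t 0 < \<delta> \<Longrightarrow> \<gamma> t \<in> W"
      unfolding eventually_at by blast
    show "v \<in> tangent_plane B p"
    proof (rule tangent_planeI[of "min \<epsilon> \<delta>" \<gamma>, OF _ smooth_on_subset[OF \<gamma>(2)]])
      fix t assume t: "t \<in> {- min \<epsilon> \<delta><..<min \<epsilon> \<delta>}"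
      then have "\<gamma> t \<in> A" by (intro \<gamma>(3)) auto
      moreover have "\<gamma> t \<in> W"
        using t \<delta>(2)[of t] W assms(2) \<gamma>(4) by (cases "t = 0") (auto simp: dist_real_def)
      ultimately show "\<gamma> t \<in> B" using W by simp
    qed (use \<gamma> \<delta> in auto)
  qed
qed

lemma tangent_plane_translation:
  "tangent_plane ((\<lambda>x. x - a) ` A) (p - a) = tangent_plane A p"
proof -
  have sub: "tangent_plane A p \<subseteq> tangent_plane ((\<lambda>x. x - a) ` A) (p - a)" for A p and a :: 'a
  proof
    fix v assume v: "v \<in> tangent_plane A p"
    have "((\<lambda>x. x - a) has_derivative (\<lambda>x. x)) (at p within A)"
      by (auto intro!: derivative_eq_intros)
    from tangent_plane_image[OF smooth_on_diff[OF smooth_on_ident smooth_on_const] this v]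
    show "v \<in> tangent_plane ((\<lambda>x. x - a) ` A) (p - a)" .
  qed
  have "tangent_plane ((\<lambda>x. x - a) ` A) (p - a) \<subseteq> tangent_plane A p"
    using sub[of "(\<lambda>x. x - a) ` A" "p - a" "- a"] by (simp add: image_image)
  with sub show ?thesis by blast
qed

section \<open>Charts and submanifolds\<close>

text \<open>This makes the model subspace of a chart canonical, whereas \<open>is_chart\<close>
  merely asserts that one exists. A short segment in direction v stays in D, and the difference of
  two of its points is a multiple of v.\<close>

lemma span_openin_subspace:
  fixes E :: "'a::real_normed_vector set"
  assumes "subspace E" "openin (top_of_set E) D" "D \<noteq> {}"
  shows "span D = E"
proof
  show "span D \<subseteq> E" by (rule span_minimal[OF openin_imp_subset[OF assms(2)] assms(1)])
  obtain p where p: "p \<in> D" using assms(3) by blast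
  show "E \<subseteq> span D"
  proof
    fix v assume "v \<in> E"
    then obtain \<epsilon> where \<epsilon>: "\<epsilon> > 0" "\<And>t. t \<in> {-\<epsilon><..<\<epsilon>} \<Longrightarrow> p + t *\<^sub>R v \<in> D"
      using line_in_open_subspace[OF assms(1,2) p] by blast
    have "p + (\<epsilon> / 2) *\<^sub>R v - p \<in> span D"
      by (rule span_diff) (use \<epsilon> p in \<open>auto intro!: span_base\<close>)
    then have "(\<epsilon> / 2) *\<^sub>R v \<in> span D" by simp
    then have "(2 / \<epsilon>) *\<^sub>R ((\<epsilon> / 2) *\<^sub>R v) \<in> span D" by (rule span_scale)
    then show "v \<in> span D" using \<epsilon>(1) by simp
  qed
qed

lemma openin_top_of_set_Int:
  "openin (top_of_set E) D \<Longrightarrow> V \<subseteq> E \<Longrightarrow> openin (top_of_set V) (V \<inter> D)"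
  unfolding openin_open by blast

lemma is_chart_open: "is_chart T n (U, \<phi>) \<Longrightarrow> openin T U"
  by (simp add: is_chart_def)

lemma is_chart_homeomorphic: "is_chart T n (U, \<phi>) \<Longrightarrow> homeomorphic_map (subtopology T U) (top_of_set (\<phi> ` U)) \<phi>"
  by (simp add: is_chart_def)

lemma is_chart_topspace: "is_chart T n (U, \<phi>) \<Longrightarrow> topspace (subtopology T U) = U"
  using is_chart_open openin_subset topspace_subtopology_subset by metis

lemma is_chart_inj:
  assumes "is_chart T n (U, \<phi>)"
  shows "inj_on \<phi> U"
  using homeomorphic_imp_injective_map[OF is_chart_homeomorphic[OF assms]] is_chart_topspace[OF assms] by simp

text \<open>For empty U the span is the zero space, so the dimension is asserted only for nonempty
  U.\<close>

lemma is_chart_model: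
  assumes "is_chart T n (U, \<phi>)"
  shows "openin (top_of_set (span (\<phi> ` U))) (\<phi> ` U)" "U \<noteq> {} \<Longrightarrow> dim (span (\<phi> ` U)) = n"
proof -
  obtain E where E: "subspace E" "dim E = n" "openin (top_of_set E) (\<phi> ` U)"
    using assms by (auto simp: is_chart_def)
  have span: "span (\<phi> ` U) = E" if "U \<noteq> {}"
    using span_openin_subspace[OF E(1,3)] that by simp
  show "openin (top_of_set (span (\<phi> ` U))) (\<phi> ` U)"
    using E(3) span by (cases "U = {}") auto
  show "U \<noteq> {} \<Longrightarrow> dim (span (\<phi> ` U)) = n" using E(2) span by (metis dim_span)
qed

lemma is_chart_image_open:
  assumes "is_chart T n (U, \<phi>)" "openin T W"
  shows "openin (top_of_set (span (\<phi> ` U))) (\<phi> ` (U \<inter> W))"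
proof -
  have "openin (subtopology T U) (U \<inter> W)"
    using assms(2) by (metis inf_commute openin_subtopology_Int)
  then have "openin (top_of_set (\<phi> ` U)) (\<phi> ` (U \<inter> W))"
    using homeomorphic_imp_open_map[OF is_chart_homeomorphic[OF assms(1)]] by (simp add: open_map_def)
  then show ?thesis using is_chart_model(1)[OF assms(1)] openin_trans by blast
qed

lemma is_chart_inv_continuous:
  assumes "is_chart T n (U, \<phi>)"
  shows "continuous_map (top_of_set (\<phi> ` U)) T (inv_into U \<phi>)"
proof -
  obtain g where g: "homeomorphic_maps (subtopology T U) (top_of_set (\<phi> ` U)) \<phi> g"
    using is_chart_homeomorphic[OF assms] homeomorphic_map_maps by blast
  then have "continuous_map (top_of_set (\<phi> ` U)) T g"
    by (simp add: homeomorphic_maps_def continuous_map_in_subtopology)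
  moreover have "g y = inv_into U \<phi> y" if "y \<in> \<phi> ` U" for y
    using g that is_chart_inj[OF assms] is_chart_topspace[OF assms] by (auto simp: homeomorphic_maps_def)
  ultimately show ?thesis by (auto intro: continuous_map_eq)
qed

lemma is_chart_continuous: "is_chart T n (U, \<phi>) \<Longrightarrow> continuous_map (subtopology T U) euclidean \<phi>"
  using homeomorphic_imp_continuous_map[OF is_chart_homeomorphic] continuous_map_in_subtopology by metis

lemma atlas_subset_smooth_charts: "smooth_manifold M \<Longrightarrow> atlas M \<subseteq> smooth_charts M"
  by (auto simp: smooth_manifold_def smooth_charts_def)

lemma smooth_charts_is_chart: "c \<in> smooth_charts M \<Longrightarrow> is_chart (mspace M) (mdim M) c"
  by (simp add: smooth_charts_def)

text \<open>A chart of the maximal atlas is compatible by definition only with the charts in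
  \<open>atlas\<close>; near each point the transition factors through one of these.\<close>

lemma smooth_charts_transition:
  assumes M: "smooth_manifold M" and c: "(U, \<phi>) \<in> smooth_charts M" "(V, \<psi>) \<in> smooth_charts M"
  shows "smooth_on (\<phi> ` (U \<inter> V)) (\<psi> \<circ> inv_into U \<phi>)"
proof (rule smooth_on_local)
  fix p assume "p \<in> \<phi> ` (U \<inter> V)"
  then obtain x where x: "x \<in> U" "x \<in> V" "p = \<phi> x" by blast
  note cU = smooth_charts_is_chart[OF c(1)] and cV = smooth_charts_is_chart[OF c(2)]
  have "x \<in> topspace (mspace M)" using x is_chart_open[OF cU] openin_subset by blast
  then obtain W \<omega> where W: "(W, \<omega>) \<in> atlas M" "x \<in> W"
    using M unfolding smooth_manifold_def by fastforce
  have cW: "is_chart (mspace M) (mdim M) (W, \<omega>)" using M W(1) by (auto simp: smooth_manifold_def)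
  have 1: "smooth_on (\<phi> ` (U \<inter> W)) (\<omega> \<circ> inv_into U \<phi>)"
    using c(1) W(1) by (auto simp: smooth_charts_def compatible_charts_def)
  have 2: "smooth_on (\<omega> ` (V \<inter> W)) (\<psi> \<circ> inv_into W \<omega>)"
    using c(2) W(1) by (auto simp: smooth_charts_def compatible_charts_def)
  let ?B = "\<phi> ` (U \<inter> V \<inter> W)"
  have inv: "inv_into U \<phi> (\<phi> y) = y" if "y \<in> U" for y using is_chart_inj[OF cU] that by simp
  have invW: "inv_into W \<omega> (\<omega> y) = y" if "y \<in> W" for y using is_chart_inj[OF cW] that by simp
  have "smooth_on ?B (\<lambda>z. (\<psi> \<circ> inv_into W \<omega>) ((\<omega> \<circ> inv_into U \<phi>) z))"
    by (rule smooth_on_compose[OF smooth_on_subset[OF 1] 2]) (auto simp: inv)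
  then have "smooth_on ?B (\<psi> \<circ> inv_into U \<phi>)"
    by (rule smooth_on_cong) (auto simp: inv invW)
  moreover have "openin (top_of_set (\<phi> ` (U \<inter> V))) ?B"
  proof -
    have "openin (top_of_set (span (\<phi> ` U))) (\<phi> ` (U \<inter> (V \<inter> W)))"
      by (rule is_chart_image_open[OF cU openin_Int[OF is_chart_open[OF cV] is_chart_open[OF cW]]])
    then have "openin (top_of_set (span (\<phi> ` U))) ?B" by (simp add: Int_assoc)
    then show ?thesis
      by (rule openin_subset_trans) (auto intro: span_base)
  qed
  ultimately show "\<exists>B. openin (top_of_set (\<phi> ` (U \<inter> V))) B \<and> p \<in> B \<and> smooth_on B (\<psi> \<circ> inv_into U \<phi>)"
    using x W(2) by blast
qed

lemma smooth_charts_cover: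
  assumes "smooth_manifold M" "x \<in> topspace (mspace M)"
  obtains U \<phi> where "(U, \<phi>) \<in> atlas M" "(U, \<phi>) \<in> smooth_charts M" "x \<in> U"
proof -
  obtain c where "c \<in> atlas M" "x \<in> fst c"
    using assms unfolding smooth_manifold_def by blast
  then show thesis
    using that[of "fst c" "snd c"] atlas_subset_smooth_charts[OF assms(1)] by auto
qed

text \<open>\<open>smooth_map\<close> tests only atlas charts, whereas adapted charts and the charts
  witnessing condition (B) come from the maximal atlas. Near each point the coordinate expression is
  therefore composed with transition maps on both sides. It is restricted to \<open>D\<close>
  because F may leave W.\<close>

lemma smooth_map_prod_coordinates:
  assumes A: "smooth_manifold A" and B: "smooth_manifold B" and C: "smooth_manifold C"
    and F: "smooth_map (prod_manifold A B) C F"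
    and U: "(U, \<phi>) \<in> smooth_charts A" and V: "(V, \<psi>) \<in> smooth_charts B" and W: "(W, \<omega>) \<in> smooth_charts C"
  defines "f \<equiv> \<lambda>(a, b). F (inv_into U \<phi> a, inv_into V \<psi> b)"
  defines "D \<equiv> {z \<in> \<phi> ` U \<times> \<psi> ` V. f z \<in> W}"
  shows "openin (top_of_set (span (\<phi> ` U) \<times> span (\<psi> ` V))) D"
    and "smooth_on D (\<lambda>z. \<omega> (f z))"
proof -
  note cU = smooth_charts_is_chart[OF U] and cV = smooth_charts_is_chart[OF V] and cW = smooth_charts_is_chart[OF W]
  have Fc: "continuous_map (prod_topology (mspace A) (mspace B)) (mspace C) F"
    using F by (simp add: smooth_map_def prod_manifold_def)
  define h where "h = (\<lambda>z. (inv_into U \<phi> (fst z), inv_into V \<psi> (snd z)))"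
  have h: "continuous_map (top_of_set (\<phi> ` U \<times> \<psi> ` V)) (prod_topology (mspace A) (mspace B)) h"
  proof -
    have "continuous_map (prod_topology (top_of_set (\<phi> ` U)) (top_of_set (\<psi> ` V))) (prod_topology (mspace A) (mspace B)) h"
      unfolding h_def
      using continuous_map_compose[OF continuous_map_fst is_chart_inv_continuous[OF cU]]
        continuous_map_compose[OF continuous_map_snd is_chart_inv_continuous[OF cV]]
      by (intro continuous_map_pairedI) (simp_all add: o_def del: prod_topology_subtopology_eu)
    then show ?thesis by simp
  qed
  have f: "f = F \<circ> h" by (auto simp: f_def h_def)
  have pre: "openin (top_of_set (span (\<phi> ` U) \<times> span (\<psi> ` V))) {z \<in> \<phi> ` U \<times> \<psi> ` V. h z \<in> Q}"
    if "openin (prod_topology (mspace A) (mspace B)) Q" for Q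
  proof -
    have "openin (top_of_set (\<phi> ` U \<times> \<psi> ` V)) {z \<in> \<phi> ` U \<times> \<psi> ` V. h z \<in> Q}"
      using openin_continuous_map_preimage[OF h that] by simp
    moreover have "openin (top_of_set (span (\<phi> ` U) \<times> span (\<psi> ` V))) (\<phi> ` U \<times> \<psi> ` V)"
      by (rule openin_Times[OF is_chart_model(1)[OF cU] is_chart_model(1)[OF cV]])
    ultimately show ?thesis by (rule openin_trans)
  qed
  have pre2: "openin (prod_topology (mspace A) (mspace B)) {z \<in> topspace (prod_topology (mspace A) (mspace B)). F z \<in> W'}"
    if "openin (mspace C) W'" for W'
    using openin_continuous_map_preimage[OF Fc that] .
  have hU: "h z \<in> U \<times> V" if "z \<in> \<phi> ` U \<times> \<psi> ` V" for z
    using that by (auto simp: h_def intro: inv_into_into)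
  have UT: "U \<times> V \<subseteq> topspace (prod_topology (mspace A) (mspace B))"
    using openin_subset[OF is_chart_open[OF cU]] openin_subset[OF is_chart_open[OF cV]] by auto
  have "D = {z \<in> \<phi> ` U \<times> \<psi> ` V. h z \<in> {z \<in> topspace (prod_topology (mspace A) (mspace B)). F z \<in> W}}"
    unfolding D_def f comp_apply using subsetD[OF UT hU] by blast
  then show D: "openin (top_of_set (span (\<phi> ` U) \<times> span (\<psi> ` V))) D"
    using pre[OF pre2[OF is_chart_open[OF cW]]] by simp
  show "smooth_on D (\<lambda>z. \<omega> (f z))"
  proof (rule smooth_on_local)
    fix z assume z: "z \<in> D"
    then have hz: "h z \<in> U \<times> V" and fz: "F (h z) \<in> W" using hU by (auto simp: D_def f)
    have hT: "fst (h z) \<in> topspace (mspace A)" "snd (h z) \<in> topspace (mspace B)"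
      using subsetD[OF UT hz] by (simp_all add: mem_Times_iff)
    obtain U' \<phi>' where U': "(U', \<phi>') \<in> atlas A" "(U', \<phi>') \<in> smooth_charts A" "fst (h z) \<in> U'"
      using smooth_charts_cover[OF A hT(1)] by metis
    obtain V' \<psi>' where V': "(V', \<psi>') \<in> atlas B" "(V', \<psi>') \<in> smooth_charts B" "snd (h z) \<in> V'"
      using smooth_charts_cover[OF B hT(2)] by metis
    obtain W' \<omega>' where W': "(W', \<omega>') \<in> atlas C" "(W', \<omega>') \<in> smooth_charts C" "F (h z) \<in> W'"
      using smooth_charts_cover[OF C subsetD[OF openin_subset[OF is_chart_open[OF cW]] fz]] by metis
    note cU' = smooth_charts_is_chart[OF U'(2)] and cV' = smooth_charts_is_chart[OF V'(2)]
      and cW' = smooth_charts_is_chart[OF W'(2)]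
    let ?Q = "{z \<in> topspace (prod_topology (mspace A) (mspace B)). F z \<in> W'} \<inter> U' \<times> V'"
    have Q: "openin (prod_topology (mspace A) (mspace B)) ?Q"
      using pre2[OF is_chart_open[OF cW']] is_chart_open[OF cU'] is_chart_open[OF cV']
      by (intro openin_Int) (auto simp: openin_prod_Times_iff)
    \<comment> \<open>The part of \<open>D\<close> on which the atlas charts chosen at z can be
      inserted at both arguments and at the value.\<close>
    define N where "N = D \<inter> {z \<in> \<phi> ` U \<times> \<psi> ` V. h z \<in> ?Q}"
    have "openin (top_of_set (span (\<phi> ` U) \<times> span (\<psi> ` V))) N"
      unfolding N_def by (rule openin_Int[OF D pre[OF Q]])
    then have 1: "openin (top_of_set D) N"
      by (rule openin_subset_trans) (use openin_imp_subset[OF D] in \<open>auto simp: N_def\<close>)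
    have "h z \<in> ?Q" "z \<in> \<phi> ` U \<times> \<psi> ` V" using U'(3) V'(3) W'(3) subsetD[OF UT hz] z by (simp_all add: mem_Times_iff D_def)
    then have 2: "z \<in> N" using z by (simp add: N_def)
    have invW': "inv_into W' \<omega>' (\<omega>' a) = a" if "a \<in> W'" for a using is_chart_inj[OF cW'] that by simp
    let ?g = "\<lambda>z. (\<phi>' (inv_into U \<phi> (fst z)), \<psi>' (inv_into V \<psi> (snd z)))"
    let ?F = "\<lambda>z. \<omega>' (F (inv_into (U' \<times> V') (map_prod \<phi>' \<psi>') z))"
    have inj: "inj_on (map_prod \<phi>' \<psi>') (U' \<times> V')"
      using is_chart_inj[OF cU'] is_chart_inj[OF cV'] by (rule map_prod_inj_on)
    have inv: "inv_into (U' \<times> V') (map_prod \<phi>' \<psi>') (\<phi>' a, \<psi>' b) = (a, b)" if "a \<in> U'" "b \<in> V'" for a b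
      using inv_into_f_f[OF inj, of "(a, b)"] that by simp
    have sF: "smooth_on (map_prod \<phi>' \<psi>' ` (U' \<times> V' \<inter> F -` W')) ?F"
    proof -
      have "(U' \<times> V', map_prod \<phi>' \<psi>') \<in> atlas (prod_manifold A B)"
        using U'(1) V'(1) by (auto simp: prod_manifold_def)
      then have "smooth_on (map_prod \<phi>' \<psi>' ` (U' \<times> V' \<inter> F -` W')) (\<omega>' \<circ> F \<circ> inv_into (U' \<times> V') (map_prod \<phi>' \<psi>'))"
        using F W'(1) unfolding smooth_map_def by fast
      then show ?thesis by (simp add: o_def)
    qed
    have s1: "smooth_on N (\<lambda>z. (\<phi>' \<circ> inv_into U \<phi>) (fst z))"
      by (rule smooth_on_compose[OF smooth_on_linear[OF linear_fst] smooth_charts_transition[OF A U U'(2)]])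
        (fastforce simp: N_def h_def is_chart_inj[OF cU])
    have s2: "smooth_on N (\<lambda>z. (\<psi>' \<circ> inv_into V \<psi>) (snd z))"
      by (rule smooth_on_compose[OF smooth_on_linear[OF linear_snd] smooth_charts_transition[OF B V V'(2)]])
        (fastforce simp: N_def h_def is_chart_inj[OF cV])
    have hB: "fst (h y) \<in> U'" "snd (h y) \<in> V'" "F (h y) \<in> W'" "F (h y) \<in> W" if "y \<in> N" for y
      using that by (auto simp: N_def D_def f)
    have sg: "smooth_on N ?g"
      using s1 s2 by (intro smooth_on_Pair) (simp_all only: comp_apply)
    have s3: "smooth_on N (\<lambda>z. ?F (?g z))"
    proof (rule smooth_on_compose[OF sg sF])
      show "?g ` N \<subseteq> map_prod \<phi>' \<psi>' ` (U' \<times> V' \<inter> F -` W')"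
      proof
        fix w assume "w \<in> ?g ` N"
        then obtain y where y: "y \<in> N" "w = ?g y" by (rule imageE) (rule that)
        then have "w = map_prod \<phi>' \<psi>' (h y)" by (simp add: h_def)
        moreover have "h y \<in> U' \<times> V' \<inter> F -` W'" using hB[OF y(1)] by (simp add: mem_Times_iff)
        ultimately show "w \<in> map_prod \<phi>' \<psi>' ` (U' \<times> V' \<inter> F -` W')" by (simp only: image_eqI)
      qed
    qed
    have Fg: "?F (?g y) = \<omega>' (F (h y))" if "y \<in> N" for y
      using hB(1,2)[OF that] inv by (simp add: h_def)
    have "smooth_on N (\<lambda>z. (\<omega> \<circ> inv_into W' \<omega>') (?F (?g z)))"
      by (rule smooth_on_compose[OF s3 smooth_charts_transition[OF C W'(2) W]])
        (use Fg hB in auto)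
    then have "smooth_on N (\<lambda>z. \<omega> (f z))"
    proof (rule smooth_on_cong)
      fix y assume "y \<in> N"
      then show "(\<omega> \<circ> inv_into W' \<omega>') (?F (?g y)) = \<omega> (f y)"
        using Fg hB invW' by (simp add: f)
    qed
    with 1 2 show "\<exists>B. openin (top_of_set D) B \<and> z \<in> B \<and> smooth_on B (\<lambda>z. \<omega> (f z))"
      by blast
  qed
qed

section \<open>Submanifolds and their tangent planes\<close>

lemma adapted_chartsE:
  assumes "(U, \<phi>) \<in> adapted_charts M k A"
  obtains V where "(U, \<phi>) \<in> smooth_charts M" "subspace V" "dim V = k" "V \<subseteq> span (\<phi> ` U)" "\<phi> ` (U \<inter> A) = \<phi> ` U \<inter> V"
proof -
  obtain V where "(U, \<phi>) \<in> smooth_charts M \<and> subspace V \<and> dim V = k \<and> V \<subseteq> span (\<phi> ` U) \<and> \<phi> ` (U \<inter> A) = \<phi> ` U \<inter> V"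
    using assms unfolding adapted_charts_def by blast
  then show thesis by (intro that) auto
qed

lemma submanifoldE:
  assumes "submanifold M k A" "x \<in> A"
  obtains U \<phi> V where "(U, \<phi>) \<in> smooth_charts M" "x \<in> U" "subspace V" "dim V = k" "V \<subseteq> span (\<phi> ` U)"
    "\<phi> ` (U \<inter> A) = \<phi> ` U \<inter> V"
proof -
  obtain U \<phi> where U: "(U, \<phi>) \<in> adapted_charts M k A" "x \<in> U"
    using assms unfolding submanifold_def by fast
  show thesis using U(1) by (rule adapted_chartsE) (rule that[OF _ U(2)])
qed

text \<open>In an adapted chart the tangent plane is the linear model V. The differential of the
  transition to \<kappa> carries it over, injectively because the differential of the reverse
  transition inverts it.\<close>

lemma tangent_plane_submanifold:
  assumes M: "smooth_manifold M" and A: "submanifold M k A" and U: "(U, \<kappa>) \<in> smooth_charts M"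
    and y: "y \<in> A" "y \<in> U"
  shows "subspace (tangent_plane (\<kappa> ` (A \<inter> U)) (\<kappa> y))" and "dim (tangent_plane (\<kappa> ` (A \<inter> U)) (\<kappa> y)) = k"
proof -
  obtain W \<phi> V where W: "(W, \<phi>) \<in> smooth_charts M" "y \<in> W" "subspace V" "dim V = k" "V \<subseteq> span (\<phi> ` W)"
    "\<phi> ` (W \<inter> A) = \<phi> ` W \<inter> V"
    using submanifoldE[OF A y(1)] by metis
  note cW = smooth_charts_is_chart[OF W(1)] and cU = smooth_charts_is_chart[OF U]
  have invW: "inv_into W \<phi> (\<phi> a) = a" if "a \<in> W" for a using is_chart_inj[OF cW] that by simp
  have invU: "inv_into U \<kappa> (\<kappa> a) = a" if "a \<in> U" for a using is_chart_inj[OF cU] that by simp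
  let ?t = "\<kappa> \<circ> inv_into W \<phi>" and ?s = "\<phi> \<circ> inv_into U \<kappa>"
  let ?D = "\<phi> ` (W \<inter> U)" and ?D' = "\<kappa> ` (U \<inter> W)"
  have t: "smooth_on ?D ?t" by (rule smooth_charts_transition[OF M W(1) U])
  have s: "smooth_on ?D' ?s" by (rule smooth_charts_transition[OF M U W(1)])
  have D: "openin (top_of_set (span (\<phi> ` W))) ?D" by (rule is_chart_image_open[OF cW is_chart_open[OF cU]])
  have D': "openin (top_of_set (span (\<kappa> ` U))) ?D'" by (rule is_chart_image_open[OF cU is_chart_open[OF cW]])
  have yD: "\<phi> y \<in> ?D" "\<kappa> y \<in> ?D'" using y W(2) by auto
  have ty: "?t (\<phi> y) = \<kappa> y" and sy: "?s (\<kappa> y) = \<phi> y" using y W(2) invW invU by auto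
  obtain t' where t': "(?t has_derivative t') (at (\<phi> y) within ?D)"
    using smooth_on_has_derivative[OF t yD(1)] by blast
  obtain s' where s': "(?s has_derivative s') (at (\<kappa> y) within ?D')"
    using smooth_on_has_derivative[OF s yD(2)] by blast
  have st: "s' (t' v) = v" if "v \<in> span (\<phi> ` W)" for v
  proof (rule has_derivative_inverse_within[OF subspace_span D yD(1) that t'])
    show "(?s has_derivative s') (at (?t (\<phi> y)) within ?D')" unfolding ty by (rule s')
  qed (use invW invU in auto)
  have ts: "t' (s' v) = v" if "v \<in> span (\<kappa> ` U)" for v
  proof (rule has_derivative_inverse_within[OF subspace_span D' yD(2) that s'])
    show "(?t has_derivative t') (at (?s (\<kappa> y)) within ?D)" unfolding sy by (rule t')
  qed (use invW invU in auto)
  have lt: "linear t'" using t' by (rule has_derivative_linear)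
  let ?DV = "\<phi> ` (W \<inter> U \<inter> A)" and ?DA = "\<kappa> ` (U \<inter> W \<inter> A)"
  have DVeq: "?DV = ?D \<inter> V"
  proof -
    have "?DV = ?D \<inter> \<phi> ` (W \<inter> A)"
      using is_chart_inj[OF cW] by (auto simp: inj_on_def)
    then show ?thesis using W(6) by auto
  qed
  have "openin (top_of_set V) (V \<inter> ?D)"
    using D W(5) by (rule openin_top_of_set_Int)
  then have DV: "openin (top_of_set V) ?DV" unfolding DVeq by (subst Int_commute)
  have TDV: "tangent_plane ?DV (\<phi> y) = V"
    by (rule tangent_plane_openin_subspace[OF W(3) DV]) (use y W(2) in auto)
  have TDA: "tangent_plane ?DA (\<kappa> y) = tangent_plane (\<kappa> ` (A \<inter> U)) (\<kappa> y)"
  proof (rule tangent_plane_local)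
    have eq: "?DA = \<kappa> ` (A \<inter> U) \<inter> ?D'"
      using is_chart_inj[OF cU] by (auto simp: inj_on_def)
    show "openin (top_of_set (\<kappa> ` (A \<inter> U))) ?DA"
      unfolding eq by (rule openin_top_of_set_Int[OF D']) (auto intro: span_base)
    show "\<kappa> y \<in> ?DA" using y W(2) by auto
  qed
  have "t' ` V \<subseteq> tangent_plane ?DA (\<kappa> y)"
  proof
    fix w assume "w \<in> t' ` V"
    then obtain v where v: "v \<in> V" "w = t' v" by blast
    have sub: "?DV \<subseteq> ?D" by auto
    have "t' v \<in> tangent_plane (?t ` ?DV) (?t (\<phi> y))"
      by (rule tangent_plane_image[OF smooth_on_subset[OF t sub] has_derivative_subset[OF t' sub]])
        (use v TDV in simp)
    moreover have "?t ` ?DV = ?DA"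
      unfolding image_image by (rule image_cong) (use invW in auto)
    ultimately show "w \<in> tangent_plane ?DA (\<kappa> y)" using v ty by simp
  qed
  moreover have "tangent_plane ?DA (\<kappa> y) \<subseteq> t' ` V"
  proof
    fix w assume w: "w \<in> tangent_plane ?DA (\<kappa> y)"
    have sub: "?DA \<subseteq> ?D'" by auto
    have "s' w \<in> tangent_plane (?s ` ?DA) (?s (\<kappa> y))"
      by (rule tangent_plane_image[OF smooth_on_subset[OF s sub] has_derivative_subset[OF s' sub] w])
    moreover have "?s ` ?DA = ?DV"
      unfolding image_image by (rule image_cong) (use invU in auto)
    ultimately have "s' w \<in> V" using TDV sy by simp
    moreover have "w \<in> span (\<kappa> ` U)"
    proof -
      have "?DA \<subseteq> span (\<kappa> ` U)" by (auto intro: span_base)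
      then show ?thesis using tangent_plane_subset_subspace[OF subspace_span] w by blast
    qed
    ultimately show "w \<in> t' ` V" using ts by (metis imageI)
  qed
  ultimately have T: "tangent_plane (\<kappa> ` (A \<inter> U)) (\<kappa> y) = t' ` V" using TDA by simp
  show "subspace (tangent_plane (\<kappa> ` (A \<inter> U)) (\<kappa> y))"
    unfolding T using lt W(3) by (rule linear_subspace_image)
  have "inj_on t' V" using st W(5) by (intro inj_on_inverseI[of _ s']) auto
  moreover have "span V = V" using W(3) by (simp add: span_eq_iff)
  ultimately show "dim (tangent_plane (\<kappa> ` (A \<inter> U)) (\<kappa> y)) = k"
    unfolding T using dim_image_eq[OF lt, of V] W(4) by metis
qed

text \<open>The definite description is well posed because k is the dimension of a tangent plane.
  This takes a point: the empty set is a submanifold of every dimension.\<close>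

lemma submanifold_dim_eq:
  assumes "smooth_manifold M" "submanifold M k A" "A \<noteq> {}"
  shows "submanifold_dim M A = k"
  unfolding submanifold_dim_def
proof (rule the_equality)
  show "submanifold M k A" by (rule assms(2))
  fix j assume j: "submanifold M j A"
  obtain x where x: "x \<in> A" using assms(3) by blast
  then have "x \<in> topspace (mspace M)" using assms(2) by (auto simp: submanifold_def)
  then obtain U \<phi> where U: "(U, \<phi>) \<in> smooth_charts M" "x \<in> U"
    using smooth_charts_cover[OF assms(1)] by metis
  show "j = k"
    using tangent_plane_submanifold(2)[OF assms(1) j U(1) x U(2)]
      tangent_plane_submanifold(2)[OF assms(1,2) U(1) x U(2)] by simp
qed

lemma smooth_manifold_induced:
  assumes M: "smooth_manifold M" and A: "submanifold M k A" "A \<noteq> {}"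
  shows "smooth_manifold (induced_manifold M A)"
proof -
  note dim = submanifold_dim_eq[OF M A]
  let ?N = "induced_manifold M A"
  have N: "mspace ?N = subtopology (mspace M) A" "mdim ?N = k"
    "atlas ?N = {(U \<inter> A, \<phi>) | U \<phi>. (U, \<phi>) \<in> adapted_charts M k A}"
    using dim by (simp_all add: induced_manifold_def)
  have AT: "A \<subseteq> topspace (mspace M)" using A(1) by (simp add: submanifold_def)
  show ?thesis
    unfolding smooth_manifold_def
  proof (intro conjI ballI)
    show "Hausdorff_space (mspace ?N)"
      using M by (simp add: N smooth_manifold_def Hausdorff_space_subtopology)
    show "second_countable (mspace ?N)"
      using M by (simp add: N smooth_manifold_def second_countable_subtopology)
    have "x \<in> \<Union> (fst ` atlas ?N)" if "x \<in> A" for x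
    proof -
      obtain U \<phi> where "(U, \<phi>) \<in> adapted_charts M k A" "x \<in> U"
        using A(1) \<open>x \<in> A\<close> unfolding submanifold_def by fast
      then have "(U \<inter> A, \<phi>) \<in> atlas ?N" unfolding N(3) by blast
      then show ?thesis using \<open>x \<in> U\<close> that by (intro UnionI[of "U \<inter> A"]) (auto simp: image_iff intro!: bexI)
    qed
    moreover have "topspace (mspace ?N) = A" using AT by (simp add: N inf.absorb2)
    ultimately show "\<Union> (fst ` atlas ?N) = topspace (mspace ?N)" by (auto simp: N(3))
  next
    fix c assume "c \<in> atlas ?N"
    then obtain U \<phi> where c: "c = (U \<inter> A, \<phi>)" "(U, \<phi>) \<in> adapted_charts M k A"
      by (auto simp: N(3))
    then obtain V where V: "(U, \<phi>) \<in> smooth_charts M" "subspace V" "dim V = k" "V \<subseteq> span (\<phi> ` U)"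
      "\<phi> ` (U \<inter> A) = \<phi> ` U \<inter> V"
      by - (erule adapted_chartsE, rule that)
    note cU = smooth_charts_is_chart[OF V(1)]
    have "openin (top_of_set V) (V \<inter> \<phi> ` U)"
      using is_chart_model(1)[OF cU] V(4) by (rule openin_top_of_set_Int)
    then have "openin (top_of_set V) (\<phi> ` (U \<inter> A))" unfolding V(5) by (subst Int_commute)
    moreover have "openin (subtopology (mspace M) A) (U \<inter> A)"
      using is_chart_open[OF cU] by (rule openin_subtopology_Int)
    moreover have "homeomorphic_map (subtopology (subtopology (mspace M) A) (U \<inter> A)) (top_of_set (\<phi> ` (U \<inter> A))) \<phi>"
    proof -
      have UT: "U \<subseteq> topspace (mspace M)" using openin_subset[OF is_chart_open[OF cU]] .
      have "homeomorphic_map (subtopology (subtopology (mspace M) U) A) (subtopology (top_of_set (\<phi> ` U)) (\<phi> ` (U \<inter> A))) \<phi>"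
        using UT by (intro homeomorphic_map_subtopologies[OF is_chart_homeomorphic[OF cU]])
          (auto simp: inf.absorb2)
      moreover have "A \<inter> (U \<inter> A) = U \<inter> A" "\<phi> ` U \<inter> \<phi> ` (U \<inter> A) = \<phi> ` (U \<inter> A)" by auto
      ultimately show ?thesis by (simp add: subtopology_subtopology)
    qed
    ultimately show "is_chart (mspace ?N) (mdim ?N) c"
      using V(2,3) by (auto simp: is_chart_def c(1) N)
  next
    \<comment> \<open>Half of compatibility, for all pairs, is enough by symmetry. On the smaller
      image, the inverse of the restricted chart agrees with the original inverse.\<close>
    have half: "smooth_on (\<phi> ` (U \<inter> A \<inter> (V \<inter> A))) (\<psi> \<circ> inv_into (U \<inter> A) \<phi>)"
      if "(U, \<phi>) \<in> adapted_charts M k A" "(V, \<psi>) \<in> adapted_charts M k A" for U \<phi> V \<psi>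
    proof -
      have c: "(U, \<phi>) \<in> smooth_charts M" "(V, \<psi>) \<in> smooth_charts M"
        using that by (blast elim: adapted_chartsE)+
      have inj: "inj_on \<phi> U" by (rule is_chart_inj[OF smooth_charts_is_chart[OF c(1)]])
      have "smooth_on (\<phi> ` (U \<inter> A \<inter> (V \<inter> A))) (\<psi> \<circ> inv_into U \<phi>)"
        by (rule smooth_on_subset[OF smooth_charts_transition[OF M c]]) auto
      then show ?thesis
      proof (rule smooth_on_cong)
        fix z assume "z \<in> \<phi> ` (U \<inter> A \<inter> (V \<inter> A))"
        then obtain a where "a \<in> U" "a \<in> A" "z = \<phi> a" by blast
        moreover have "inj_on \<phi> (U \<inter> A)" using inj by (rule inj_on_subset) auto
        ultimately show "(\<psi> \<circ> inv_into U \<phi>) z = (\<psi> \<circ> inv_into (U \<inter> A) \<phi>) z"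
          using inj by simp
      qed
    qed
    fix c c' assume "c \<in> atlas ?N" "c' \<in> atlas ?N"
    then obtain U \<phi> V \<psi> where c: "c = (U \<inter> A, \<phi>)" "c' = (V \<inter> A, \<psi>)"
      and "(U, \<phi>) \<in> adapted_charts M k A" "(V, \<psi>) \<in> adapted_charts M k A"
      unfolding N(3) by blast
    then show "compatible_charts c c'"
      using half[of U \<phi> V \<psi>] half[of V \<psi> U \<phi>]
      by (simp add: c compatible_charts_def Int_commute[of "V \<inter> A"])
  qed
qed

section \<open>Smooth maps on products with one argument fixed\<close>

lemma openin_Times_section:
  assumes "openin (top_of_set (E \<times> F)) D" "a \<in> E"
  shows "openin (top_of_set F) {z. (a, z) \<in> D}"
proof -
  obtain W where W: "open W" "D = (E \<times> F) \<inter> W" using assms(1) by (auto simp: openin_open)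
  have "open (Pair a -` W)" by (intro open_vimage[OF W(1)] continuous_intros)
  moreover have "{z. (a, z) \<in> D} = F \<inter> (Pair a -` W)" using W(2) assms(2) by auto
  ultimately show ?thesis by (auto simp: openin_open)
qed

lemma openin_Times_section':
  assumes "openin (top_of_set (E \<times> F)) D" "b \<in> F"
  shows "openin (top_of_set E) {z. (z, b) \<in> D}"
proof -
  obtain W where W: "open W" "D = (E \<times> F) \<inter> W" using assms(1) by (auto simp: openin_open)
  have "open ((\<lambda>z. (z, b)) -` W)" by (intro open_vimage[OF W(1)] continuous_intros)
  moreover have "{z. (z, b) \<in> D} = E \<inter> ((\<lambda>z. (z, b)) -` W)" using W(2) assms(2) by auto
  ultimately show ?thesis by (auto simp: openin_open)
qed

text \<open>Applied to the multiplication and to the action, this yields the translations by a group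
  element.\<close>

lemma smooth_map_prod_section:
  assumes A: "smooth_manifold A" and B: "smooth_manifold B" and C: "smooth_manifold C"
    and F: "smooth_map (prod_manifold A B) C F"
    and V: "(V, \<psi>) \<in> smooth_charts B" and W: "(W, \<omega>) \<in> smooth_charts C" and a: "a \<in> topspace (mspace A)"
  defines "D \<equiv> {z \<in> \<psi> ` V. F (a, inv_into V \<psi> z) \<in> W}"
  shows "openin (top_of_set (span (\<psi> ` V))) D" and "smooth_on D (\<lambda>z. \<omega> (F (a, inv_into V \<psi> z)))"
proof -
  obtain U \<phi> where U: "(U, \<phi>) \<in> smooth_charts A" "a \<in> U" using smooth_charts_cover[OF A a] by metis
  have inv: "inv_into U \<phi> (\<phi> a) = a" using is_chart_inj[OF smooth_charts_is_chart[OF U(1)]] U(2) by simp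
  note coord = smooth_map_prod_coordinates[OF A B C F U(1) V W]
  have mem: "z \<in> D \<longleftrightarrow> (\<phi> a, z) \<in> {z \<in> \<phi> ` U \<times> \<psi> ` V. (\<lambda>(a, b). F (inv_into U \<phi> a, inv_into V \<psi> b)) z \<in> W}" for z
    using U(2) inv by (auto simp: D_def)
  show "openin (top_of_set (span (\<psi> ` V))) D"
    using openin_Times_section[OF coord(1), of "\<phi> a"] U(2) unfolding mem[symmetric] by (simp add: span_base)
  have "smooth_on D (\<lambda>z. (\<lambda>z. \<omega> ((\<lambda>(a, b). F (inv_into U \<phi> a, inv_into V \<psi> b)) z)) (\<phi> a, z))"
    by (rule smooth_on_compose[OF smooth_on_Pair[OF smooth_on_const smooth_on_ident] coord(2)]) (use mem in blast)
  then show "smooth_on D (\<lambda>z. \<omega> (F (a, inv_into V \<psi> z)))" by (simp add: inv)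
qed

text \<open>Applied to the action, this yields the orbit maps.\<close>

lemma smooth_map_prod_section':
  assumes A: "smooth_manifold A" and B: "smooth_manifold B" and C: "smooth_manifold C"
    and F: "smooth_map (prod_manifold A B) C F"
    and U: "(U, \<phi>) \<in> smooth_charts A" and W: "(W, \<omega>) \<in> smooth_charts C" and b: "b \<in> topspace (mspace B)"
  defines "D \<equiv> {z \<in> \<phi> ` U. F (inv_into U \<phi> z, b) \<in> W}"
  shows "openin (top_of_set (span (\<phi> ` U))) D" and "smooth_on D (\<lambda>z. \<omega> (F (inv_into U \<phi> z, b)))"
proof -
  obtain V \<psi> where V: "(V, \<psi>) \<in> smooth_charts B" "b \<in> V" using smooth_charts_cover[OF B b] by metis
  have inv: "inv_into V \<psi> (\<psi> b) = b" using is_chart_inj[OF smooth_charts_is_chart[OF V(1)]] V(2) by simp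
  note coord = smooth_map_prod_coordinates[OF A B C F U V(1) W]
  have mem: "z \<in> D \<longleftrightarrow> (z, \<psi> b) \<in> {z \<in> \<phi> ` U \<times> \<psi> ` V. (\<lambda>(a, b). F (inv_into U \<phi> a, inv_into V \<psi> b)) z \<in> W}" for z
    using V(2) inv by (auto simp: D_def)
  show "openin (top_of_set (span (\<phi> ` U))) D"
    using openin_Times_section'[OF coord(1), of "\<psi> b"] V(2) unfolding mem[symmetric] by (simp add: span_base)
  have "smooth_on D (\<lambda>z. (\<lambda>z. \<omega> ((\<lambda>(a, b). F (inv_into U \<phi> a, inv_into V \<psi> b)) z)) (z, \<psi> b))"
    by (rule smooth_on_compose[OF smooth_on_Pair[OF smooth_on_ident smooth_on_const] coord(2)]) (use mem in blast)
  then show "smooth_on D (\<lambda>z. \<omega> (F (inv_into U \<phi> z, b)))" by (simp add: inv)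
qed

section \<open>Free actions of compact Lie groups\<close>

locale free_compact_action =
  fixes G :: "'g monoid" and L :: "('g, 'b::euclidean_space) manifold"
    and M :: "('p, 'e::euclidean_space) manifold" and \<alpha> :: "'g \<Rightarrow> 'p \<Rightarrow> 'p"
  assumes lie: "lie_group G L" and compact: "compact_space (mspace L)"
    and M: "smooth_manifold M"
    and act: "smooth_action G L M \<alpha>" and free: "free_action G (topspace (mspace M)) \<alpha>"
begin

abbreviation "T \<equiv> mspace M"
abbreviation "TQ \<equiv> orbit_topology G T \<alpha>"
abbreviation "orb \<equiv> orbit G \<alpha>"
abbreviation "Q \<equiv> quotient_manifold G L M \<alpha>"

sublocale group_action G "topspace T" \<alpha>
  using act by (simp add: smooth_action_def)

sublocale grp: group G
  using lie by (simp add: lie_group_def)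

lemma L: "smooth_manifold L"
  using lie by (simp add: lie_group_def)

lemma carrier: "topspace (mspace L) = carrier G"
  using lie by (simp add: lie_group_def)

lemma act_smooth: "smooth_map (prod_manifold L M) M (\<lambda>(g, x). \<alpha> g x)"
  using act by (simp add: smooth_action_def)

lemma mult_smooth: "smooth_map (prod_manifold L L) L (\<lambda>(g, h). g \<otimes>\<^bsub>G\<^esub> h)"
  using lie by (simp add: lie_group_def)

lemma act_closed: "g \<in> carrier G \<Longrightarrow> x \<in> topspace T \<Longrightarrow> \<alpha> g x \<in> topspace T"
  using element_image by blast

lemma act_one: "x \<in> topspace T \<Longrightarrow> \<alpha> \<one>\<^bsub>G\<^esub> x = x"
  using id_eq_one by (metis restrict_apply')

lemma act_mult: "g \<in> carrier G \<Longrightarrow> h \<in> carrier G \<Longrightarrow> x \<in> topspace T \<Longrightarrow> \<alpha> (g \<otimes>\<^bsub>G\<^esub> h) x = \<alpha> g (\<alpha> h x)"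
  using composition_rule by blast

lemma act_inv: "g \<in> carrier G \<Longrightarrow> x \<in> topspace T \<Longrightarrow> \<alpha> (inv\<^bsub>G\<^esub> g) (\<alpha> g x) = x"
  using orbit_sym_aux by blast

lemma act_inv': "g \<in> carrier G \<Longrightarrow> x \<in> topspace T \<Longrightarrow> \<alpha> g (\<alpha> (inv\<^bsub>G\<^esub> g) x) = x"
  using act_inv[of "inv\<^bsub>G\<^esub> g" x] by simp

lemma act_free:
  assumes "g \<in> carrier G" "h \<in> carrier G" "x \<in> topspace T" "\<alpha> g x = \<alpha> h x"
  shows "g = h"
proof -
  have "\<alpha> (inv\<^bsub>G\<^esub> h \<otimes>\<^bsub>G\<^esub> g) x = x"
    using assms act_inv by (simp add: act_mult)
  moreover have "inv\<^bsub>G\<^esub> h \<otimes>\<^bsub>G\<^esub> g \<in> carrier G" using assms by simp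
  ultimately have "inv\<^bsub>G\<^esub> h \<otimes>\<^bsub>G\<^esub> g = \<one>\<^bsub>G\<^esub>"
    using free assms(1-3) unfolding free_action_def by blast
  then show ?thesis using assms(1,2) by (metis grp.inv_inv grp.inv_closed grp.inv_equality)
qed

lemma act_continuous: "continuous_map (prod_topology (mspace L) T) T (\<lambda>(g, x). \<alpha> g x)"
  using act_smooth by (simp add: smooth_map_def prod_manifold_def)

lemma translation_continuous:
  assumes "g \<in> carrier G"
  shows "continuous_map T T (\<alpha> g)"
proof -
  have "continuous_map T (prod_topology (mspace L) T) (\<lambda>x. (g, x))"
    using assms carrier by (intro continuous_map_pairedI) (auto simp: continuous_map_const)
  from continuous_map_compose[OF this act_continuous] show ?thesis by (simp add: o_def)
qed

lemma translation_image:
  assumes "g \<in> carrier G" "W \<subseteq> topspace T"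
  shows "\<alpha> g ` W = {x \<in> topspace T. \<alpha> (inv\<^bsub>G\<^esub> g) x \<in> W}"
proof safe
  fix x assume "x \<in> W"
  then have "x \<in> topspace T" using assms(2) by blast
  then show "\<alpha> g x \<in> topspace T" "\<alpha> (inv\<^bsub>G\<^esub> g) (\<alpha> g x) \<in> W"
    using assms(1) \<open>x \<in> W\<close> act_closed act_inv by auto
next
  fix x assume "x \<in> topspace T" "\<alpha> (inv\<^bsub>G\<^esub> g) x \<in> W"
  then show "x \<in> \<alpha> g ` W" using act_inv'[OF assms(1)] by (metis image_eqI)
qed

lemma translation_open:
  assumes "g \<in> carrier G" "openin T W"
  shows "openin T (\<alpha> g ` W)"
  using openin_continuous_map_preimage[OF translation_continuous[OF grp.inv_closed[OF assms(1)]] assms(2)]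
    translation_image[OF assms(1) openin_subset[OF assms(2)]] by simp

lemma orb_eq_iff:
  assumes "x \<in> topspace T" "y \<in> topspace T"
  shows "orb x = orb y \<longleftrightarrow> (\<exists>g\<in>carrier G. \<alpha> g x = y)"
proof
  assume "orb x = orb y"
  then have "y \<in> orb x" using orbit_refl[OF assms(2)] by simp
  then show "\<exists>g\<in>carrier G. \<alpha> g x = y" by (auto simp: orbit_def)
next
  assume "\<exists>g\<in>carrier G. \<alpha> g x = y"
  then obtain g where g: "g \<in> carrier G" "\<alpha> g x = y" by blast
  have *: "orb (\<alpha> k z) \<subseteq> orb z" if "k \<in> carrier G" "z \<in> topspace T" for k z
    using that by (auto simp: orbit_def) (metis act_mult grp.m_closed)
  have "orb y \<subseteq> orb x" using *[of g x] g assms by simp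
  moreover have "orb x \<subseteq> orb y" using *[of "inv\<^bsub>G\<^esub> g" y] g assms act_inv by force
  ultimately show "orb x = orb y" by blast
qed

lemma orb_translate: "g \<in> carrier G \<Longrightarrow> x \<in> topspace T \<Longrightarrow> orb (\<alpha> g x) = orb x"
  using orb_eq_iff act_closed by metis

section \<open>Topology of the orbit space\<close>

lemma topspace_TQ: "topspace TQ = orb ` topspace T"
proof -
  have "openin TQ (orbits G (topspace T) \<alpha>)"
  proof -
    have "{x \<in> topspace T. orb x \<in> orbits G (topspace T) \<alpha>} = topspace T" by (auto simp: orbits_def)
    then show ?thesis by (simp add: openin_orbit_topology)
  qed
  then have "orbits G (topspace T) \<alpha> \<subseteq> topspace TQ" by (rule openin_subset)
  moreover have "topspace TQ \<subseteq> orbits G (topspace T) \<alpha>"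
    using openin_topspace[of TQ] by (simp only: openin_orbit_topology)
  moreover have "orbits G (topspace T) \<alpha> = orb ` topspace T" by (auto simp: orbits_def)
  ultimately show ?thesis by simp
qed

lemma orb_continuous: "continuous_map T TQ orb"
  using topspace_TQ by (auto simp: continuous_map_def openin_orbit_topology)

text \<open>The saturation of W is a union of translates and hence open with W; this makes
  \<open>orb\<close> an open map.\<close>

lemma orb_image_preimage:
  assumes "W \<subseteq> topspace T"
  shows "{x \<in> topspace T. orb x \<in> orb ` W} = (\<Union>g\<in>carrier G. \<alpha> g ` W)"
proof safe
  fix x w assume "x \<in> topspace T" "orb x = orb w" "w \<in> W"
  then obtain g where "g \<in> carrier G" "\<alpha> g w = x" using orb_eq_iff assms by (metis subsetD)
  then show "x \<in> (\<Union>g\<in>carrier G. \<alpha> g ` W)" using \<open>w \<in> W\<close> by blast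
next
  fix g w assume "g \<in> carrier G" "w \<in> W"
  then show "\<alpha> g w \<in> topspace T" "orb (\<alpha> g w) \<in> orb ` W"
    using act_closed orb_translate assms by auto
qed

lemma orb_open_map: "open_map T TQ orb"
  unfolding open_map_def openin_orbit_topology
proof (intro allI impI conjI)
  fix W assume W: "openin T W"
  then have WT: "W \<subseteq> topspace T" by (rule openin_subset)
  then show "orb ` W \<subseteq> orbits G (topspace T) \<alpha>" by (auto simp: orbits_def)
  show "openin T {x \<in> topspace T. orb x \<in> orb ` W}"
    unfolding orb_image_preimage[OF WT] using translation_open[OF _ W] by blast
qed

text \<open>Since M is Hausdorff, the triples (g, u, v) with gu \<noteq> v form an open set. It
  contains C \<times> {(x, y)}, and as C is compact, the tube lemma allows (x, y) to be replaced by
  a neighbourhood. With C the whole group this separates orbits; with y = x and C the complement of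
  a neighbourhood of the unit it makes slices meet orbits at most once.\<close>

lemma separate_translates:
  assumes C: "compactin (mspace L) C" and x: "x \<in> topspace T" and y: "y \<in> topspace T"
    and ne: "\<And>g. g \<in> C \<Longrightarrow> \<alpha> g x \<noteq> y"
  obtains N N' where "openin T N" "x \<in> N" "openin T N'" "y \<in> N'"
    "\<And>g u. g \<in> C \<Longrightarrow> u \<in> N \<Longrightarrow> \<alpha> g u \<notin> N'"
proof -
  let ?P = "prod_topology (mspace L) (prod_topology T T)"
  have CG: "C \<subseteq> carrier G" using compactin_subset_topspace[OF C] carrier by simp
  define h :: "'g \<times> 'p \<times> 'p \<Rightarrow> 'p \<times> 'p" where "h = (\<lambda>z. (\<alpha> (fst z) (fst (snd z)), snd (snd z)))"
  have "continuous_map ?P (prod_topology T T) h"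
    unfolding h_def
  proof (intro continuous_map_pairedI)
    have "continuous_map ?P (prod_topology (mspace L) T) (\<lambda>z. (fst z, fst (snd z)))"
      using continuous_map_compose[OF continuous_map_snd continuous_map_fst]
      by (intro continuous_map_pairedI continuous_map_fst) (simp add: o_def)
    from continuous_map_compose[OF this act_continuous]
    show "continuous_map ?P T (\<lambda>z. \<alpha> (fst z) (fst (snd z)))" by (simp add: o_def)
    show "continuous_map ?P T (\<lambda>z. snd (snd z))"
      using continuous_map_compose[OF continuous_map_snd continuous_map_snd] by (simp add: o_def)
  qed
  moreover have "openin (prod_topology T T) (topspace T \<times> topspace T - (\<lambda>x. (x, x)) ` topspace T)"
  proof -
    have "Hausdorff_space T" using M by (simp add: smooth_manifold_def)
    then have "closedin (prod_topology T T) ((\<lambda>x. (x, x)) ` topspace T)"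
      by (simp add: Hausdorff_space_closedin_diagonal)
    then show ?thesis using openin_diff[OF openin_topspace[of "prod_topology T T"]] by simp
  qed
  ultimately have W: "openin ?P {z \<in> topspace ?P. h z \<in> topspace T \<times> topspace T - (\<lambda>x. (x, x)) ` topspace T}"
    by (rule openin_continuous_map_preimage)
  have sub: "C \<times> {(x, y)} \<subseteq> {z \<in> topspace ?P. h z \<in> topspace T \<times> topspace T - (\<lambda>x. (x, x)) ` topspace T}"
    using subsetD[OF CG] x y ne act_closed carrier by (auto simp: h_def dest: sym)
  obtain U V where UV: "openin (prod_topology T T) V" "C \<subseteq> U" "(x, y) \<in> V"
    "U \<times> V \<subseteq> {z \<in> topspace ?P. h z \<in> topspace T \<times> topspace T - (\<lambda>x. (x, x)) ` topspace T}"
    using tube_lemma_left[OF W C _ sub] x y by auto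
  obtain N N' where N: "openin T N" "openin T N'" "x \<in> N" "y \<in> N'" "N \<times> N' \<subseteq> V"
    using UV(1,3) unfolding openin_prod_topology_alt by metis
  have "\<alpha> g u \<notin> N'" if "g \<in> C" "u \<in> N" for g u
  proof
    assume "\<alpha> g u \<in> N'"
    then have "(g, (u, \<alpha> g u)) \<in> U \<times> V" using that N(5) UV(2) by blast
    then show False using UV(4) by (auto simp: h_def)
  qed
  then show thesis using that N by blast
qed

lemma Hausdorff_TQ: "Hausdorff_space TQ"
  unfolding Hausdorff_space_def
proof (intro allI impI)
  fix p q assume pq: "p \<in> topspace TQ \<and> q \<in> topspace TQ \<and> p \<noteq> q"
  then obtain x y where xy: "x \<in> topspace T" "p = orb x" "y \<in> topspace T" "q = orb y"
    by (auto simp: topspace_TQ)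
  then have ne: "\<alpha> g x \<noteq> y" if "g \<in> carrier G" for g using pq orb_eq_iff that by metis
  have "compactin (mspace L) (carrier G)" using compact carrier by (simp add: compact_space_def)
  then obtain N N' where N: "openin T N" "x \<in> N" "openin T N'" "y \<in> N'"
    "\<And>g u. g \<in> carrier G \<Longrightarrow> u \<in> N \<Longrightarrow> \<alpha> g u \<notin> N'"
    using separate_translates[OF _ xy(1,3) ne] by metis
  have "disjnt (orb ` N) (orb ` N')"
  proof (rule ccontr)
    assume "\<not> disjnt (orb ` N) (orb ` N')"
    then obtain u v where uv: "u \<in> N" "v \<in> N'" "orb u = orb v" by (auto simp: disjnt_iff)
    then have "u \<in> topspace T" "v \<in> topspace T" using N openin_subset by blast+
    then show False using orb_eq_iff uv N(5) by metis
  qed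
  then show "\<exists>U V. openin TQ U \<and> openin TQ V \<and> p \<in> U \<and> q \<in> V \<and> disjnt U V"
    using N xy orb_open_map unfolding open_map_def by (metis imageI)
qed

lemma second_countable_TQ: "second_countable TQ"
  using M second_countable_open_map_image[OF orb_continuous orb_open_map] topspace_TQ
  by (simp add: smooth_manifold_def)

lemma orb_mem_image:
  assumes "invariant G \<alpha> A" "A \<subseteq> topspace T" "x \<in> topspace T"
  shows "orb x \<in> orb ` A \<longleftrightarrow> x \<in> A"
proof
  assume "orb x \<in> orb ` A"
  then obtain a where "a \<in> A" "orb a = orb x" by auto
  then show "x \<in> A" using orb_eq_iff assms unfolding invariant_def by (metis subsetD)
qed simp

text \<open>If orb x adheres to the image of A, then the image of an open N around x, being open,
  meets that of A, and invariance turns this into a point of A in N. The converse is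
  continuity.\<close>

lemma orb_closure:
  assumes "invariant G \<alpha> A" "A \<subseteq> topspace T" "x \<in> topspace T"
  shows "orb x \<in> TQ closure_of (orb ` A) \<longleftrightarrow> x \<in> T closure_of A"
proof
  assume *: "orb x \<in> TQ closure_of (orb ` A)"
  show "x \<in> T closure_of A"
    unfolding in_closure_of
  proof (intro conjI allI impI)
    fix N assume N: "x \<in> N \<and> openin T N"
    then have "openin TQ (orb ` N)" "orb x \<in> orb ` N" using orb_open_map by (auto simp: open_map_def)
    then obtain q where "q \<in> orb ` A" "q \<in> orb ` N" using * unfolding in_closure_of by blast
    then obtain n where "n \<in> N" "orb n \<in> orb ` A" by blast
    then show "\<exists>y. y \<in> A \<and> y \<in> N" using orb_mem_image[OF assms(1,2)] N openin_subset by blast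
  qed (rule assms(3))
next
  assume "x \<in> T closure_of A"
  then show "orb x \<in> TQ closure_of (orb ` A)"
    using continuous_map_image_closure_subset[OF orb_continuous] by blast
qed

lemma orb_closed:
  assumes "invariant G \<alpha> A" "closedin T A"
  shows "closedin TQ (orb ` A)"
proof -
  have AT: "A \<subseteq> topspace T" using assms(2) by (rule closedin_subset)
  have "q \<in> orb ` A" if "q \<in> TQ closure_of (orb ` A)" for q
  proof -
    have "q \<in> topspace TQ" using that by (simp add: in_closure_of)
    then obtain x where x: "x \<in> topspace T" "q = orb x" by (auto simp: topspace_TQ)
    then show ?thesis
      using that orb_closure[OF assms(1) AT x(1)] closure_of_closedin[OF assms(2)] by simp
  qed
  then have "TQ closure_of (orb ` A) \<subseteq> orb ` A" by blast
  moreover have "orb ` A \<subseteq> topspace TQ" using AT topspace_TQ by auto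
  ultimately show ?thesis using closure_of_subset_eq by blast
qed

subsection \<open>Orbit maps are immersions\<close>

text \<open>One fixed chart around the unit provides coordinates for the group; in them,
  \<open>B\<close> is the Lie algebra as a vector space.\<close>

definition "echart = (SOME c. c \<in> atlas L \<and> \<one>\<^bsub>G\<^esub> \<in> fst c)"
definition "UG = fst echart"
definition "\<gamma> = snd echart"
abbreviation "ginv \<equiv> inv_into UG \<gamma>"
abbreviation "B \<equiv> span (\<gamma> ` UG)"
abbreviation "e0 \<equiv> \<gamma> \<one>\<^bsub>G\<^esub>"

lemma UG: "(UG, \<gamma>) \<in> smooth_charts L" "\<one>\<^bsub>G\<^esub> \<in> UG"
proof -
  have "\<exists>c. c \<in> atlas L \<and> \<one>\<^bsub>G\<^esub> \<in> fst c"
    using smooth_charts_cover[OF L, of "\<one>\<^bsub>G\<^esub>"] carrier by (metis grp.one_closed fst_conv)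
  then have "echart \<in> atlas L \<and> \<one>\<^bsub>G\<^esub> \<in> fst echart" unfolding echart_def by (rule someI_ex)
  then show "(UG, \<gamma>) \<in> smooth_charts L" "\<one>\<^bsub>G\<^esub> \<in> UG"
    using atlas_subset_smooth_charts[OF L] by (auto simp: UG_def \<gamma>_def)
qed

lemmas UG_chart = smooth_charts_is_chart[OF UG(1)]

lemma UG_carrier: "UG \<subseteq> carrier G"
  using openin_subset[OF is_chart_open[OF UG_chart]] carrier by simp

lemma ginv: "g \<in> UG \<Longrightarrow> ginv (\<gamma> g) = g"
  using is_chart_inj[OF UG_chart] by simp

lemma ginv_mem: "c \<in> \<gamma> ` UG \<Longrightarrow> ginv c \<in> UG" "c \<in> \<gamma> ` UG \<Longrightarrow> ginv c \<in> carrier G"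
  using inv_into_into UG_carrier by (metis, metis subsetD)

lemma dim_B: "dim B = mdim L"
  using is_chart_model(2)[OF UG_chart] UG(2) by blast

text \<open>The domain of the orbit map of y, read in the fixed group chart and in a chart on
  U.\<close>

definition "orbit_dom U y = {c \<in> \<gamma> ` UG. \<alpha> (ginv c) y \<in> U}"

lemma orbit_map_smooth:
  assumes "(U, \<kappa>) \<in> smooth_charts M" "y \<in> topspace T"
  shows "openin (top_of_set B) (orbit_dom U y)" "smooth_on (orbit_dom U y) (\<lambda>c. \<kappa> (\<alpha> (ginv c) y))"
  using smooth_map_prod_section'[OF L M M act_smooth UG(1) assms] by (simp_all add: orbit_dom_def)

lemma chart_topspace: "(U, \<kappa>) \<in> smooth_charts M \<Longrightarrow> y \<in> U \<Longrightarrow> y \<in> topspace T"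
  using is_chart_open[OF smooth_charts_is_chart] openin_subset by blast

lemma e0_orbit_dom: "(U, \<kappa>) \<in> smooth_charts M \<Longrightarrow> y \<in> U \<Longrightarrow> e0 \<in> orbit_dom U y"
  using UG(2) ginv[OF UG(2)] act_one chart_topspace by (auto simp: orbit_dom_def)

lemma translation_smooth:
  assumes "(U, \<kappa>) \<in> smooth_charts M" "(V, \<psi>) \<in> smooth_charts M" "g \<in> carrier G"
  shows "openin (top_of_set (span (\<kappa> ` U))) {z \<in> \<kappa> ` U. \<alpha> g (inv_into U \<kappa> z) \<in> V}"
    "smooth_on {z \<in> \<kappa> ` U. \<alpha> g (inv_into U \<kappa> z) \<in> V} (\<lambda>z. \<psi> (\<alpha> g (inv_into U \<kappa> z)))"
  using smooth_map_prod_section[OF L M M act_smooth assms(1,2)] assms(3) carrier by simp_all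

definition "left_dom g = {c \<in> \<gamma> ` UG. g \<otimes>\<^bsub>G\<^esub> ginv c \<in> UG}"

lemma left_smooth:
  assumes "g \<in> carrier G"
  shows "openin (top_of_set B) (left_dom g)" "smooth_on (left_dom g) (\<lambda>c. \<gamma> (g \<otimes>\<^bsub>G\<^esub> ginv c))"
  using smooth_map_prod_section[OF L L L mult_smooth UG(1) UG(1)] assms carrier by (simp_all add: left_dom_def)

text \<open>The differential is injective at some group element by injectivity of the orbit map;
  equivariance transports this to the identity.\<close>

lemma orbit_map_immersion:
  assumes U: "(U, \<kappa>) \<in> smooth_charts M" "y \<in> U"
    and f': "((\<lambda>c. \<kappa> (\<alpha> (ginv c) y)) has_derivative f') (at e0 within orbit_dom U y)"
    and b: "b \<in> B" "f' b = 0"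
  shows "b = 0"
proof -
  let ?f = "\<lambda>c. \<kappa> (\<alpha> (ginv c) y)"
  have yT: "y \<in> topspace T" by (rule chart_topspace[OF U])
  note fo = orbit_map_smooth[OF U(1) yT] and cU = smooth_charts_is_chart[OF U(1)]
  have inj: "inj_on ?f (orbit_dom U y)"
  proof (rule inj_onI)
    fix c d assume c: "c \<in> orbit_dom U y" "d \<in> orbit_dom U y" "?f c = ?f d"
    then have "\<alpha> (ginv c) y = \<alpha> (ginv d) y"
      using is_chart_inj[OF cU] by (auto simp: orbit_dom_def dest: inj_onD)
    then have "ginv c = ginv d"
      using act_free c yT ginv_mem(2) by (auto simp: orbit_dom_def)
    then show "c = d" using c by (auto simp: orbit_dom_def dest: inv_into_injective)
  qed
  obtain p f'' where p: "p \<in> orbit_dom U y" "(?f has_derivative f'') (at p within orbit_dom U y)"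
    "\<And>v. v \<in> B \<Longrightarrow> f'' v = 0 \<Longrightarrow> v = 0"
    using injective_smooth_imp_immersion_point[OF subspace_span fo(1) _ fo(2) inj] e0_orbit_dom[OF U] by blast
  \<comment> \<open>The immersion at p is moved to the unit by the left translation
    \<open>?l\<close> of the group and the translation \<open>?t\<close> of M.\<close>
  define g where "g = ginv p"
  have g: "g \<in> UG" "g \<in> carrier G" "\<gamma> g = p" "\<alpha> g y \<in> U"
    using p(1) ginv_mem by (auto simp: g_def orbit_dom_def f_inv_into_f)
  let ?l = "\<lambda>c. \<gamma> (g \<otimes>\<^bsub>G\<^esub> ginv c)" and ?m = "\<lambda>c. \<gamma> (inv\<^bsub>G\<^esub> g \<otimes>\<^bsub>G\<^esub> ginv c)"
  let ?t = "\<lambda>z. \<kappa> (\<alpha> g (inv_into U \<kappa> z))" and ?Dt = "{z \<in> \<kappa> ` U. \<alpha> g (inv_into U \<kappa> z) \<in> U}"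
  note l = left_smooth[OF g(2)] and m = left_smooth[OF grp.inv_closed[OF g(2)]]
  note t = translation_smooth[OF U(1) U(1) g(2)]
  have e0l: "e0 \<in> left_dom g" "?l e0 = p" using g UG ginv by (auto simp: left_dom_def)
  have inv\<kappa>: "inv_into U \<kappa> (\<kappa> a) = a" if "a \<in> U" for a using is_chart_inj[OF cU] that by simp
  have ml: "?l c \<in> left_dom (inv\<^bsub>G\<^esub> g)" "?m (?l c) = c" if "c \<in> left_dom g" for c
  proof -
    have c: "c \<in> \<gamma> ` UG" "g \<otimes>\<^bsub>G\<^esub> ginv c \<in> UG" "ginv c \<in> carrier G" "ginv c \<in> UG"
      using that ginv_mem by (auto simp: left_dom_def)
    have "inv\<^bsub>G\<^esub> g \<otimes>\<^bsub>G\<^esub> (g \<otimes>\<^bsub>G\<^esub> ginv c) = ginv c"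
      using c g(2) by (simp add: grp.m_assoc[symmetric])
    then show "?l c \<in> left_dom (inv\<^bsub>G\<^esub> g)" "?m (?l c) = c"
      using c ginv by (auto simp: left_dom_def f_inv_into_f)
  qed
  obtain l' where l': "(?l has_derivative l') (at e0 within left_dom g)"
    using smooth_on_has_derivative[OF l(2) e0l(1)] by blast
  obtain m' where m': "(?m has_derivative m') (at (?l e0) within left_dom (inv\<^bsub>G\<^esub> g))"
    using smooth_on_has_derivative[OF m(2) ml(1)[OF e0l(1)]] by blast
  have mlb: "m' (l' b) = b"
    using has_derivative_inverse_within[OF subspace_span l(1) e0l(1) b(1) l' m'] ml by blast
  have l'B: "l' b \<in> B"
  proof -
    have "l' b \<in> tangent_plane (?l ` left_dom g) (?l e0)"
      by (rule tangent_plane_image[OF l(2) l'])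
        (use tangent_plane_openin_subspace[OF subspace_span l(1) e0l(1)] b(1) in simp)
    moreover have "?l ` left_dom g \<subseteq> B" by (auto simp: left_dom_def intro: span_base)
    ultimately show ?thesis using tangent_plane_subset_subspace[OF subspace_span] by blast
  qed
  \<comment> \<open>On this set both sides of the equivariance f (l c) = t (f c) are defined in the
    charts. It has to be open in B for the two derivatives to be comparable.\<close>
  let ?N = "orbit_dom U y \<inter> left_dom g \<inter> {c \<in> \<gamma> ` UG. \<alpha> (ginv c) y \<in> {x \<in> topspace T. \<alpha> g x \<in> U}}"
  have N: "openin (top_of_set B) ?N"
  proof (intro openin_Int fo(1) l(1))
    have "openin (mspace L) {h \<in> topspace (mspace L). \<alpha> h y \<in> {x \<in> topspace T. \<alpha> g x \<in> U}}"
    proof (rule openin_continuous_map_preimage[of _ T])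
      have "continuous_map (mspace L) (prod_topology (mspace L) T) (\<lambda>h. (h, y))"
        using yT by (intro continuous_map_pairedI) (auto simp: continuous_map_const)
      from continuous_map_compose[OF this act_continuous]
      show "continuous_map (mspace L) T (\<lambda>h. \<alpha> h y)" by (simp add: o_def)
      show "openin T {x \<in> topspace T. \<alpha> g x \<in> U}"
        by (rule openin_continuous_map_preimage[OF translation_continuous[OF g(2)] is_chart_open[OF cU]])
    qed
    from is_chart_image_open[OF UG_chart this]
    have "openin (top_of_set B) (\<gamma> ` (UG \<inter> {h \<in> topspace (mspace L). \<alpha> h y \<in> {x \<in> topspace T. \<alpha> g x \<in> U}}))" .
    moreover have "\<gamma> ` (UG \<inter> {h \<in> topspace (mspace L). \<alpha> h y \<in> {x \<in> topspace T. \<alpha> g x \<in> U}}) =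
      {c \<in> \<gamma> ` UG. \<alpha> (ginv c) y \<in> {x \<in> topspace T. \<alpha> g x \<in> U}}"
      using ginv UG_carrier carrier by auto
    ultimately show "openin (top_of_set B) {c \<in> \<gamma> ` UG. \<alpha> (ginv c) y \<in> {x \<in> topspace T. \<alpha> g x \<in> U}}" by simp
  qed
  have e0N: "e0 \<in> ?N"
    using e0l(1) e0_orbit_dom[OF U] UG ginv act_one[OF yT] yT g(4) by simp
  have fl: "?f (?l c) = ?t (?f c)" "?l c \<in> orbit_dom U y" "?f c \<in> ?Dt" if c: "c \<in> ?N" for c
  proof -
    have mem: "ginv c \<in> carrier G" "\<alpha> (ginv c) y \<in> U" "g \<otimes>\<^bsub>G\<^esub> ginv c \<in> UG" "\<alpha> g (\<alpha> (ginv c) y) \<in> U"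
      using c ginv_mem by (auto simp: orbit_dom_def left_dom_def)
    have eq: "\<alpha> (ginv (?l c)) y = \<alpha> g (\<alpha> (ginv c) y)"
      using mem ginv act_mult[OF g(2) mem(1) yT] by simp
    then show "?f (?l c) = ?t (?f c)" using mem inv\<kappa> by simp
    show "?l c \<in> orbit_dom U y" using eq mem by (simp add: orbit_dom_def)
    show "?f c \<in> ?Dt" using mem inv\<kappa> by simp
  qed
  obtain t' where t': "(?t has_derivative t') (at (?f e0) within ?Dt)"
    using smooth_on_has_derivative[OF t(2) fl(3)[OF e0N]] by blast
  \<comment> \<open>Two derivatives of the same map: equivariance gives f'' (l' b) = t' (f' b). If
    f' b = 0, injectivity of f'' on B yields l' b = 0, and then the left inverse m' of l' yields b =
    0.\<close>
  have "((\<lambda>c. ?f (?l c)) has_derivative (\<lambda>v. f'' (l' v))) (at e0 within ?N)"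
  proof -
    have sub: "?N \<subseteq> left_dom g" by blast
    have sub': "?l ` ?N \<subseteq> orbit_dom U y" using fl(2) by blast
    have "(?f has_derivative f'') (at (?l e0) within orbit_dom U y)" unfolding e0l(2) by (rule p(2))
    from has_derivative_compose_within[OF has_derivative_subset[OF l' sub] this sub'] show ?thesis .
  qed
  moreover have "((\<lambda>c. ?f (?l c)) has_derivative (\<lambda>v. t' (f' v))) (at e0 within ?N)"
  proof (rule has_derivative_transform[OF e0N])
    show "((\<lambda>c. ?t (?f c)) has_derivative (\<lambda>v. t' (f' v))) (at e0 within ?N)"
    proof -
      have sub: "?N \<subseteq> orbit_dom U y" by blast
      have sub': "?f ` ?N \<subseteq> ?Dt" using fl(3) by blast
      show ?thesis by (rule has_derivative_compose_within[OF has_derivative_subset[OF f' sub] t' sub'])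
    qed
  qed (rule fl(1))
  ultimately have "f'' (l' b) = t' (f' b)"
    by (rule has_derivative_unique_on_subspace[OF subspace_span N e0N b(1)])
  also have "\<dots> = 0" using b(2) t' by (simp add: has_derivative_linear linear_0)
  finally have "l' b = 0" using p(3)[OF l'B] by simp
  then show "b = 0" using mlb m' by (simp add: has_derivative_linear linear_0)
qed

end

section \<open>Slices\<close>

text \<open>The last property recovers the S-component of a sum whose second summand is normal to S.
  It makes the splitting into orbit and slice directions explicit.\<close>

lemma orthogonal_projection_exists:
  fixes S :: "'a::euclidean_space set"
  assumes "subspace S"
  obtains P where "linear P" "\<And>z. P z \<in> S" "\<And>z v. v \<in> S \<Longrightarrow> orthogonal v (z - P z)"
    "\<And>z w. w \<in> S \<Longrightarrow> (\<And>v. v \<in> S \<Longrightarrow> orthogonal v z) \<Longrightarrow> P (w + z) = w"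
proof -
  obtain C where C: "C \<subseteq> S" "pairwise orthogonal C" "\<And>x. x \<in> C \<Longrightarrow> norm x = 1" "independent C" "span C = S"
    using orthonormal_basis_subspace[OF assms] by metis
  have fin: "finite C" using C(4) by (rule independent_imp_finite)
  define P where "P z = (\<Sum>b\<in>C. (z \<bullet> b) *\<^sub>R b)" for z
  have lin: "linear P"
    unfolding P_def by (intro linear_compose_sum ballI) (simp add: linear_iff inner_add_left scaleR_left_distrib)
  have PS: "P z \<in> S" for z
    unfolding P_def using C(1) by (intro subspace_sum assms subspace_scale[OF assms]) auto
  have Pb: "(z - P z) \<bullet> b = 0" if "b \<in> C" for z b
  proof -
    have "P z \<bullet> b = (\<Sum>c\<in>C. (z \<bullet> c) * (c \<bullet> b))" by (simp add: P_def inner_sum_left)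
    also have "\<dots> = (\<Sum>c\<in>C. if c = b then z \<bullet> b else 0)"
      using C(2,3) that by (intro sum.cong) (auto simp: pairwise_def orthogonal_def norm_eq_1)
    also have "\<dots> = z \<bullet> b" using fin that by simp
    finally show ?thesis by (simp add: inner_diff_left)
  qed
  have orth: "orthogonal v (z - P z)" if "v \<in> S" for v z
  proof -
    have "orthogonal (z - P z) v"
      by (rule orthogonal_to_span[of v C]) (use that C(5) Pb in \<open>auto simp: orthogonal_def\<close>)
    then show ?thesis by (simp add: orthogonal_commute)
  qed
  have "P (w + z) = w" if "w \<in> S" "\<And>v. v \<in> S \<Longrightarrow> orthogonal v z" for w z
  proof -
    let ?u = "w - P (w + z)"
    have u: "?u \<in> S" using that(1) PS by (intro subspace_diff assms)
    have "?u \<bullet> (w + z - P (w + z)) = 0" "?u \<bullet> z = 0"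
      using orth[OF u, of "w + z"] that(2)[OF u] by (simp_all add: orthogonal_def)
    moreover have "?u \<bullet> (w + z - P (w + z)) = ?u \<bullet> ?u + ?u \<bullet> z"
      by (simp only: inner_add_right[symmetric]) (simp add: algebra_simps)
    ultimately have "orthogonal ?u ?u" by (simp add: orthogonal_def)
    then show ?thesis by (simp add: orthogonal_self)
  qed
  then show thesis using that[of P] lin PS orth by blast
qed

lemma is_chart_preimage_open:
  assumes "is_chart T n (U, \<phi>)" "openin (top_of_set (span (\<phi> ` U))) Z"
  shows "openin T {u \<in> U. \<phi> u \<in> Z}"
proof -
  obtain W where W: "open W" "Z = span (\<phi> ` U) \<inter> W" using assms(2) by (auto simp: openin_open)
  have "openin (subtopology T U) {u \<in> topspace (subtopology T U). \<phi> u \<in> W}"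
    using openin_continuous_map_preimage[OF is_chart_continuous[OF assms(1)]] W(1) by simp
  then have "openin (subtopology T U) {u \<in> U. \<phi> u \<in> W}"
    by (simp only: is_chart_topspace[OF assms(1)])
  then have "openin T {u \<in> U. \<phi> u \<in> W}"
    using is_chart_open[OF assms(1)] openin_trans_full by blast
  moreover have "{u \<in> U. \<phi> u \<in> W} = {u \<in> U. \<phi> u \<in> Z}" using W(2) by (auto intro: span_base)
  ultimately show ?thesis by simp
qed

lemma openin_affine_preimage:
  fixes A :: "'a::euclidean_space \<Rightarrow> 'b::euclidean_space"
  assumes "openin (top_of_set F) D" "linear A" "\<And>z. z \<in> E \<Longrightarrow> p + A z \<in> F"
  shows "openin (top_of_set E) {z \<in> E. p + A z \<in> D}"
proof -
  obtain W where W: "open W" "D = F \<inter> W" using assms(1) by (auto simp: openin_open)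
  have "open ((\<lambda>z. p + A z) -` W)"
    using W(1) assms(2) by (intro open_vimage continuous_intros linear_continuous_on)
      (auto simp: linear_conv_bounded_linear)
  moreover have "{z \<in> E. p + A z \<in> D} = E \<inter> (\<lambda>z. p + A z) -` W" using W(2) assms(3) by auto
  ultimately show ?thesis by (auto simp: openin_open)
qed

lemma smooth_on_affine:
  fixes A :: "'a::euclidean_space \<Rightarrow> 'b::euclidean_space"
  assumes "linear A"
  shows "smooth_on S (\<lambda>z. p + A z)"
  by (intro smooth_on_add smooth_on_const smooth_on_linear assms)

lemma has_derivative_affine:
  fixes A :: "'a::euclidean_space \<Rightarrow> 'b::euclidean_space"
  assumes "linear A"
  shows "((\<lambda>z. p + A z) has_derivative A) (at x within S)"
  using has_derivative_add[OF has_derivative_const[of p] bounded_linear_imp_has_derivative[of A]] assms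
  by (simp add: linear_conv_bounded_linear)

context free_compact_action
begin

text \<open>The normal space of the orbit at x, the image of \<open>B\<close> under
  \<open>f'\<close> being the tangent space of the orbit in the chart. It is the linear model of the
  slice and becomes the model space of a quotient chart.\<close>

definition "orbit_normal U \<kappa> f' = {w \<in> span (\<kappa> ` U). \<forall>v \<in> f' ` B. orthogonal v w}"

lemma subspace_orbit_normal: "subspace (orbit_normal U \<kappa> f')"
  unfolding orbit_normal_def subspace_def orthogonal_def
  by (auto simp: inner_add_right intro: span_add span_scale span_zero)

text \<open>Injectivity of \<open>f'\<close> on \<open>B\<close> is
  \<open>orbit_map_immersion\<close>. If A is invariant and contains x, the orbit map takes its
  values in A, so its velocities are tangent to A.\<close>

lemma orbit_tangent:
  assumes U: "(U, \<kappa>) \<in> smooth_charts M" "x \<in> U"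
    and f': "((\<lambda>c. \<kappa> (\<alpha> (ginv c) x)) has_derivative f') (at e0 within orbit_dom U x)"
  shows "subspace (f' ` B)" "f' ` B \<subseteq> span (\<kappa> ` U)" "dim (f' ` B) = mdim L" "inj_on f' B"
    "invariant G \<alpha> A \<Longrightarrow> x \<in> A \<Longrightarrow> f' ` B \<subseteq> tangent_plane (\<kappa> ` (A \<inter> U)) (\<kappa> x)"
proof -
  have xT: "x \<in> topspace T" by (rule chart_topspace[OF U])
  note fo = orbit_map_smooth[OF U(1) xT]
  let ?f = "\<lambda>c. \<kappa> (\<alpha> (ginv c) x)"
  have lf: "linear f'" using f' by (rule has_derivative_linear)
  show "subspace (f' ` B)" using lf by (intro linear_subspace_image) auto
  have fe0: "?f e0 = \<kappa> x" using ginv[OF UG(2)] act_one[OF xT] by simp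
  have tp: "f' ` B \<subseteq> tangent_plane (?f ` orbit_dom U x) (\<kappa> x)"
  proof
    fix v assume "v \<in> f' ` B"
    then obtain b where b: "b \<in> B" "v = f' b" by blast
    have "f' b \<in> tangent_plane (?f ` orbit_dom U x) (?f e0)"
      by (rule tangent_plane_image[OF fo(2) f'])
        (use tangent_plane_openin_subspace[OF subspace_span fo(1) e0_orbit_dom[OF U]] b(1) in simp)
    then show "v \<in> tangent_plane (?f ` orbit_dom U x) (\<kappa> x)" unfolding fe0 b(2) .
  qed
  have "?f ` orbit_dom U x \<subseteq> span (\<kappa> ` U)" by (auto simp: orbit_dom_def intro: span_base)
  then show "f' ` B \<subseteq> span (\<kappa> ` U)" using tp tangent_plane_subset_subspace[OF subspace_span] by blast
  show inj: "inj_on f' B"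
    using lf orbit_map_immersion[OF U f'] by (subst linear_inj_on_iff_eq_0) auto
  show "dim (f' ` B) = mdim L"
    using dim_image_eq[OF lf, of B] inj dim_B by (simp add: span_span)
  assume A: "invariant G \<alpha> A" "x \<in> A"
  have "?f ` orbit_dom U x \<subseteq> \<kappa> ` (A \<inter> U)"
    using A ginv_mem(2) by (auto simp: orbit_dom_def invariant_def)
  then show "f' ` B \<subseteq> tangent_plane (\<kappa> ` (A \<inter> U)) (\<kappa> x)"
    using tp tangent_plane_mono by blast
qed

text \<open>With V the whole model space this gives the dimension of the quotient, with V the linear
  model of an invariant submanifold that of its image. The inequality excludes truncation in the
  difference of natural numbers.\<close>

lemma dim_orbit_normal:
  assumes U: "(U, \<kappa>) \<in> smooth_charts M" "x \<in> U"
    and f': "((\<lambda>c. \<kappa> (\<alpha> (ginv c) x)) has_derivative f') (at e0 within orbit_dom U x)"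
    and V: "subspace V" "V \<subseteq> span (\<kappa> ` U)" "f' ` B \<subseteq> V"
  shows "dim (orbit_normal U \<kappa> f' \<inter> V) = dim V - mdim L" "mdim L \<le> dim V"
proof -
  have "orbit_normal U \<kappa> f' \<inter> V = {w \<in> V. \<forall>v \<in> f' ` B. orthogonal v w}"
    using V(2) by (auto simp: orbit_normal_def)
  moreover have "dim {w \<in> V. \<forall>v \<in> f' ` B. orthogonal v w} + dim (f' ` B) = dim V"
    using dim_subspace_orthogonal_to_vectors[OF orbit_tangent(1)[OF U f'] V(1,3)] .
  ultimately show "dim (orbit_normal U \<kappa> f' \<inter> V) = dim V - mdim L" "mdim L \<le> dim V"
    using orbit_tangent(3)[OF U f'] by auto
qed

text \<open>In the coordinates \<open>(g, w)\<close> with \<open>w\<close> normal to the orbit, the action map is a local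
  diffeomorphism; compactness and freeness make the slice meet each orbit at most once.\<close>

lemma slice_exists:
  assumes U: "(U, \<kappa>) \<in> smooth_charts M" "x \<in> U"
    and f': "((\<lambda>c. \<kappa> (\<alpha> (ginv c) x)) has_derivative f') (at e0 within orbit_dom U x)"
  defines "W \<equiv> orbit_normal U \<kappa> f'"
  obtains \<Sigma> Y \<rho> where "\<Sigma> \<subseteq> U" "x \<in> \<Sigma>" "openin (top_of_set W) ((\<lambda>s. \<kappa> s - \<kappa> x) ` \<Sigma>)" "inj_on orb \<Sigma>"
    "\<And>Z. openin (top_of_set W) Z \<Longrightarrow> Z \<subseteq> (\<lambda>s. \<kappa> s - \<kappa> x) ` \<Sigma> \<Longrightarrow> openin TQ (orb ` {s \<in> \<Sigma>. \<kappa> s - \<kappa> x \<in> Z})"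
    "openin T Y" "\<Sigma> \<subseteq> Y" "Y \<subseteq> U" "smooth_on (\<kappa> ` Y) \<rho>"
    "\<And>u. u \<in> Y \<Longrightarrow> \<exists>s\<in>\<Sigma>. orb u = orb s \<and> \<rho> (\<kappa> u) = \<kappa> s - \<kappa> x"
proof -
  define E where "E = span (\<kappa> ` U)"
  define a where "a = \<kappa> x"
  have sE: "subspace E" by (simp add: E_def)
  note cU = smooth_charts_is_chart[OF U(1)]
  have xT: "x \<in> topspace T" by (rule chart_topspace[OF U])
  have inv\<kappa>: "inv_into U \<kappa> (\<kappa> u) = u" if "u \<in> U" for u using is_chart_inj[OF cU] that by simp
  have aE: "a \<in> E" using U(2) by (auto simp: a_def E_def intro: span_base)
  have \<kappa>E: "\<kappa> u \<in> E" if "u \<in> U" for u using that by (auto simp: E_def intro: span_base)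
  have W: "subspace W" "W \<subseteq> E" using subspace_orbit_normal by (auto simp: W_def orbit_normal_def E_def)
  note tan = orbit_tangent[OF U f']
  have lf: "linear f'" using f' by (rule has_derivative_linear)
  obtain P where P: "linear P" "\<And>z. P z \<in> f' ` B" "\<And>z v. v \<in> f' ` B \<Longrightarrow> orthogonal v (z - P z)"
    "\<And>z w. w \<in> f' ` B \<Longrightarrow> (\<And>v. v \<in> f' ` B \<Longrightarrow> orthogonal v z) \<Longrightarrow> P (w + z) = w"
    using orthogonal_projection_exists[OF tan(1)] by metis
  obtain S where S: "range S \<subseteq> B" "linear S" "\<And>b. b \<in> B \<Longrightarrow> S (f' b) = b"
    using linear_exists_left_inverse_on[OF lf subspace_span tan(4)] by blast
  \<comment> \<open>Together with \<open>R\<close> below, this splits z = f' b + w into the group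
    coordinate A z = b and the normal part R z = w.\<close>
  define A where "A z = S (P z)" for z
  have A: "linear A" using linear_compose[OF P(1) S(2)] unfolding A_def o_def .
  have AB: "A z \<in> B" for z using S(1) by (auto simp: A_def)
  have fA: "f' (A z) = P z" for z
    using P(2)[of z] S(3) by (auto simp: A_def)
  define R where "R z = z - P z" for z
  have R: "linear R" unfolding R_def by (intro linear_compose_sub linear_ident P(1))
  have PE: "P z \<in> E" for z using P(2)[of z] tan(2) E_def by auto
  have RW: "R z \<in> W" if "z \<in> E" for z
    using that PE P(3) sE by (auto simp: R_def W_def orbit_normal_def E_def[symmetric] intro: subspace_diff)
  have decomp: "A (f' b + w) = b" "R (f' b + w) = w" if "b \<in> B" "w \<in> W" for b w
  proof -
    have "P (f' b + w) = f' b" using that P(4)[of "f' b" w] by (auto simp: W_def orbit_normal_def)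
    then show "A (f' b + w) = b" "R (f' b + w) = w" using S(3)[OF that(1)] by (auto simp: A_def R_def)
  qed
  define H where "H = (\<lambda>z. \<kappa> (\<alpha> (ginv (fst z)) (inv_into U \<kappa> (snd z))))"
  define D where "D = {z \<in> \<gamma> ` UG \<times> \<kappa> ` U. \<alpha> (ginv (fst z)) (inv_into U \<kappa> (snd z)) \<in> U}"
  have D: "openin (top_of_set (B \<times> E)) D" and H: "smooth_on D H"
    using smooth_map_prod_coordinates[OF L M M act_smooth UG(1) U(1) U(1)]
    by (simp_all add: D_def H_def E_def split_beta)
  have pD: "(e0, a) \<in> D" "H (e0, a) = a"
    using UG(2) U(2) ginv[OF UG(2)] act_one[OF xT] inv\<kappa> by (auto simp: D_def H_def a_def)
  obtain H' where H': "(H has_derivative H') (at (e0, a) within D)"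
    using smooth_on_has_derivative[OF H pD(1)] by blast
  have H'b: "H' (b, 0) = f' b" if "b \<in> B" for b
  proof (rule has_derivative_unique_on_subspace[OF subspace_span orbit_map_smooth(1)[OF U(1) xT] e0_orbit_dom[OF U] that _ f'])
    have sub: "(\<lambda>c. (c, a)) ` orbit_dom U x \<subseteq> D"
      using U(2) inv\<kappa> by (auto simp: D_def orbit_dom_def a_def)
    have "((\<lambda>c. H (c, a)) has_derivative (\<lambda>b. H' (b, 0))) (at e0 within orbit_dom U x)"
      by (rule has_derivative_compose_within[OF has_derivative_Pair[OF has_derivative_ident has_derivative_const] H' sub])
    then show "((\<lambda>c. \<kappa> (\<alpha> (ginv c) x)) has_derivative (\<lambda>b. H' (b, 0))) (at e0 within orbit_dom U x)"
      using inv\<kappa>[OF U(2)] by (simp add: H_def a_def)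
  qed
  have H'w: "H' (0, w) = w" if "w \<in> E" for w
  proof (rule has_derivative_unique_on_subspace[OF sE is_chart_model(1)[OF cU, folded E_def] _ that _ has_derivative_ident])
    show "a \<in> \<kappa> ` U" using U(2) by (simp add: a_def)
    have sub: "(\<lambda>z. (e0, z)) ` (\<kappa> ` U) \<subseteq> D"
      using UG(2) ginv[OF UG(2)] inv\<kappa> act_one chart_topspace[OF U(1)] by (auto simp: D_def)
    have "((\<lambda>z. H (e0, z)) has_derivative (\<lambda>w. H' (0, w))) (at a within \<kappa> ` U)"
      by (rule has_derivative_compose_within[OF has_derivative_Pair[OF has_derivative_const has_derivative_ident] H' sub])
    then show "((\<lambda>z. z) has_derivative (\<lambda>w. H' (0, w))) (at a within \<kappa> ` U)"
      by (rule has_derivative_transform[rotated 2])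
        (use U(2) ginv[OF UG(2)] inv\<kappa> act_one chart_topspace[OF U(1)] in \<open>auto simp: H_def a_def\<close>)
  qed
  \<comment> \<open>The coordinate action map H lives on B \<times> E, whereas
    \<open>subspace_inverse_function\<close> asks for a self-map of one subspace with identity
    derivative. The affine map q identifies E with the coordinates (b, w) in B \<times> W around
    (e0, a), and H after q has derivative P z + R z = z at 0.\<close>
  define q where "q = (\<lambda>z. (e0, a) + (A z, R z))"
  have linq: "linear (\<lambda>z. (A z, R z))"
    using A R by (auto simp: linear_iff)
  have e0B: "e0 \<in> B" using UG(2) by (auto intro: span_base)
  have qBE: "q z \<in> B \<times> E" if "z \<in> E" for z
    using AB RW[OF that] W(2) e0B aE sE by (auto simp: q_def intro!: subspace_add)
  define D0 where "D0 = {z \<in> E. q z \<in> D}"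
  define h where "h = (\<lambda>z. H (q z))"
  have D0: "openin (top_of_set E) D0"
    unfolding D0_def q_def by (rule openin_affine_preimage[OF D linq qBE[unfolded q_def]])
  have q0: "q 0 = (e0, a)" using A R by (simp add: q_def linear_0)
  have zD0: "0 \<in> D0" using q0 pD(1) sE by (simp add: D0_def subspace_0)
  have qD: "q ` D0 \<subseteq> D" by (auto simp: D0_def)
  have h: "smooth_on D0 h"
    unfolding h_def by (rule smooth_on_compose[OF _ H qD]) (unfold q_def, rule smooth_on_affine[OF linq])
  have hE: "h ` D0 \<subseteq> E"
    using \<kappa>E by (auto simp: h_def H_def D0_def D_def)
  have h': "(h has_derivative (\<lambda>z. H' (A z, R z))) (at 0 within D0)"
    unfolding h_def
  proof (rule has_derivative_compose_within[OF _ _ qD])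
    show "(q has_derivative (\<lambda>z. (A z, R z))) (at 0 within D0)"
      unfolding q_def by (rule has_derivative_affine[OF linq])
    show "(H has_derivative H') (at (q 0) within D)" unfolding q0 by (rule H')
  qed
  have h'id: "H' (A z, R z) = z" if "z \<in> E" for z
  proof -
    have "H' (A z, R z) = H' ((A z, 0) + (0, R z))" by simp
    also have "\<dots> = H' (A z, 0) + H' (0, R z)" using H' by (metis has_derivative_linear linear_add)
    also have "\<dots> = P z + R z" using H'b[OF AB] H'w[of "R z"] RW[OF that] W(2) fA by auto
    finally show ?thesis by (simp add: R_def)
  qed
  obtain D' V0 gi where I: "openin (top_of_set E) D'" "D' \<subseteq> D0" "0 \<in> D'" "openin (top_of_set E) V0"
    "homeomorphism D' V0 h gi" "smooth_on V0 gi"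
    using subspace_inverse_function[OF sE D0 zD0 h hE h' h'id] by blast
  have hgi: "gi (h z) = z" "h z \<in> V0" if "z \<in> D'" for z using I(5) that by (auto simp: homeomorphism_def)
  have gih: "h (gi y) = y" "gi y \<in> D'" if "y \<in> V0" for y using I(5) that by (auto simp: homeomorphism_def)
  \<comment> \<open>The point with coordinates h z is a translate of the point s whose slice
    coordinate is R z.\<close>
  have hz: "\<exists>k\<in>carrier G. \<exists>s\<in>U. \<kappa> s - a = R z \<and> \<alpha> k s \<in> U \<and> h z = \<kappa> (\<alpha> k s)" if "z \<in> D'" for z
  proof -
    have "q z \<in> D" using that I(2) by (auto simp: D0_def)
    then have 1: "e0 + A z \<in> \<gamma> ` UG" "a + R z \<in> \<kappa> ` U" "\<alpha> (ginv (e0 + A z)) (inv_into U \<kappa> (a + R z)) \<in> U"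
      by (auto simp: D_def q_def)
    obtain s where s: "s \<in> U" "\<kappa> s = a + R z" using 1(2) by auto
    then have "inv_into U \<kappa> (a + R z) = s" using inv\<kappa> by metis
    then show ?thesis
      using 1 s ginv_mem(2)[OF 1(1)] by (intro bexI[of _ "ginv (e0 + A z)"] bexI[of _ s]) (auto simp: h_def H_def q_def)
  qed
  \<comment> \<open>A single radius serves b and w: for r = e / (K + 1) the norm of f' b + w stays
    below K r + r = e.\<close>
  obtain r where r: "r > 0" "\<And>b w. b \<in> B \<Longrightarrow> norm b < r \<Longrightarrow> w \<in> W \<Longrightarrow> norm w < r \<Longrightarrow> f' b + w \<in> D'"
  proof -
    obtain e where e: "e > 0" "ball 0 e \<inter> E \<subseteq> D'" using I(1,3) unfolding openin_contains_ball by blast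
    obtain K where K: "K > 0" "\<And>b. norm (f' b) \<le> K * norm b" using linear_bounded_pos[OF lf] by blast
    have "f' b + w \<in> D'" if "b \<in> B" "norm b < e / (K + 1)" "w \<in> W" "norm w < e / (K + 1)" for b w
    proof -
      have "norm (f' b + w) \<le> K * norm b + norm w" using norm_triangle_ineq[of "f' b" w] K(2)[of b] by linarith
      also have "\<dots> < K * (e / (K + 1)) + e / (K + 1)"
        using that K(1) by (intro add_le_less_mono mult_left_mono) auto
      also have "\<dots> = (K + 1) * (e / (K + 1))" by (simp only: distrib_right mult_1_left)
      also have "\<dots> = e" using K(1) by simp
      finally have "f' b + w \<in> ball 0 e" by simp
      moreover have "f' b + w \<in> E" using that(1,3) tan(2) W(2) sE by (auto simp: E_def intro: span_add)
      ultimately show ?thesis using e(2) by blast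
    qed
    moreover have "e / (K + 1) > 0" using e(1) K(1) by simp
    ultimately show thesis using that by blast
  qed
  have zB: "(0::'b) \<in> B" by (rule span_zero)
  have r0: "norm (0::'b) < r" using r(1) by simp
  \<comment> \<open>Group elements near the unit are handled by the injectivity of h. The remaining
    ones form a compact set and, by freeness, move x; so they carry no point of \<open>N\<close>
    into \<open>N'\<close>.\<close>
  define N0 where "N0 = {g \<in> UG. \<gamma> g \<in> B \<inter> ball e0 r}"
  have N0: "openin (mspace L) N0"
    unfolding N0_def by (rule is_chart_preimage_open[OF UG_chart]) auto
  have oneN0: "\<one>\<^bsub>G\<^esub> \<in> N0" using UG(2) e0B r(1) by (simp add: N0_def)
  obtain N N' where N: "openin T N" "x \<in> N" "openin T N'" "x \<in> N'"
    "\<And>g u. g \<in> carrier G - N0 \<Longrightarrow> u \<in> N \<Longrightarrow> \<alpha> g u \<notin> N'"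
  proof (rule separate_translates[OF _ xT xT, of "carrier G - N0"])
    have "closedin (mspace L) (carrier G - N0)" using N0 carrier by (metis closedin_diff closedin_topspace)
    then show "compactin (mspace L) (carrier G - N0)" using compact by (rule closedin_compact_space[rotated])
    show "\<alpha> g x \<noteq> x" if "g \<in> carrier G - N0" for g
      using that act_free[of g "\<one>\<^bsub>G\<^esub>" x] xT act_one oneN0 by auto
  qed (rule that)
  \<comment> \<open>Lying in \<open>N\<close> and \<open>N'\<close> forces a group element that
    joins two points of \<Sigma> into \<open>N0\<close>; the bound r puts the corresponding
    arguments of h into \<open>D'\<close>.\<close>
  define \<Sigma> where "\<Sigma> = {s \<in> U \<inter> (N \<inter> N'). \<kappa> s - a \<in> W \<and> norm (\<kappa> s - a) < r}"
  have \<Sigma>U: "\<Sigma> \<subseteq> U" by (auto simp: \<Sigma>_def)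
  have x\<Sigma>: "x \<in> \<Sigma>" using U(2) N W(1) r(1) by (simp add: \<Sigma>_def a_def subspace_0)
  have inj: "inj_on orb \<Sigma>"
  proof (rule inj_onI)
    fix s s' assume s: "s \<in> \<Sigma>" "s' \<in> \<Sigma>" "orb s = orb s'"
    then have sT: "s \<in> topspace T" "s' \<in> topspace T" using chart_topspace[OF U(1)] \<Sigma>U by auto
    then obtain g where g: "g \<in> carrier G" "\<alpha> g s = s'" using s(3) orb_eq_iff by blast
    then have gN: "g \<in> N0" using N(5)[of g s] s by (auto simp: \<Sigma>_def)
    define b where "b = \<gamma> g - e0"
    have b: "b \<in> B" "norm b < r" using gN e0B by (auto simp: b_def N0_def dist_norm norm_minus_commute intro: span_diff)
    have sW: "\<kappa> s - a \<in> W" "norm (\<kappa> s - a) < r" "\<kappa> s' - a \<in> W" "norm (\<kappa> s' - a) < r"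
      using s by (auto simp: \<Sigma>_def)
    \<comment> \<open>The point s' is reached both as the translate of s by g and as the translate
      of itself by the unit. Injectivity of h identifies the two arguments, and R compares their
      normal parts.\<close>
    let ?z = "f' b + (\<kappa> s - a)" and ?z' = "f' 0 + (\<kappa> s' - a)"
    have z: "?z \<in> D'" "?z' \<in> D'" using r(2)[OF b sW(1,2)] r(2)[OF zB r0 sW(3,4)] by auto
    have "h ?z = \<kappa> s'"
      using decomp[OF b(1) sW(1)] gN s(1) \<Sigma>U inv\<kappa> ginv g(2) by (auto simp: h_def q_def H_def b_def N0_def)
    moreover have "h ?z' = \<kappa> s'"
      using decomp[OF zB sW(3)] s(2) \<Sigma>U inv\<kappa> ginv[OF UG(2)] act_one[OF sT(2)]
      by (auto simp: h_def q_def H_def span_zero)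
    ultimately have "?z = ?z'" using hgi(1) z by metis
    then have "R ?z = R ?z'" by (rule arg_cong)
    then have "\<kappa> s - a = \<kappa> s' - a" using decomp(2)[OF b(1) sW(1)] decomp(2)[OF zB sW(3)] by (simp add: span_zero)
    then have "\<kappa> s = \<kappa> s'" by simp
    then show "s = s'" using s(1,2) \<Sigma>U is_chart_inj[OF cU] by (meson inj_onD subsetD)
  qed
  have \<Sigma>open: "openin (top_of_set W) ((\<lambda>s. \<kappa> s - a) ` \<Sigma>)"
  proof -
    have 1: "openin (top_of_set E) (\<kappa> ` (U \<inter> (N \<inter> N')))"
      using is_chart_image_open[OF cU openin_Int[OF N(1,3)]] by (simp add: E_def)
    have "openin (top_of_set W) ({w \<in> W. a + w \<in> \<kappa> ` (U \<inter> (N \<inter> N'))} \<inter> (W \<inter> ball 0 r))"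
      by (rule openin_Int[OF openin_affine_preimage[OF 1 linear_ident] openin_open_Int[OF open_ball]])
        (use W(2) aE sE in \<open>auto intro: subspace_add\<close>)
    moreover have "{w \<in> W. a + w \<in> \<kappa> ` (U \<inter> (N \<inter> N'))} \<inter> (W \<inter> ball 0 r) = (\<lambda>s. \<kappa> s - a) ` \<Sigma>"
    proof (intro Set.set_eqI iffI)
      fix w assume w: "w \<in> {w \<in> W. a + w \<in> \<kappa> ` (U \<inter> (N \<inter> N'))} \<inter> (W \<inter> ball 0 r)"
      then obtain s where s: "s \<in> U \<inter> (N \<inter> N')" "a + w = \<kappa> s" by blast
      then have "w = \<kappa> s - a" by (simp add: algebra_simps)
      then show "w \<in> (\<lambda>s. \<kappa> s - a) ` \<Sigma>" using s(1) w by (auto simp: \<Sigma>_def)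
    qed (auto simp: \<Sigma>_def)
    ultimately show ?thesis by simp
  qed
  \<comment> \<open>An open thickening, along orbits, of the slice piece over Z; there R (gi
    (\<kappa> u)) is the slice coordinate of a point on the orbit of u. It has the same image under
    \<open>orb\<close> as the slice piece, which is how that image is seen to be open.\<close>
  define YZ where "YZ Z = {u \<in> U. \<kappa> u \<in> h ` {z \<in> D'. R z \<in> Z}}" for Z
  have YZ: "openin T (YZ Z)" if Z: "openin (top_of_set W) Z" for Z
  proof -
    have "openin (top_of_set E) {z \<in> E. 0 + R z \<in> Z}"
      by (rule openin_affine_preimage[OF Z R]) (simp add: RW)
    then have "openin (top_of_set D') (D' \<inter> {z \<in> E. 0 + R z \<in> Z})"
      using openin_top_of_set_Int openin_imp_subset[OF I(1)] by blast
    moreover have "D' \<inter> {z \<in> E. 0 + R z \<in> Z} = {z \<in> D'. R z \<in> Z}"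
      using openin_imp_subset[OF I(1)] by auto
    ultimately have 1: "openin (top_of_set D') {z \<in> D'. R z \<in> Z}" by simp
    have "openin (top_of_set V0) (V0 \<inter> gi -` {z \<in> D'. R z \<in> Z})"
      by (rule continuous_openin_preimage[OF smooth_on_continuous_on[OF I(6)] _ 1]) (use gih in auto)
    moreover have "V0 \<inter> gi -` {z \<in> D'. R z \<in> Z} = h ` {z \<in> D'. R z \<in> Z}"
      using hgi gih by (force simp: image_iff)
    ultimately have "openin (top_of_set E) (h ` {z \<in> D'. R z \<in> Z})" using I(4) openin_trans by metis
    then show ?thesis unfolding YZ_def E_def by (rule is_chart_preimage_open[OF cU])
  qed
  have YZ\<Sigma>: "\<exists>s\<in>\<Sigma>. \<kappa> s - a \<in> Z \<and> orb u = orb s \<and> R (gi (\<kappa> u)) = \<kappa> s - a"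
    if Z: "Z \<subseteq> (\<lambda>s. \<kappa> s - a) ` \<Sigma>" and u: "u \<in> YZ Z" for Z u
  proof -
    obtain z where z: "z \<in> D'" "R z \<in> Z" "\<kappa> u = h z" "u \<in> U" using u by (auto simp: YZ_def)
    obtain k s where ks: "k \<in> carrier G" "s \<in> U" "\<kappa> s - a = R z" "\<alpha> k s \<in> U" "h z = \<kappa> (\<alpha> k s)"
      using hz[OF z(1)] by blast
    have "u = \<alpha> k s" using z(3,4) ks(4,5) is_chart_inj[OF cU] by (metis inj_onD)
    then have "orb u = orb s" using orb_translate[OF ks(1)] chart_topspace[OF U(1) ks(2)] by simp
    moreover obtain s1 where "s1 \<in> \<Sigma>" "\<kappa> s1 - a = R z" using Z z(2) by (metis (no_types, lifting) imageE subsetD)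
    moreover from this have "s1 = s" using ks(2,3) \<Sigma>U is_chart_inj[OF cU] by (metis add_diff_cancel_right' diff_add_cancel inj_onD subsetD)
    ultimately show ?thesis using z hgi(1) by (intro bexI[of _ s]) auto
  qed
  have \<Sigma>YZ: "s \<in> YZ Z" if "s \<in> \<Sigma>" "\<kappa> s - a \<in> Z" for s Z
  proof -
    have sW: "\<kappa> s - a \<in> W" "norm (\<kappa> s - a) < r" and sU: "s \<in> U" using that(1) by (auto simp: \<Sigma>_def)
    let ?z = "f' 0 + (\<kappa> s - a)"
    have "?z \<in> D'" by (rule r(2)[OF zB r0 sW])
    moreover have "h ?z = \<kappa> s"
      using decomp[OF zB sW(1)] sU inv\<kappa> ginv[OF UG(2)] act_one[OF chart_topspace[OF U(1) sU]]
      by (auto simp: h_def q_def H_def span_zero)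
    moreover have "R ?z \<in> Z" using decomp(2)[OF zB sW(1)] that(2) by (simp add: span_zero)
    ultimately show ?thesis using sU unfolding YZ_def by force
  qed
  have op: "openin TQ (orb ` {s \<in> \<Sigma>. \<kappa> s - a \<in> Z})"
    if "openin (top_of_set W) Z" "Z \<subseteq> (\<lambda>s. \<kappa> s - a) ` \<Sigma>" for Z
  proof -
    note YZ\<Sigma>' = YZ\<Sigma>[OF that(2)]
    have "orb ` {s \<in> \<Sigma>. \<kappa> s - a \<in> Z} = orb ` YZ Z"
    proof (intro equalityI image_subsetI)
      show "orb s \<in> orb ` YZ Z" if "s \<in> {s \<in> \<Sigma>. \<kappa> s - a \<in> Z}" for s
        using that \<Sigma>YZ by (intro imageI) simp
      fix u assume "u \<in> YZ Z"
      then obtain s where "s \<in> \<Sigma>" "\<kappa> s - a \<in> Z" and us: "orb u = orb s"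
        using YZ\<Sigma>' by metis
      then show "orb u \<in> orb ` {s \<in> \<Sigma>. \<kappa> s - a \<in> Z}"
        unfolding us by (intro imageI) simp
    qed
    then show ?thesis using YZ[OF that(1)] orb_open_map by (simp add: open_map_def)
  qed
  define Y where "Y = YZ ((\<lambda>s. \<kappa> s - a) ` \<Sigma>)"
  have Y: "openin T Y" unfolding Y_def by (rule YZ[OF \<Sigma>open])
  have \<Sigma>Y: "\<Sigma> \<subseteq> Y"
  proof
    fix s assume s: "s \<in> \<Sigma>"
    show "s \<in> Y" unfolding Y_def by (rule \<Sigma>YZ[OF s]) (use s in simp)
  qed
  have YU: "Y \<subseteq> U" unfolding Y_def YZ_def by (rule Collect_restrict)
  have "\<kappa> ` Y \<subseteq> V0" using hgi(2) by (auto simp: Y_def YZ_def)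
  then have \<rho>: "smooth_on (\<kappa> ` Y) (\<lambda>y. R (gi y))"
    by (rule smooth_on_compose_linear[OF R smooth_on_subset[OF I(6)]])
  have orbY: "\<exists>s\<in>\<Sigma>. orb u = orb s \<and> R (gi (\<kappa> u)) = \<kappa> s - a" if u: "u \<in> Y" for u
    using YZ\<Sigma>[OF subset_refl u[unfolded Y_def]] by metis
  note \<Sigma>open' = \<Sigma>open[unfolded a_def] and op' = op[unfolded a_def] and orbY' = orbY[unfolded a_def]
  show thesis
    by (rule that[of \<Sigma> Y "\<lambda>y. R (gi y)"])
      (fact \<Sigma>U x\<Sigma> \<Sigma>open' inj Y \<Sigma>Y YU \<rho> | erule (1) op' | erule orbY')+
qed

end

section \<open>The quotient manifold\<close>

context free_compact_action
begin

lemma mspace_Q: "mspace Q = TQ" and mdim_Q: "mdim Q = mdim M - mdim L"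
  and atlas_Q: "atlas Q = {c. is_chart TQ (mdim M - mdim L) c \<and> (\<forall>b\<in>atlas M. submersive b c orb)}"
  by (simp_all add: quotient_manifold_def)

lemma orbit_derivative_exists:
  assumes "(U, \<kappa>) \<in> smooth_charts M" "x \<in> U"
  obtains f' where "((\<lambda>c. \<kappa> (\<alpha> (ginv c) x)) has_derivative f') (at e0 within orbit_dom U x)"
  using smooth_on_has_derivative[OF orbit_map_smooth(2)[OF assms(1) chart_topspace[OF assms]] e0_orbit_dom[OF assms]] .

text \<open>The coordinate expression of the projection is smooth because, after a translation into
  the thickening \<open>Y\<close>, it is \<rho>. Its differentials are onto because a translated
  slice is a smooth local section through each given point.\<close>

lemma slice_chart:
  assumes U: "(U, \<kappa>) \<in> smooth_charts M" "x \<in> U"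
    and f': "((\<lambda>c. \<kappa> (\<alpha> (ginv c) x)) has_derivative f') (at e0 within orbit_dom U x)"
  defines "W \<equiv> orbit_normal U \<kappa> f'"
  obtains V \<psi> \<Sigma> where "(V, \<psi>) \<in> atlas Q" "\<Sigma> \<subseteq> U" "x \<in> \<Sigma>" "V = orb ` \<Sigma>" "inj_on orb \<Sigma>"
    "\<And>s. s \<in> \<Sigma> \<Longrightarrow> \<psi> (orb s) = \<kappa> s - \<kappa> x" "openin (top_of_set W) ((\<lambda>s. \<kappa> s - \<kappa> x) ` \<Sigma>)"
proof -
  obtain \<Sigma> Y \<rho> where \<Sigma>: "\<Sigma> \<subseteq> U" "x \<in> \<Sigma>" "openin (top_of_set W) ((\<lambda>s. \<kappa> s - \<kappa> x) ` \<Sigma>)" "inj_on orb \<Sigma>"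
    and op: "\<And>Z. openin (top_of_set W) Z \<Longrightarrow> Z \<subseteq> (\<lambda>s. \<kappa> s - \<kappa> x) ` \<Sigma> \<Longrightarrow> openin TQ (orb ` {s \<in> \<Sigma>. \<kappa> s - \<kappa> x \<in> Z})"
    and Y: "openin T Y" "\<Sigma> \<subseteq> Y" "Y \<subseteq> U" and \<rho>: "smooth_on (\<kappa> ` Y) \<rho>"
    and orbY: "\<And>u. u \<in> Y \<Longrightarrow> \<exists>s\<in>\<Sigma>. orb u = orb s \<and> \<rho> (\<kappa> u) = \<kappa> s - \<kappa> x"
    using slice_exists[OF U f'] unfolding W_def by blast
  define a where "a = \<kappa> x"
  define V where "V = orb ` \<Sigma>"
  define \<psi> where "\<psi> p = \<kappa> (inv_into \<Sigma> orb p) - a" for p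
  note cU = smooth_charts_is_chart[OF U(1)]
  have inv\<kappa>: "inv_into U \<kappa> (\<kappa> u) = u" if "u \<in> U" for u using is_chart_inj[OF cU] that by simp
  have \<psi>: "\<psi> (orb s) = \<kappa> s - a" if "s \<in> \<Sigma>" for s using \<Sigma>(4) that by (simp add: \<psi>_def)
  have \<psi>V: "\<psi> ` V = (\<lambda>s. \<kappa> s - a) ` \<Sigma>" unfolding V_def image_image by (rule image_cong) (simp_all add: \<psi>)
  have oW: "openin (top_of_set W) (\<psi> ` V)" using \<Sigma>(3) unfolding \<psi>V a_def .
  have sW: "subspace W" unfolding W_def by (rule subspace_orbit_normal)
  have \<Sigma>T: "\<Sigma> \<subseteq> topspace T" using chart_topspace[OF U(1)] \<Sigma>(1) by blast
  have \<psi>Y: "\<psi> (orb u) = \<rho> (\<kappa> u)" "orb u \<in> V" if "u \<in> Y" for u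
    using orbY[OF that] \<psi> by (auto simp: V_def a_def)
  have opV: "openin TQ {q \<in> V. \<psi> q \<in> Z}" if Z: "openin (top_of_set W) Z" "Z \<subseteq> \<psi> ` V" for Z
  proof -
    have "{q \<in> V. \<psi> q \<in> Z} = orb ` {s \<in> \<Sigma>. \<kappa> s - \<kappa> x \<in> Z}"
      unfolding V_def using \<psi> a_def by auto
    then show ?thesis using op[OF Z(1)] Z(2) by (simp add: \<psi>V a_def)
  qed
  have oV: "openin TQ V"
  proof -
    have "{q \<in> V. \<psi> q \<in> \<psi> ` V} = V" by blast
    then show ?thesis using opV[OF oW] by simp
  qed
  \<comment> \<open>Lifts slice coordinates back into \<Sigma>, so that \<open>orb\<close> after
    \<theta> inverts the chart.\<close>
  define \<theta> where "\<theta> w = inv_into U \<kappa> (a + w)" for w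
  have \<theta>: "\<theta> w \<in> \<Sigma>" "\<kappa> (\<theta> w) = a + w" "\<psi> (orb (\<theta> w)) = w" if "w \<in> \<psi> ` V" for w
  proof -
    obtain s where s: "s \<in> \<Sigma>" "w = \<kappa> s - a" using \<open>w \<in> \<psi> ` V\<close> unfolding \<psi>V by blast
    then have "\<theta> w = s" using inv\<kappa>[of s] \<Sigma>(1) by (auto simp: \<theta>_def)
    then show "\<theta> w \<in> \<Sigma>" "\<kappa> (\<theta> w) = a + w" "\<psi> (orb (\<theta> w)) = w" using s \<psi> by simp_all
  qed
  have \<theta>c: "continuous_map (top_of_set (\<psi> ` V)) T \<theta>"
  proof -
    have "continuous_map (top_of_set (\<psi> ` V)) (top_of_set (\<kappa> ` U)) (\<lambda>w. a + w)"
      using \<Sigma>(1) by (auto simp: continuous_map_in_subtopology \<psi>V intro!: continuous_intros)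
    from continuous_map_compose[OF this is_chart_inv_continuous[OF cU]]
    show ?thesis unfolding \<theta>_def o_def .
  qed
  have chart: "is_chart TQ (mdim M - mdim L) (V, \<psi>)"
  proof -
    have "homeomorphic_maps (subtopology TQ V) (top_of_set (\<psi> ` V)) \<psi> (\<lambda>w. orb (\<theta> w))"
      unfolding homeomorphic_maps_def
    proof (intro conjI ballI)
      have tV: "topspace (subtopology TQ V) = V" using openin_subset[OF oV] by auto
      show "continuous_map (subtopology TQ V) (top_of_set (\<psi> ` V)) \<psi>"
        unfolding continuous_map_def tV
      proof (intro conjI allI impI)
        show "\<psi> \<in> V \<rightarrow> topspace (top_of_set (\<psi> ` V))" by auto
        fix Z assume Z: "openin (top_of_set (\<psi> ` V)) Z"
        have "openin TQ {q \<in> V. \<psi> q \<in> Z}"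
          by (rule opV[OF openin_trans[OF Z oW] openin_imp_subset[OF Z]])
        then show "openin (subtopology TQ V) {q \<in> V. \<psi> q \<in> Z}"
          by (auto simp: openin_open_subtopology[OF oV])
      qed
      have "continuous_map (top_of_set (\<psi> ` V)) TQ (\<lambda>w. orb (\<theta> w))"
        using continuous_map_compose[OF \<theta>c orb_continuous] by (simp add: o_def)
      then show "continuous_map (top_of_set (\<psi> ` V)) (subtopology TQ V) (\<lambda>w. orb (\<theta> w))"
        using \<theta>(1) by (auto simp: continuous_map_in_subtopology V_def)
      show "orb (\<theta> (\<psi> q)) = q" if "q \<in> topspace (subtopology TQ V)" for q
      proof -
        have "q \<in> V" using that tV by simp
        then obtain s where s: "s \<in> \<Sigma>" "q = orb s" by (auto simp: V_def)
        then have "\<theta> (\<psi> q) = s" using \<psi>[OF s(1)] inv\<kappa>[of s] \<Sigma>(1) by (auto simp: \<theta>_def)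
        then show ?thesis using s by simp
      qed
      show "\<psi> (orb (\<theta> w)) = w" if "w \<in> topspace (top_of_set (\<psi> ` V))" for w
        using \<theta>(3) that by simp
    qed
    then have "homeomorphic_map (subtopology TQ V) (top_of_set (\<psi> ` V)) \<psi>"
      using homeomorphic_map_maps by blast
    moreover have "dim W = mdim M - mdim L"
    proof -
      have "U \<noteq> {}" using U(2) by blast
      then have "dim (span (\<kappa> ` U)) = mdim M" by (rule is_chart_model(2)[OF cU])
      moreover have "W \<inter> span (\<kappa> ` U) = W" by (auto simp: W_def orbit_normal_def)
      ultimately show ?thesis
        using dim_orbit_normal(1)[OF U f' subspace_span subset_refl orbit_tangent(2)[OF U f']] by (simp add: W_def)
    qed
    ultimately show ?thesis unfolding is_chart_def using oV sW oW by auto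
  qed
  have "submersive (U2, \<phi>) (V, \<psi>) orb" if b: "(U2, \<phi>) \<in> atlas M" for U2 \<phi>
  proof -
    have b': "(U2, \<phi>) \<in> smooth_charts M" using b atlas_subset_smooth_charts[OF M] by blast
    note c2 = smooth_charts_is_chart[OF b']
    have inv\<phi>: "inv_into U2 \<phi> (\<phi> u) = u" if "u \<in> U2" for u using is_chart_inj[OF c2] that by simp
    define D where "D = \<phi> ` (U2 \<inter> orb -` V)"
    define F where "F = \<psi> \<circ> orb \<circ> inv_into U2 \<phi>"
    have D: "openin (top_of_set (span (\<phi> ` U2))) D"
    proof -
      have "U2 \<inter> orb -` V = U2 \<inter> {u \<in> topspace T. orb u \<in> V}" using chart_topspace[OF b'] by auto
      then show ?thesis
        unfolding D_def using is_chart_image_open[OF c2 openin_continuous_map_preimage[OF orb_continuous oV]] by simp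
    qed
    have FV: "F ` D \<subseteq> \<psi> ` V" using inv\<phi> by (auto simp: F_def D_def)
    have local: "\<exists>g\<in>carrier G. \<alpha> g u \<in> \<Sigma>" if u: "u \<in> U2" "orb u \<in> V" for u
    proof -
      obtain s where s: "s \<in> \<Sigma>" "orb u = orb s" using u(2) by (auto simp: V_def)
      then obtain g where "g \<in> carrier G" "\<alpha> g u = s"
        using orb_eq_iff[of u s] chart_topspace[OF b' u(1)] \<Sigma>T by blast
      then show ?thesis using s by blast
    qed
    have F: "smooth_on D F"
    proof (rule smooth_on_local)
      fix p assume "p \<in> D"
      then obtain u where u: "u \<in> U2" "orb u \<in> V" "p = \<phi> u" by (auto simp: D_def)
      then obtain g where g: "g \<in> carrier G" "\<alpha> g u \<in> \<Sigma>" using local by blast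
      note t = translation_smooth[OF b' U(1) g(1)]
      define N where "N = \<phi> ` (U2 \<inter> {v \<in> topspace T. \<alpha> g v \<in> Y})"
      have N: "openin (top_of_set (span (\<phi> ` U2))) N"
        unfolding N_def
        by (rule is_chart_image_open[OF c2 openin_continuous_map_preimage[OF translation_continuous[OF g(1)] Y(1)]])
      have ND: "N \<subseteq> D"
        using \<psi>Y(2) orb_translate[OF g(1)] by (auto simp: N_def D_def) (metis IntI imageI vimageI)
      have "smooth_on N (\<lambda>z. \<rho> (\<kappa> (\<alpha> g (inv_into U2 \<phi> z))))"
        by (rule smooth_on_compose[OF smooth_on_subset[OF t(2)] \<rho>]) (use Y(3) inv\<phi> in \<open>auto simp: N_def\<close>)
      then have "smooth_on N F"
      proof (rule smooth_on_cong)
        fix z assume "z \<in> N"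
        then obtain v where v: "v \<in> U2" "v \<in> topspace T" "\<alpha> g v \<in> Y" "z = \<phi> v" by (auto simp: N_def)
        then show "\<rho> (\<kappa> (\<alpha> g (inv_into U2 \<phi> z))) = F z"
          using \<psi>Y(1)[OF v(3)] orb_translate[OF g(1) v(2)] inv\<phi> by (simp add: F_def)
      qed
      moreover have "openin (top_of_set D) N"
        using openin_subset_trans[OF N ND openin_imp_subset[OF D]] .
      moreover have "p \<in> N" using u g Y(2) chart_topspace[OF b'] by (auto simp: N_def)
      ultimately show "\<exists>N. openin (top_of_set D) N \<and> p \<in> N \<and> smooth_on N F" by blast
    qed
    have "\<exists>F'. (F has_derivative F') (at p within D) \<and> F' ` tangent_plane D p = tangent_plane (\<psi> ` V) (F p)"
      if p: "p \<in> D" for p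
    proof -
      obtain F' where F': "(F has_derivative F') (at p within D)" using smooth_on_has_derivative[OF F p] by blast
      obtain u where u: "u \<in> U2" "orb u \<in> V" "p = \<phi> u" using p by (auto simp: D_def)
      then obtain g where g: "g \<in> carrier G" "\<alpha> g u \<in> \<Sigma>" using local by blast
      have uT: "u \<in> topspace T" by (rule chart_topspace[OF b' u(1)])
      define h where "h = inv\<^bsub>G\<^esub> g"
      have h: "h \<in> carrier G" "\<alpha> h (\<alpha> g u) = u" using g(1) act_inv[OF g(1) uT] by (simp_all add: h_def)
      note t = translation_smooth[OF U(1) b' h(1)]
      let ?Dt = "{z \<in> \<kappa> ` U. \<alpha> h (inv_into U \<kappa> z) \<in> U2}"
      define Z where "Z = {w \<in> \<psi> ` V. \<theta> w \<in> {v \<in> topspace T. \<alpha> h v \<in> U2}}"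
      \<comment> \<open>The slice, moved by the inverse of g so that it passes through u: a local
        section of the projection in coordinates, sending F p to p.\<close>
      define \<sigma> where "\<sigma> w = \<phi> (\<alpha> h (\<theta> w))" for w
      have Z: "openin (top_of_set W) Z"
      proof -
        have "openin (top_of_set (\<psi> ` V)) Z"
          unfolding Z_def using openin_continuous_map_preimage[OF \<theta>c
              openin_continuous_map_preimage[OF translation_continuous[OF h(1)] is_chart_open[OF c2]]] by simp
        then show ?thesis using oW by (rule openin_trans)
      qed
      have Fp: "F p = \<kappa> (\<alpha> g u) - a"
        using \<psi>[OF g(2)] orb_translate[OF g(1) uT] u inv\<phi> by (simp add: F_def)
      have FpV: "F p \<in> \<psi> ` V" using FV p by blast
      have \<theta>Fp: "\<theta> (F p) = \<alpha> g u" using inv\<kappa>[of "\<alpha> g u"] g(2) \<Sigma>(1) by (auto simp: \<theta>_def Fp)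
      have FpZ: "F p \<in> Z" using FpV \<theta>Fp h(2) u(1) act_closed[OF g(1) uT] by (simp add: Z_def)
      have \<sigma>Fp: "\<sigma> (F p) = p" by (simp only: \<sigma>_def \<theta>Fp h(2)) (rule u(3)[symmetric])
      have \<sigma>s: "smooth_on Z \<sigma>"
        unfolding \<sigma>_def \<theta>_def
      proof (rule smooth_on_compose[OF smooth_on_add[OF smooth_on_const smooth_on_ident] t(2)])
        show "(+) a ` Z \<subseteq> ?Dt" using \<theta> \<Sigma>(1) by (force simp: Z_def \<theta>_def image_subset_iff)
      qed
      have \<sigma>D: "\<sigma> ` Z \<subseteq> D" and F\<sigma>: "F (\<sigma> w) = w" if "w \<in> Z" for w
      proof -
        have *: "\<sigma> w \<in> D \<and> F (\<sigma> w) = w" if w: "w \<in> Z" for w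
        proof -
          have 1: "\<theta> w \<in> \<Sigma>" "\<psi> (orb (\<theta> w)) = w" "\<alpha> h (\<theta> w) \<in> U2" "\<theta> w \<in> topspace T"
            using w \<theta> by (auto simp: Z_def)
          have o: "orb (\<alpha> h (\<theta> w)) = orb (\<theta> w)" by (rule orb_translate[OF h(1) 1(4)])
          show ?thesis using 1 o inv\<phi>[OF 1(3)] by (auto simp: \<sigma>_def D_def F_def V_def)
        qed
        show "\<sigma> ` Z \<subseteq> D" using * by blast
        show "F (\<sigma> w) = w" using * that by blast
      qed
      obtain \<sigma>' where \<sigma>': "(\<sigma> has_derivative \<sigma>') (at (F p) within Z)"
        using smooth_on_has_derivative[OF \<sigma>s FpZ] by blast
      have TW: "tangent_plane (\<psi> ` V) (F p) = W" "tangent_plane Z (F p) = W"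
        by (rule tangent_plane_openin_subspace[OF sW oW FpV], rule tangent_plane_openin_subspace[OF sW Z FpZ])
      have "F' ` tangent_plane D p \<subseteq> W"
        using tangent_plane_image[OF F F'] tangent_plane_mono[OF FV] TW(1) by blast
      moreover have "W \<subseteq> F' ` tangent_plane D p"
      proof
        fix w assume w: "w \<in> W"
        have "F' (\<sigma>' w) = w"
        proof (rule has_derivative_inverse_within[OF sW Z FpZ w \<sigma>'])
          show "(F has_derivative F') (at (\<sigma> (F p)) within D)" unfolding \<sigma>Fp by (rule F')
        qed (use \<sigma>D[OF FpZ] F\<sigma> in auto)
        moreover have "\<sigma>' w \<in> tangent_plane (\<sigma> ` Z) (\<sigma> (F p))"
          by (rule tangent_plane_image[OF \<sigma>s \<sigma>']) (simp add: TW w)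
        then have "\<sigma>' w \<in> tangent_plane D p" using tangent_plane_mono[OF \<sigma>D[OF FpZ]] \<sigma>Fp by auto
        ultimately show "w \<in> F' ` tangent_plane D p" by (metis imageI)
      qed
      ultimately show ?thesis using F' TW(1) by blast
    qed
    with F show ?thesis by (simp add: submersive_def Let_def D_def F_def)
  qed
  then have "(V, \<psi>) \<in> atlas Q" using chart unfolding atlas_Q by auto
  then show thesis
    by (rule that[of V \<psi> \<Sigma>]) (use \<Sigma> \<psi> in \<open>simp_all add: V_def a_def\<close>)
qed

text \<open>Both charts are arbitrary charts with submersive projection, so they are compared
  through M. A submersion has smooth local sections, and a section for the first chart followed by
  the projection read in the second chart is the transition map.\<close>

lemma atlas_Q_transition:
  assumes c: "(V, \<phi>) \<in> atlas Q" "(V', \<psi>) \<in> atlas Q"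
  shows "smooth_on (\<phi> ` (V \<inter> V')) (\<psi> \<circ> inv_into V \<phi>)"
proof (rule smooth_on_local)
  fix y assume "y \<in> \<phi> ` (V \<inter> V')"
  then obtain q where q: "q \<in> V" "q \<in> V'" "y = \<phi> q" by blast
  have cV: "is_chart TQ (mdim M - mdim L) (V, \<phi>)"
    and sub: "\<And>b. b \<in> atlas M \<Longrightarrow> submersive b (V, \<phi>) orb" "\<And>b. b \<in> atlas M \<Longrightarrow> submersive b (V', \<psi>) orb"
    using c unfolding atlas_Q by auto
  have inv\<phi>: "inv_into V \<phi> (\<phi> u) = u" if "u \<in> V" for u using is_chart_inj[OF cV] that by simp
  have "q \<in> topspace TQ" using openin_subset[OF is_chart_open[OF cV]] q(1) by blast
  then obtain m where m: "m \<in> topspace T" "q = orb m" by (auto simp: topspace_TQ)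
  obtain U \<omega> where U: "(U, \<omega>) \<in> atlas M" "(U, \<omega>) \<in> smooth_charts M" "m \<in> U"
    using smooth_charts_cover[OF M m(1)] by metis
  note cU = smooth_charts_is_chart[OF U(2)]
  have inv\<omega>: "inv_into U \<omega> (\<omega> u) = u" if "u \<in> U" for u using is_chart_inj[OF cU] that by simp
  let ?E = "span (\<omega> ` U)" and ?E1 = "span (\<phi> ` V)"
  define D where "D = \<omega> ` (U \<inter> orb -` V)"
  define F where "F = \<phi> \<circ> orb \<circ> inv_into U \<omega>"
  define D2 where "D2 = \<omega> ` (U \<inter> orb -` V')"
  define F2 where "F2 = \<psi> \<circ> orb \<circ> inv_into U \<omega>"
  have F: "smooth_on D F" and FT: "\<And>p. p \<in> D \<Longrightarrow> \<exists>F'. (F has_derivative F') (at p within D) \<and>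
      F' ` tangent_plane D p = tangent_plane (\<phi> ` V) (F p)"
    using sub(1)[OF U(1)] unfolding submersive_def Let_def case_prod_conv D_def F_def by blast+
  have F2: "smooth_on D2 F2"
    using sub(2)[OF U(1)] by (simp add: submersive_def Let_def D2_def F2_def)
  have D: "openin (top_of_set ?E) D"
  proof -
    have "U \<inter> orb -` V = U \<inter> {u \<in> topspace T. orb u \<in> V}" using chart_topspace[OF U(2)] by auto
    then show ?thesis
      unfolding D_def using is_chart_image_open[OF cU openin_continuous_map_preimage[OF orb_continuous is_chart_open[OF cV]]] by simp
  qed
  define p where "p = \<omega> m"
  have pD: "p \<in> D" using U(3) q m by (auto simp: p_def D_def)
  have Fp: "F p = y" using inv\<omega>[OF U(3)] q m by (simp add: F_def p_def)
  obtain F' where F': "(F has_derivative F') (at p within D)" "F' ` tangent_plane D p = tangent_plane (\<phi> ` V) (F p)"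
    using FT[OF pD] by blast
  have yV: "y \<in> \<phi> ` V" using q by blast
  have F'E: "F' ` ?E = ?E1"
    using F'(2) tangent_plane_openin_subspace[OF subspace_span D pD]
      tangent_plane_openin_subspace[OF subspace_span is_chart_model(1)[OF cV] yV] Fp by simp
  have lF': "linear F'" using F'(1) by (rule has_derivative_linear)
  obtain R where R: "range R \<subseteq> ?E" "linear R" "\<And>v. v \<in> ?E1 \<Longrightarrow> F' (R v) = v"
    using linear_exists_right_inverse_on[OF lF' subspace_span[of "\<omega> ` U"]] F'E by blast
  have pE: "p \<in> ?E" using openin_imp_subset[OF D] pD by blast
  define Dh where "Dh = {w \<in> ?E1. p + R w \<in> D}"
  \<comment> \<open>As R is a linear right inverse of the differential F', the map h has identity
    derivative at 0, and z \<mapsto> p + R (gi z) is a local section of F.\<close>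
  define h where "h w = F (p + R w)" for w
  have Dh: "openin (top_of_set ?E1) Dh"
    unfolding Dh_def by (rule openin_affine_preimage[OF D R(2)]) (use R(1) pE in \<open>auto intro: span_add\<close>)
  have zDh: "0 \<in> Dh" using pD R(2) by (simp add: Dh_def span_zero linear_0)
  have im: "(\<lambda>w. p + R w) ` Dh \<subseteq> D" by (auto simp: Dh_def)
  have hs: "smooth_on Dh h" unfolding h_def by (rule smooth_on_compose[OF smooth_on_affine[OF R(2)] F im])
  have hE: "h ` Dh \<subseteq> ?E1"
    using inv\<omega> by (auto simp: h_def Dh_def D_def F_def intro: span_base)
  have h': "(h has_derivative (\<lambda>v. F' (R v))) (at 0 within Dh)"
    unfolding h_def
    by (rule has_derivative_compose_within[OF has_derivative_affine[OF R(2)] _ im]) (simp add: linear_0[OF R(2)] F'(1))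
  obtain D' V0 gi where I: "openin (top_of_set ?E1) D'" "D' \<subseteq> Dh" "0 \<in> D'" "openin (top_of_set ?E1) V0"
    "homeomorphism D' V0 h gi" "smooth_on V0 gi"
    using subspace_inverse_function[OF subspace_span Dh zDh hs hE h' R(3)] by blast
  have gih: "h (gi y) = y" "gi y \<in> D'" if "y \<in> V0" for y using I(5) that by (auto simp: homeomorphism_def)
  define N where "N = \<phi> ` (V \<inter> V') \<inter> V0"
  have N: "openin (top_of_set (\<phi> ` (V \<inter> V'))) N"
    unfolding N_def by (rule openin_top_of_set_Int[OF I(4)]) (auto intro: span_base)
  have yN: "y \<in> N"
  proof -
    have "h 0 \<in> V0" using I(3,5) by (auto simp: homeomorphism_def)
    moreover have "h 0 = y" using Fp R(2) by (simp add: h_def linear_0)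
    ultimately show ?thesis using q by (auto simp: N_def)
  qed
  have key: "p + R (gi z) \<in> D2" "F2 (p + R (gi z)) = (\<psi> \<circ> inv_into V \<phi>) z" if z: "z \<in> N" for z
  proof -
    obtain v where v: "v \<in> V" "v \<in> V'" "z = \<phi> v" "z \<in> V0" using z by (auto simp: N_def)
    have "p + R (gi z) \<in> D" using gih(2)[OF v(4)] I(2) by (auto simp: Dh_def)
    then obtain u where u: "u \<in> U" "orb u \<in> V" "p + R (gi z) = \<omega> u" by (auto simp: D_def)
    have "\<phi> (orb u) = \<phi> v" using gih(1)[OF v(4)] u inv\<omega> v(3) by (simp add: h_def F_def)
    then have "orb u = v" using is_chart_inj[OF cV] u(2) v(1) by (meson inj_onD)
    then show "p + R (gi z) \<in> D2" "F2 (p + R (gi z)) = (\<psi> \<circ> inv_into V \<phi>) z"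
      using u v inv\<omega> inv\<phi> by (auto simp: D2_def F2_def)
  qed
  have giN: "smooth_on N gi" by (rule smooth_on_subset[OF I(6)]) (simp add: N_def)
  have aff: "smooth_on N (\<lambda>z. p + R (gi z))"
    by (rule smooth_on_add[OF smooth_on_const smooth_on_compose_linear[OF R(2) giN]])
  have "smooth_on N (\<lambda>z. F2 (p + R (gi z)))"
    by (rule smooth_on_compose[OF aff F2]) (use key(1) in blast)
  then have "smooth_on N (\<psi> \<circ> inv_into V \<phi>)"
    by (rule smooth_on_cong) (rule key(2))
  then show "\<exists>N. openin (top_of_set (\<phi> ` (V \<inter> V'))) N \<and> y \<in> N \<and> smooth_on N (\<psi> \<circ> inv_into V \<phi>)"
    using N yN by blast
qed

text \<open>The atlas is defined by a property of its charts; the slice charts show that it has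
  enough members to cover the orbit space.\<close>

lemma smooth_manifold_Q: "smooth_manifold Q"
  unfolding smooth_manifold_def
proof (intro conjI ballI)
  show "Hausdorff_space (mspace Q)" "second_countable (mspace Q)"
    using Hausdorff_TQ second_countable_TQ by (simp_all add: mspace_Q)
  show chart: "is_chart (mspace Q) (mdim Q) c" if "c \<in> atlas Q" for c
    using that by (simp add: atlas_Q mspace_Q mdim_Q)
  have "q \<in> \<Union> (fst ` atlas Q)" if "q \<in> topspace TQ" for q
  proof -
    obtain m where m: "m \<in> topspace T" "q = orb m" using \<open>q \<in> topspace TQ\<close> by (auto simp: topspace_TQ)
    obtain U \<kappa> where U: "(U, \<kappa>) \<in> smooth_charts M" "m \<in> U" using smooth_charts_cover[OF M m(1)] by metis
    obtain f' where f': "((\<lambda>c. \<kappa> (\<alpha> (ginv c) m)) has_derivative f') (at e0 within orbit_dom U m)"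
      using orbit_derivative_exists[OF U] by blast
    obtain V \<psi> \<Sigma> where V: "(V, \<psi>) \<in> atlas Q" "m \<in> \<Sigma>" "V = orb ` \<Sigma>"
      using slice_chart[OF U f'] by metis
    then have "q \<in> V" using m by simp
    then show ?thesis using V(1) by force
  qed
  moreover have "fst c \<subseteq> topspace TQ" if "c \<in> atlas Q" for c
    using chart[OF that] openin_subset[of TQ "fst c"] by (simp add: is_chart_def mspace_Q split_beta)
  ultimately show "\<Union> (fst ` atlas Q) = topspace (mspace Q)" unfolding mspace_Q by blast
  fix c c' assume "c \<in> atlas Q" "c' \<in> atlas Q"
  then show "compatible_charts c c'"
    using atlas_Q_transition[of "fst c" "snd c" "fst c'" "snd c'"] atlas_Q_transition[of "fst c'" "snd c'" "fst c" "snd c"]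
    by (cases c, cases c') (simp add: compatible_charts_def Int_commute)
qed

text \<open>The orbit of x lies in A, so the linear model S of A contains its tangent space, and the
  normal space meets S in dimension k - dim G. The second claim keeps this difference from being
  truncated.\<close>

lemma submanifold_quotient:
  assumes A: "submanifold M k A" "invariant G \<alpha> A"
  shows "submanifold Q (k - mdim L) (orb ` A)" and "A \<noteq> {} \<Longrightarrow> mdim L \<le> k"
proof -
  have AT: "A \<subseteq> topspace T" using A(1) by (simp add: submanifold_def)
  have key: "mdim L \<le> k \<and> (\<exists>(V, \<psi>)\<in>adapted_charts Q (k - mdim L) (orb ` A). orb x \<in> V)" if x: "x \<in> A" for x
  proof -
    obtain U \<kappa> S where U: "(U, \<kappa>) \<in> smooth_charts M" "x \<in> U" and S: "subspace S" "dim S = k" "S \<subseteq> span (\<kappa> ` U)"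
      "\<kappa> ` (U \<inter> A) = \<kappa> ` U \<inter> S"
      using submanifoldE[OF A(1) x] by metis
    note cU = smooth_charts_is_chart[OF U(1)]
    obtain f' where f': "((\<lambda>c. \<kappa> (\<alpha> (ginv c) x)) has_derivative f') (at e0 within orbit_dom U x)"
      using orbit_derivative_exists[OF U] by blast
    let ?W = "orbit_normal U \<kappa> f'"
    have "\<kappa> ` (A \<inter> U) \<subseteq> S" using S(4) by (auto simp: Int_commute)
    then have TS: "f' ` B \<subseteq> S"
      using orbit_tangent(5)[OF U f' A(2) x] tangent_plane_subset_subspace[OF S(1)] by blast
    note dimW = dim_orbit_normal[OF U f' S(1,3) TS]
    obtain V \<psi> \<Sigma> where V: "(V, \<psi>) \<in> atlas Q" "\<Sigma> \<subseteq> U" "x \<in> \<Sigma>" "V = orb ` \<Sigma>" "inj_on orb \<Sigma>"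
      "\<And>s. s \<in> \<Sigma> \<Longrightarrow> \<psi> (orb s) = \<kappa> s - \<kappa> x" "openin (top_of_set ?W) ((\<lambda>s. \<kappa> s - \<kappa> x) ` \<Sigma>)"
      using slice_chart[OF U f'] by blast
    have \<psi>V: "\<psi> ` V = (\<lambda>s. \<kappa> s - \<kappa> x) ` \<Sigma>" unfolding V(4) image_image by (rule image_cong) (simp_all add: V(6))
    have spanV: "span (\<psi> ` V) = ?W"
      unfolding \<psi>V by (rule span_openin_subspace[OF subspace_orbit_normal V(7)]) (use V(3) in blast)
    \<comment> \<open>The vector \<kappa> x itself lies in S, so subtracting it does not affect
      membership in S.\<close>
    have iff: "s \<in> A \<longleftrightarrow> \<kappa> s - \<kappa> x \<in> S" if s: "s \<in> \<Sigma>" for s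
    proof -
      have "s \<in> U" using s V(2) by blast
      then have "s \<in> A \<longleftrightarrow> \<kappa> s \<in> \<kappa> ` (U \<inter> A)" using is_chart_inj[OF cU] by (auto dest: inj_onD)
      also have "\<dots> \<longleftrightarrow> \<kappa> s \<in> S" using S(4) \<open>s \<in> U\<close> by auto
      also have "\<dots> \<longleftrightarrow> \<kappa> s - \<kappa> x \<in> S"
      proof -
        have "\<kappa> x \<in> S" using S(4) U(2) x by blast
        then show ?thesis using S(1) subspace_diff[of S "\<kappa> s" "\<kappa> x"] subspace_add[of S "\<kappa> s - \<kappa> x" "\<kappa> x"] by auto
      qed
      finally show ?thesis .
    qed
    have "\<psi> ` (V \<inter> orb ` A) = \<psi> ` V \<inter> (?W \<inter> S)"
    proof -
      have "V \<inter> orb ` A = orb ` {s \<in> \<Sigma>. s \<in> A}"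
        using orb_mem_image[OF A(2) AT] chart_topspace[OF U(1)] V(2) unfolding V(4) by blast
      then have "\<psi> ` (V \<inter> orb ` A) = (\<lambda>s. \<kappa> s - \<kappa> x) ` {s \<in> \<Sigma>. \<kappa> s - \<kappa> x \<in> S}"
        using V(6) iff by (force simp: image_image)
      also have "\<dots> = \<psi> ` V \<inter> S" unfolding \<psi>V by blast
      also have "\<dots> = \<psi> ` V \<inter> (?W \<inter> S)" using openin_imp_subset[OF V(7)] unfolding \<psi>V by blast
      finally show ?thesis .
    qed
    moreover have "(V, \<psi>) \<in> smooth_charts Q" using V(1) atlas_subset_smooth_charts[OF smooth_manifold_Q] by blast
    moreover have "subspace (?W \<inter> S)" by (rule subspace_inter[OF subspace_orbit_normal S(1)])
    moreover have "dim (?W \<inter> S) = k - mdim L" using dimW(1) S(2) by simp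
    moreover have "?W \<inter> S \<subseteq> span (\<psi> ` V)" unfolding spanV by blast
    ultimately have "(V, \<psi>) \<in> adapted_charts Q (k - mdim L) (orb ` A)"
      unfolding adapted_charts_def by blast
    moreover have "orb x \<in> V" using V(3,4) by blast
    ultimately show ?thesis using dimW(2) S(2) by blast
  qed
  show "A \<noteq> {} \<Longrightarrow> mdim L \<le> k" using key by blast
  show "submanifold Q (k - mdim L) (orb ` A)"
    unfolding submanifold_def mspace_Q topspace_TQ using AT key by auto
qed

end

section \<open>Convergence in Grassmannians\<close>

lemma limitin_pullback_topology:
  "limitin (pullback_topology A f X) xs l F \<longleftrightarrow>
     l \<in> A \<and> (\<forall>\<^sub>F n in F. xs n \<in> A) \<and> limitin X (\<lambda>n. f (xs n)) (f l) F"
  (is "?lhs \<longleftrightarrow> ?rhs")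
proof
  assume L: ?lhs
  then have lA: "l \<in> A" "f l \<in> topspace X" by (auto simp: limitin_def topspace_pullback_topology)
  have ev: "\<forall>\<^sub>F n in F. xs n \<in> f -` U \<inter> A" if "openin X U" "f l \<in> U" for U
    using L lA that unfolding limitin_def openin_pullback_topology by blast
  have "\<forall>\<^sub>F n in F. xs n \<in> A"
    using ev[OF openin_topspace lA(2)] by (rule eventually_mono) blast
  moreover have "\<forall>\<^sub>F n in F. f (xs n) \<in> U" if "openin X U" "f l \<in> U" for U
    using ev[OF that] by (rule eventually_mono) blast
  ultimately show ?rhs using lA by (auto simp: limitin_def)
next
  assume R: ?rhs
  have "\<forall>\<^sub>F n in F. xs n \<in> f -` U \<inter> A" if "openin X U" "f l \<in> U" for U
  proof -
    have "\<forall>\<^sub>F n in F. f (xs n) \<in> U" using R that by (auto simp: limitin_def)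
    with R show ?thesis by (auto elim: eventually_elim2)
  qed
  then show ?lhs
    using R by (auto simp: limitin_def topspace_pullback_topology openin_pullback_topology)
qed

text \<open>The function type carries the product topology, which makes convergence of projections
  pointwise; the terms have to be points of the Grassmannian only eventually.\<close>

lemma limitin_grassmannian:
  "limitin (grassmannian k) Vs V F \<longleftrightarrow>
     subspace V \<and> dim V = k \<and> (\<forall>\<^sub>F n in F. subspace (Vs n) \<and> dim (Vs n) = k) \<and>
     (\<forall>v. ((\<lambda>n. closest_point (Vs n) v) \<longlongrightarrow> closest_point V v) F)"
proof -
  have "limitin euclidean (\<lambda>n. closest_point (Vs n)) (closest_point V) F \<longleftrightarrow>
      (\<forall>v. ((\<lambda>n. closest_point (Vs n) v) \<longlongrightarrow> closest_point V v) F)"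
    unfolding euclidean_product_topology[symmetric] limitin_componentwise by simp
  then show ?thesis unfolding grassmannian_def limitin_pullback_topology by simp
qed

text \<open>By Pythagoras. It identifies \<open>closest_point\<close>, through which
  \<open>grassmannian\<close> is topologized, with any map found to be an orthogonal
  projection.\<close>

lemma closest_point_subspace_eqI:
  fixes V :: "'a::euclidean_space set"
  assumes "subspace V" "p \<in> V" "\<And>v. v \<in> V \<Longrightarrow> orthogonal v (z - p)"
  shows "closest_point V z = p"
proof -
  have "dist z p \<le> dist z y" if "y \<in> V" for y
  proof -
    have "orthogonal (z - p) (p - y)"
      using assms(3)[of "p - y"] subspace_diff[OF assms(1,2) that] by (simp add: orthogonal_commute)
    then have "(norm (z - p + (p - y)))\<^sup>2 = (norm (z - p))\<^sup>2 + (norm (p - y))\<^sup>2"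
      by (rule norm_add_Pythagorean)
    then have "(norm (z - p))\<^sup>2 \<le> (norm (z - y))\<^sup>2" by simp
    then show ?thesis by (simp add: dist_norm)
  qed
  then show ?thesis
    using closest_point_unique[OF subspace_imp_convex[OF assms(1)] closed_subspace[OF assms(1)] assms(2)] by metis
qed

lemma closest_point_subspace:
  fixes V :: "'a::euclidean_space set"
  assumes "subspace V"
  shows "linear (closest_point V)" "closest_point V z \<in> V" "v \<in> V \<Longrightarrow> orthogonal v (z - closest_point V z)"
    "v \<in> V \<Longrightarrow> closest_point V v = v" "norm (closest_point V z) \<le> norm z"
proof -
  obtain P where P: "linear P" "\<And>z. P z \<in> V" "\<And>z v. v \<in> V \<Longrightarrow> orthogonal v (z - P z)"
    using orthogonal_projection_exists[OF assms] by metis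
  have eq: "closest_point V = P"
    using closest_point_subspace_eqI[OF assms P(2) P(3)] by (simp add: fun_eq_iff)
  show "linear (closest_point V)" "closest_point V z \<in> V" "v \<in> V \<Longrightarrow> orthogonal v (z - closest_point V z)"
    unfolding eq using P by auto
  show "v \<in> V \<Longrightarrow> closest_point V v = v" by (rule closest_point_self)
  have "(norm (P z + (z - P z)))\<^sup>2 = (norm (P z))\<^sup>2 + (norm (z - P z))\<^sup>2"
    by (rule norm_add_Pythagorean) (rule P(3)[OF P(2)])
  then have "(norm (P z))\<^sup>2 \<le> (norm z)\<^sup>2" by simp
  then show "norm (closest_point V z) \<le> norm z" unfolding eq by simp
qed

text \<open>The projection of v onto \<open>Vs n\<close> is at least as close to v as u n, so these
  projections tend to v; by the topology they also tend to the projection of v onto V.\<close>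

lemma limitin_grassmannian_mem:
  fixes V :: "'a::euclidean_space set"
  assumes "limitin (grassmannian k) Vs V sequentially" "u \<longlonglongrightarrow> v" "\<forall>\<^sub>F n in sequentially. u n \<in> Vs n"
  shows "v \<in> V"
proof -
  have V: "subspace V" "(\<lambda>n. closest_point (Vs n) v) \<longlonglongrightarrow> closest_point V v"
    "\<forall>\<^sub>F n in sequentially. subspace (Vs n) \<and> dim (Vs n) = k"
    using assms(1) by (auto simp: limitin_grassmannian)
  have "\<forall>\<^sub>F n in sequentially. norm (closest_point (Vs n) v - v) \<le> norm (u n - v)"
    using assms(3) V(3)
  proof eventually_elim
    case (elim n)
    have "dist v (closest_point (Vs n) v) \<le> dist v (u n)"
      using closest_point_le[OF closed_subspace elim(1)] elim(2) by blast
    then show ?case by (simp add: dist_norm norm_minus_commute)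
  qed
  moreover have "(\<lambda>n. norm (u n - v)) \<longlonglongrightarrow> 0" using assms(2) by (simp add: LIM_zero tendsto_norm_zero)
  ultimately have "(\<lambda>n. closest_point (Vs n) v - v) \<longlonglongrightarrow> 0" by (rule Lim_null_comparison)
  then have "(\<lambda>n. closest_point (Vs n) v) \<longlonglongrightarrow> v" by (simp add: LIM_zero_iff)
  then have "closest_point V v = v" using V(2) LIMSEQ_unique by blast
  then show "v \<in> V" using closest_point_subspace(2)[OF V(1), of v] by simp
qed

text \<open>The projections of v onto the planes serve as u. With the preceding lemma, the limit
  plane consists exactly of the limits of vectors taken from the planes.\<close>

lemma limitin_grassmannian_approx:
  fixes V :: "'a::euclidean_space set"
  assumes "limitin (grassmannian k) Vs V sequentially" "v \<in> V"
  obtains u where "u \<longlonglongrightarrow> v" "\<forall>\<^sub>F n in sequentially. u n \<in> Vs n"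
proof -
  have V: "subspace V" "(\<lambda>n. closest_point (Vs n) v) \<longlonglongrightarrow> closest_point V v"
    "\<forall>\<^sub>F n in sequentially. subspace (Vs n) \<and> dim (Vs n) = k"
    using assms(1) by (auto simp: limitin_grassmannian)
  have "\<forall>\<^sub>F n in sequentially. closest_point (Vs n) v \<in> Vs n"
    using V(3) by (rule eventually_mono) (simp add: closest_point_subspace(2))
  moreover have "(\<lambda>n. closest_point (Vs n) v) \<longlonglongrightarrow> v"
    using V(2) closest_point_subspace(4)[OF V(1) assms(2)] by simp
  ultimately show thesis using that by blast
qed

lemma limitin_grassmannian_subset:
  fixes V :: "'a::euclidean_space set"
  assumes "limitin (grassmannian k) Vs V sequentially" "closed W" "\<And>n. Vs n \<subseteq> W"
  shows "V \<subseteq> W"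
proof
  fix v assume "v \<in> V"
  then obtain u where u: "u \<longlonglongrightarrow> v" "\<forall>\<^sub>F n in sequentially. u n \<in> Vs n"
    using limitin_grassmannian_approx[OF assms(1)] by blast
  from u(2) have "\<forall>\<^sub>F n in sequentially. u n \<in> W" by (rule eventually_mono) (use assms(3) in blast)
  then show "v \<in> W" using Lim_in_closed_set[OF assms(2) _ _ u(1)] by simp
qed

text \<open>Orthogonal projections have norm at most 1, so a subsequence converges to some q.
  Orthogonality of q w and z - q z survives the limit and makes q the projection onto its range. The
  dimension cannot jump, since projections at distance less than 1 have equal rank.\<close>

lemma grassmannian_convergent_subsequence:
  fixes Vs :: "nat \<Rightarrow> 'a::euclidean_space set"
  assumes "\<And>n. subspace (Vs n)" "\<And>n. dim (Vs n) = k"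
  obtains r V where "strict_mono r" "limitin (grassmannian k) (\<lambda>n. Vs (r n)) V sequentially"
proof -
  define p where "p n = Blinfun (closest_point (Vs n))" for n
  have p: "blinfun_apply (p n) = closest_point (Vs n)" for n
    unfolding p_def using closest_point_subspace(1)[OF assms(1)]
    by (intro bounded_linear_Blinfun_apply) (simp add: linear_conv_bounded_linear)
  have "norm (p n) \<le> 1" for n
    by (rule norm_blinfun_bound) (use closest_point_subspace(5)[OF assms(1)] in \<open>simp_all add: p\<close>)
  then have "bounded (range p)" by (auto simp: bounded_iff)
  then obtain q r where r: "strict_mono r" "(p \<circ> r) \<longlonglongrightarrow> q"
    using bounded_imp_convergent_subsequence by blast
  have conv: "(\<lambda>n. closest_point (Vs (r n)) v) \<longlonglongrightarrow> blinfun_apply q v" for v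
    using blinfun.tendsto[OF r(2) tendsto_const[of v]] by (simp add: p)
  define V where "V = range (blinfun_apply q)"
  have V: "subspace V"
    unfolding V_def by (rule linear_subspace_image) (simp_all add: bounded_linear.linear blinfun.bounded_linear_right)
  have orth: "orthogonal (blinfun_apply q w) (z - blinfun_apply q z)" for w z
  proof -
    have "(\<lambda>n. closest_point (Vs (r n)) w \<bullet> (z - closest_point (Vs (r n)) z)) \<longlonglongrightarrow> blinfun_apply q w \<bullet> (z - blinfun_apply q z)"
      by (intro tendsto_intros conv)
    moreover have "closest_point (Vs (r n)) w \<bullet> (z - closest_point (Vs (r n)) z) = 0" for n
      using closest_point_subspace(3)[OF assms(1) closest_point_subspace(2)[OF assms(1)]] by (simp add: orthogonal_def)
    ultimately show ?thesis by (simp add: orthogonal_def LIMSEQ_const_iff)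
  qed
  have cp: "closest_point V z = blinfun_apply q z" for z
    by (rule closest_point_subspace_eqI[OF V]) (use orth in \<open>auto simp: V_def\<close>)
  have "\<forall>\<^sub>F n in sequentially. dist ((p \<circ> r) n) q < 1"
    using r(2) by (rule tendstoD) simp
  then obtain n where n: "norm (p (r n) - q) < 1"
    by (auto simp: dist_norm eventually_sequentially)
  have less: "norm (closest_point (Vs (r n)) v - closest_point V v) < norm v" if "v \<noteq> 0" for v
  proof -
    have "norm (blinfun_apply (p (r n) - q) v) \<le> norm (p (r n) - q) * norm v" by (rule norm_blinfun)
    also have "\<dots> < 1 * norm v" using n that by (intro mult_strict_right_mono) auto
    finally show ?thesis by (simp add: blinfun.diff_left p cp)
  qed
  \<comment> \<open>If a nonzero v in S had projection 0 onto S', its two projections would be v and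
    0, at distance |v|.\<close>
  have dim_le: "dim S \<le> dim S'" if "subspace S" "subspace S'"
    "\<And>v. v \<noteq> 0 \<Longrightarrow> norm (closest_point S' v - closest_point S v) < norm v" for S S' :: "'a set"
  proof -
    note lin = closest_point_subspace(1)[OF that(2)]
    have "inj_on (closest_point S') S"
      unfolding linear_inj_on_iff_eq_0[OF lin that(1)]
    proof (intro ballI impI)
      fix v assume v: "v \<in> S" "closest_point S' v = 0"
      show "v = 0"
        using that(3)[of v] v closest_point_subspace(4)[OF that(1) v(1)] by fastforce
    qed
    moreover have "span S = S" using that(1) by (simp add: span_eq_iff)
    ultimately have "dim (closest_point S' ` S) = dim S" using dim_image_eq[OF lin, of S] by metis
    moreover have "closest_point S' ` S \<subseteq> S'" using closest_point_subspace(2)[OF that(2)] by blast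
    ultimately show ?thesis using dim_subset by metis
  qed
  have "dim V = k"
  proof (rule antisym)
    show "dim V \<le> k" using dim_le[OF V assms(1) less] assms(2) by simp
    show "k \<le> dim V" using dim_le[OF assms(1)[of "r n"] V] less assms(2) by (simp add: norm_minus_commute)
  qed
  then have "limitin (grassmannian k) (\<lambda>n. Vs (r n)) V sequentially"
    using V assms conv cp by (simp add: limitin_grassmannian)
  then show thesis using that r(1) by blast
qed

section \<open>The quotient stratification\<close>

lemma limitin_chart:
  assumes "is_chart T n (U, \<phi>)" "x \<in> U" "\<And>k. s k \<in> U"
  shows "limitin T s x F \<longleftrightarrow> ((\<lambda>k. \<phi> (s k)) \<longlongrightarrow> \<phi> x) F"
proof
  assume "limitin T s x F"
  then have "limitin (subtopology T U) s x F" using assms(2,3) by (simp add: limitin_subtopology)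
  from continuous_map_limit[OF is_chart_continuous[OF assms(1)] this]
  show "((\<lambda>k. \<phi> (s k)) \<longlongrightarrow> \<phi> x) F" by (simp add: o_def)
next
  assume "((\<lambda>k. \<phi> (s k)) \<longlongrightarrow> \<phi> x) F"
  then have "limitin (top_of_set (\<phi> ` U)) (\<lambda>k. \<phi> (s k)) (\<phi> x) F"
    using assms(2,3) by (simp add: limitin_subtopology)
  from continuous_map_limit[OF is_chart_inv_continuous[OF assms(1)] this]
  show "limitin T s x F" using is_chart_inj[OF assms(1)] assms(2,3) by (simp add: o_def)
qed

context free_compact_action
begin

text \<open>The orbit direction at \<open>s k\<close> given by b is a partial derivative of the
  action map in coordinates. It is computed from a smooth extension F defined near (e0, \<kappa> x),
  so it depends continuously on the point and converges to the orbit direction at x.\<close>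

lemma orbit_direction_limit:
  assumes U: "(U, \<kappa>) \<in> smooth_charts M" "x \<in> U"
    and f': "((\<lambda>c. \<kappa> (\<alpha> (ginv c) x)) has_derivative f') (at e0 within orbit_dom U x)"
    and A: "invariant G \<alpha> A" and s: "\<And>k. s k \<in> A \<inter> U" "limitin T s x sequentially" and b: "b \<in> B"
  obtains v where "v \<longlonglongrightarrow> f' b" "\<forall>\<^sub>F k in sequentially. v k \<in> tangent_plane (\<kappa> ` (A \<inter> U)) (\<kappa> (s k))"
proof -
  note cU = smooth_charts_is_chart[OF U(1)]
  have inv\<kappa>: "inv_into U \<kappa> (\<kappa> u) = u" if "u \<in> U" for u using is_chart_inj[OF cU] that by simp
  define H where "H = (\<lambda>z. \<kappa> (\<alpha> (ginv (fst z)) (inv_into U \<kappa> (snd z))))"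
  define D where "D = {z \<in> \<gamma> ` UG \<times> \<kappa> ` U. \<alpha> (ginv (fst z)) (inv_into U \<kappa> (snd z)) \<in> U}"
  have H: "smooth_on D H"
    using smooth_map_prod_coordinates(2)[OF L M M act_smooth UG(1) U(1) U(1)]
    by (simp add: D_def H_def split_beta)
  have memD: "(e0, \<kappa> y) \<in> D" if "y \<in> U" for y
    using that UG(2) ginv[OF UG(2)] inv\<kappa> act_one[OF chart_topspace[OF U(1)]] by (auto simp: D_def)
  obtain W F where W: "open W" "(e0, \<kappa> x) \<in> W" "\<And>k. ck_on k W F" "\<And>z. z \<in> D \<Longrightarrow> z \<in> W \<Longrightarrow> F z = H z"
    using smooth_onE[OF H memD[OF U(2)]] by blast
  define dF where "dF z = frechet_derivative F (at z)" for z
  have der: "((\<lambda>c. \<kappa> (\<alpha> (ginv c) y)) has_derivative (\<lambda>b. dF (e0, \<kappa> y) (b, 0))) (at e0 within orbit_dom U y)"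
    if y: "y \<in> U" "(e0, \<kappa> y) \<in> W" for y
  proof -
    have "(F has_derivative dF (e0, \<kappa> y)) (at (e0, \<kappa> y))"
      unfolding dF_def by (rule ck_on_SucE[OF W(3) y(2)])
    from has_derivative_within_extension[OF W(1) y(2) memD[OF y(1)] W(4) this]
    have H': "(H has_derivative dF (e0, \<kappa> y)) (at (e0, \<kappa> y) within D)" by blast
    have sub: "(\<lambda>c. (c, \<kappa> y)) ` orbit_dom U y \<subseteq> D"
      using y(1) inv\<kappa> by (auto simp: D_def orbit_dom_def)
    have "((\<lambda>c. H (c, \<kappa> y)) has_derivative (\<lambda>b. dF (e0, \<kappa> y) (b, 0))) (at e0 within orbit_dom U y)"
      by (rule has_derivative_compose_within[OF has_derivative_Pair[OF has_derivative_ident has_derivative_const] H' sub])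
    then show ?thesis using inv\<kappa>[OF y(1)] by (simp add: H_def)
  qed
  have dFx: "dF (e0, \<kappa> x) (b, 0) = f' b"
    by (rule has_derivative_unique_on_subspace[OF subspace_span orbit_map_smooth(1)[OF U(1) chart_topspace[OF U]]
          e0_orbit_dom[OF U] b der[OF U(2) W(2)] f'])
  have sx: "(\<lambda>k. \<kappa> (s k)) \<longlonglongrightarrow> \<kappa> x"
    using limitin_chart[OF cU U(2), of s] s by simp
  then have ex: "(\<lambda>k. (e0, \<kappa> (s k))) \<longlonglongrightarrow> (e0, \<kappa> x)" by (intro tendsto_Pair tendsto_const)
  have ev: "\<forall>\<^sub>F k in sequentially. (e0, \<kappa> (s k)) \<in> W"
    by (rule topological_tendstoD[OF ex W(1,2)])
  have "ck_on 0 W (\<lambda>z. dF z (b, 0))"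
    using W(3)[of "Suc 0"] unfolding dF_def by simp
  then have "isCont (\<lambda>z. dF z (b, 0)) (e0, \<kappa> x)"
    using W(1,2) by (simp add: continuous_on_eq_continuous_at)
  from isCont_tendsto_compose[OF this ex]
  have "(\<lambda>k. dF (e0, \<kappa> (s k)) (b, 0)) \<longlonglongrightarrow> f' b" by (simp add: dFx)
  moreover have "\<forall>\<^sub>F k in sequentially. dF (e0, \<kappa> (s k)) (b, 0) \<in> tangent_plane (\<kappa> ` (A \<inter> U)) (\<kappa> (s k))"
    using ev
  proof eventually_elim
    case (elim k)
    have sk: "s k \<in> U" "s k \<in> A" using s(1)[of k] by auto
    show ?case using orbit_tangent(5)[OF U(1) sk(1) der[OF sk(1) elim] A sk(2)] b by blast
  qed
  ultimately show thesis by (rule that)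
qed

lemma whitney_B_quotient:
  assumes wB: "whitney_B M R S x" and R: "invariant G \<alpha> R" "R \<subseteq> topspace T"
    and S: "invariant G \<alpha> S" "submanifold M d S" "S \<noteq> {}"
  shows "whitney_B Q (orb ` R) (orb ` S) (orb x)"
proof -
  obtain U \<kappa> where U: "(U, \<kappa>) \<in> smooth_charts M" "x \<in> U"
    and wh: "\<And>xs ys l \<tau>. (\<forall>k. xs k \<in> R \<inter> U) \<and> (\<forall>k. ys k \<in> S \<inter> U) \<and>
           limitin T xs x sequentially \<and> limitin T ys x sequentially \<and>
           limitin (grassmannian 1) (\<lambda>k. span {\<kappa> (ys k) - \<kappa> (xs k)}) l sequentially \<and>
           limitin (grassmannian (submanifold_dim M S))
             (\<lambda>k. tangent_plane (\<kappa> ` (S \<inter> U)) (\<kappa> (ys k))) \<tau> sequentially \<Longrightarrow> l \<subseteq> \<tau>"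
    using wB unfolding whitney_B_def by blast
  note cU = smooth_charts_is_chart[OF U(1)]
  have ST: "S \<subseteq> topspace T" using S(2) by (simp add: submanifold_def)
  have dM: "submanifold_dim M S = d" by (rule submanifold_dim_eq[OF M S(2,3)])
  note sub = submanifold_quotient[OF S(2,1)]
  have dQ: "submanifold_dim Q (orb ` S) = d - mdim L"
    using S(3) by (intro submanifold_dim_eq[OF smooth_manifold_Q sub(1)]) simp
  obtain f' where f': "((\<lambda>c. \<kappa> (\<alpha> (ginv c) x)) has_derivative f') (at e0 within orbit_dom U x)"
    using orbit_derivative_exists[OF U] by blast
  let ?W = "orbit_normal U \<kappa> f'"
  obtain V \<psi> \<Sigma> where V: "(V, \<psi>) \<in> atlas Q" "\<Sigma> \<subseteq> U" "x \<in> \<Sigma>" "V = orb ` \<Sigma>" "inj_on orb \<Sigma>"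
    "\<And>s. s \<in> \<Sigma> \<Longrightarrow> \<psi> (orb s) = \<kappa> s - \<kappa> x" "openin (top_of_set ?W) ((\<lambda>s. \<kappa> s - \<kappa> x) ` \<Sigma>)"
    using slice_chart[OF U f'] by blast
  have VQ: "(V, \<psi>) \<in> smooth_charts Q" using V(1) atlas_subset_smooth_charts[OF smooth_manifold_Q] by blast
  have cV: "is_chart TQ (mdim Q) (V, \<psi>)" using smooth_charts_is_chart[OF VQ] by (simp add: mspace_Q)
  have xV: "orb x \<in> V" using V(3,4) by blast
  have \<Sigma>W: "\<kappa> s - \<kappa> x \<in> ?W" if "s \<in> \<Sigma>" for s using openin_imp_subset[OF V(7)] that by blast
  have \<Sigma>T: "\<Sigma> \<subseteq> topspace T" using V(2) chart_topspace[OF U(1)] by blast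
  have main: "l \<subseteq> \<tau>"
    if xs: "\<forall>k. xs k \<in> orb ` R \<inter> V" and ys: "\<forall>k. ys k \<in> orb ` S \<inter> V"
      and lim: "limitin (mspace Q) xs (orb x) sequentially" "limitin (mspace Q) ys (orb x) sequentially"
      and l: "limitin (grassmannian 1) (\<lambda>k. span {\<psi> (ys k) - \<psi> (xs k)}) l sequentially"
      and \<tau>: "limitin (grassmannian (submanifold_dim Q (orb ` S)))
             (\<lambda>k. tangent_plane (\<psi> ` (orb ` S \<inter> V)) (\<psi> (ys k))) \<tau> sequentially" for xs ys l \<tau>
  proof -
    \<comment> \<open>Sequences in the quotient are lifted into \<Sigma>, where \<psi> and \<kappa>
      differ only by the constant \<kappa> x.\<close>
    have lift: "\<exists>s. \<forall>k. s k \<in> A \<inter> \<Sigma> \<and> orb (s k) = zs k"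
      if A: "invariant G \<alpha> A" "A \<subseteq> topspace T" and zs: "\<forall>k. zs k \<in> orb ` A \<inter> V" for A and zs :: "nat \<Rightarrow> 'p set"
    proof -
      have "\<exists>s. s \<in> A \<inter> \<Sigma> \<and> orb s = zs k" for k
      proof -
        obtain s where "s \<in> \<Sigma>" "zs k = orb s" using zs V(4) by blast
        moreover from this have "s \<in> A" using orb_mem_image[OF A, of s] zs \<Sigma>T by (metis IntD1 subsetD)
        ultimately show ?thesis by auto
      qed
      then show ?thesis by metis
    qed
    obtain s where s: "\<And>k. s k \<in> R \<inter> \<Sigma>" "\<And>k. orb (s k) = xs k" using lift[OF R xs] by blast
    obtain t where t: "\<And>k. t k \<in> S \<inter> \<Sigma>" "\<And>k. orb (t k) = ys k" using lift[OF S(1) ST ys] by blast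
    have \<psi>s: "\<psi> (xs k) = \<kappa> (s k) - \<kappa> x" and \<psi>t: "\<psi> (ys k) = \<kappa> (t k) - \<kappa> x" for k
      using V(6)[of "s k"] V(6)[of "t k"] s[of k] t[of k] by auto
    have conv: "limitin T u x sequentially"
      if u: "\<And>k. u k \<in> \<Sigma>" "\<And>k. orb (u k) = zs k" and z: "limitin (mspace Q) zs (orb x) sequentially" for u and zs :: "nat \<Rightarrow> 'p set"
    proof -
      have zV: "zs k \<in> V" for k using u[of k] V(4) by blast
      have "(\<lambda>k. \<psi> (zs k)) \<longlonglongrightarrow> \<psi> (orb x)" using z unfolding mspace_Q limitin_chart[OF cV xV zV] .
      moreover have "\<psi> (zs k) = \<kappa> (u k) - \<kappa> x" for k using V(6)[OF u(1)[of k]] u(2)[of k] by simp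
      ultimately have "(\<lambda>k. \<kappa> (u k) - \<kappa> x) \<longlonglongrightarrow> 0" using V(6)[OF V(3)] by simp
      then have "(\<lambda>k. \<kappa> (u k)) \<longlonglongrightarrow> \<kappa> x" by (simp add: LIM_zero_iff)
      moreover have "u k \<in> U" for k using u(1) V(2) by blast
      ultimately show ?thesis using limitin_chart[OF cU U(2)] by blast
    qed
    have sx: "limitin T s x sequentially" and tx: "limitin T t x sequentially"
      using conv[OF _ s(2) lim(1)] conv[OF _ t(2) lim(2)] s(1) t(1) by blast+
    have sU: "s k \<in> R \<inter> U" and tU: "t k \<in> S \<inter> U" for k using s(1)[of k] t(1)[of k] V(2) by auto
    define \<tau>k where "\<tau>k k = tangent_plane (\<kappa> ` (S \<inter> U)) (\<kappa> (t k))" for k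
    have \<tau>k: "subspace (\<tau>k k)" "dim (\<tau>k k) = d" for k
      using tangent_plane_submanifold[OF M S(2) U(1)] tU[of k] unfolding \<tau>k_def by blast+
    \<comment> \<open>Convergence of the planes downstairs does not make the larger planes upstairs
      converge. Compactness of the Grassmannian supplies a subsequence, and passing to it does not
      affect the limits l and \<tau>.\<close>
    obtain r \<tau>' where r: "strict_mono r" "limitin (grassmannian d) (\<lambda>n. \<tau>k (r n)) \<tau>' sequentially"
      using grassmannian_convergent_subsequence[of \<tau>k d] \<tau>k by blast
    have l': "limitin (grassmannian 1) (\<lambda>k. span {\<kappa> (t (r k)) - \<kappa> (s (r k))}) l sequentially"
      using limitin_subsequence[OF r(1) l] by (simp add: o_def \<psi>s \<psi>t)
    have "l \<subseteq> \<tau>'"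
    proof (rule wh[of "\<lambda>k. s (r k)" "\<lambda>k. t (r k)"], intro conjI allI)
      show "limitin T (\<lambda>k. s (r k)) x sequentially" "limitin T (\<lambda>k. t (r k)) x sequentially"
        using limitin_subsequence[OF r(1) sx] limitin_subsequence[OF r(1) tx] by (simp_all add: o_def)
      show "limitin (grassmannian (submanifold_dim M S)) (\<lambda>k. tangent_plane (\<kappa> ` (S \<inter> U)) (\<kappa> (t (r k)))) \<tau>' sequentially"
        using r(2) by (simp add: dM \<tau>k_def)
    qed (fact sU tU l')+
    have closedW: "closed ?W" by (rule closed_subspace[OF subspace_orbit_normal])
    have "span {\<psi> (ys k) - \<psi> (xs k)} \<subseteq> ?W" for k
    proof -
      have "\<psi> (ys k) \<in> ?W" "\<psi> (xs k) \<in> ?W" using \<psi>s \<psi>t \<Sigma>W s(1) t(1) by auto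
      then show ?thesis by (intro span_minimal subspace_orbit_normal) (simp add: subspace_diff[OF subspace_orbit_normal])
    qed
    then have lW: "l \<subseteq> ?W" by (rule limitin_grassmannian_subset[OF l closedW])
    have im: "\<psi> ` (orb ` S \<inter> V) = (\<lambda>z. z - \<kappa> x) ` \<kappa> ` (S \<inter> \<Sigma>)"
    proof -
      have "orb ` S \<inter> V = orb ` (S \<inter> \<Sigma>)" using orb_mem_image[OF S(1) ST] \<Sigma>T unfolding V(4) by blast
      then show ?thesis using V(6) by (auto simp: image_image intro!: image_cong)
    qed
    \<comment> \<open>Up to translation, the plane downstairs is tangent to the image of S \<inter>
      \<Sigma>, a subset of the image of S \<inter> U.\<close>
    have tk: "tangent_plane (\<psi> ` (orb ` S \<inter> V)) (\<psi> (ys k)) \<subseteq> \<tau>k k" for k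
    proof -
      have "tangent_plane (\<psi> ` (orb ` S \<inter> V)) (\<psi> (ys k)) = tangent_plane (\<kappa> ` (S \<inter> \<Sigma>)) (\<kappa> (t k))"
        unfolding im \<psi>t by (rule tangent_plane_translation)
      moreover have "\<kappa> ` (S \<inter> \<Sigma>) \<subseteq> \<kappa> ` (S \<inter> U)" using V(2) by blast
      ultimately show ?thesis unfolding \<tau>k_def using tangent_plane_mono by metis
    qed
    have "\<psi> ` (orb ` S \<inter> V) \<subseteq> ?W" unfolding im using \<Sigma>W by auto
    then have "tangent_plane (\<psi> ` (orb ` S \<inter> V)) (\<psi> (ys k)) \<subseteq> ?W" for k
      by (rule tangent_plane_subset_subspace[OF subspace_orbit_normal])
    then have \<tau>W: "\<tau> \<subseteq> ?W" by (rule limitin_grassmannian_subset[OF \<tau> closedW])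
    have \<tau>\<tau>': "\<tau> \<subseteq> \<tau>'"
    proof
      fix v assume "v \<in> \<tau>"
      then obtain u where u: "u \<longlonglongrightarrow> v" "\<forall>\<^sub>F k in sequentially. u k \<in> tangent_plane (\<psi> ` (orb ` S \<inter> V)) (\<psi> (ys k))"
        using limitin_grassmannian_approx[OF \<tau>] by blast
      have "(\<lambda>k. u (r k)) \<longlonglongrightarrow> v" using LIMSEQ_subseq_LIMSEQ[OF u(1) r(1)] by (simp add: o_def)
      moreover have "\<forall>\<^sub>F k in sequentially. u (r k) \<in> \<tau>k (r k)"
        using eventually_subseq[OF r(1) u(2)] by (rule eventually_mono) (use tk in blast)
      ultimately show "v \<in> \<tau>'" by (rule limitin_grassmannian_mem[OF r(2)])
    qed
    let ?T = "f' ` B"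
    have T\<tau>': "?T \<subseteq> \<tau>'"
    proof
      fix w assume "w \<in> ?T"
      then obtain b where b: "b \<in> B" "w = f' b" by blast
      obtain v where v: "v \<longlonglongrightarrow> f' b" "\<forall>\<^sub>F k in sequentially. v k \<in> \<tau>k k"
        using orbit_direction_limit[OF U f' S(1) tU tx b(1)] unfolding \<tau>k_def by blast
      have "(\<lambda>k. v (r k)) \<longlonglongrightarrow> f' b" using LIMSEQ_subseq_LIMSEQ[OF v(1) r(1)] by (simp add: o_def)
      from limitin_grassmannian_mem[OF r(2) this eventually_subseq[OF r(1) v(2)]]
      show "w \<in> \<tau>'" by (simp add: b(2))
    qed
    have sub\<tau>: "subspace \<tau>" "dim \<tau> = d - mdim L" "subspace \<tau>'" "dim \<tau>' = d"
      using \<tau> r(2) by (auto simp: limitin_grassmannian dQ)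
    note tan = orbit_tangent[OF U f']
    have TW: "v = 0" if "v \<in> ?T" "v \<in> ?W" for v
      using that by (auto simp: orbit_normal_def orthogonal_self)
    let ?sum = "{u + w | u w. u \<in> ?T \<and> w \<in> \<tau>}"
    have "?T \<inter> \<tau> = {0}"
      using TW \<tau>W subspace_0[OF tan(1)] subspace_0[OF sub\<tau>(1)] by blast
    then have "dim (?T \<inter> \<tau>) = 0" by simp
    \<comment> \<open>The dimensions dim G and d - dim G add up to d because dim G is at most d; so
      the sum fills \<tau>'.\<close>
    then have "dim ?sum = d"
      using dim_sums_Int[OF tan(1) sub\<tau>(1)] tan(3) sub\<tau>(2) sub(2)[OF S(3)] by linarith
    moreover have "?sum \<subseteq> \<tau>'" using T\<tau>' \<tau>\<tau>' subspace_add[OF sub\<tau>(3)] by blast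
    ultimately have eq: "?sum = \<tau>'"
      by (intro subspace_dim_equal[OF subspace_sums[OF tan(1) sub\<tau>(1)] sub\<tau>(3)]) (simp_all only: sub\<tau>(4) order_refl)
    show "l \<subseteq> \<tau>"
    proof
      fix v assume v: "v \<in> l"
      then have "v \<in> ?sum" using \<open>l \<subseteq> \<tau>'\<close> eq by blast
      then obtain u w where uw: "v = u + w" "u \<in> ?T" "w \<in> \<tau>" by blast
      have "v - w \<in> ?W" using lW \<tau>W v uw(3) by (intro subspace_diff[OF subspace_orbit_normal]) auto
      then have "u = 0" using TW uw by simp
      then show "v \<in> \<tau>" using uw by simp
    qed
  qed
  show ?thesis
    unfolding whitney_B_def
  proof (rule bexI[OF _ VQ], unfold prod.case, intro conjI allI impI)
    show "orb x \<in> V" by (rule xV)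
  qed (elim conjE, rule main)
qed

section \<open>Strata, closures and dimensions in the quotient\<close>

lemma submanifold_dim_quotient:
  assumes "submanifold M k A" "invariant G \<alpha> A" "A \<noteq> {}"
  shows "submanifold_dim Q (orb ` A) = submanifold_dim M A - mdim L" "mdim L \<le> submanifold_dim M A"
  using submanifold_quotient(2)[OF assms(1-3)] submanifold_dim_eq[OF M assms(1,3)] assms(3)
    submanifold_dim_eq[OF smooth_manifold_Q submanifold_quotient(1)[OF assms(1,2)]] by simp_all

text \<open>Stratifications take closures relative to X, while \<open>orb_closure\<close> is about
  closures in M; this reconciles the two.\<close>

lemma orb_closure_subtopology:
  assumes "invariant G \<alpha> A" "A \<subseteq> X" "X \<subseteq> topspace T" "x \<in> X"
  shows "orb x \<in> subtopology TQ (orb ` X) closure_of (orb ` A) \<longleftrightarrow> x \<in> subtopology T X closure_of A"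
proof -
  have "orb ` X \<inter> orb ` A = orb ` A" "X \<inter> A = A" using assms(2) by auto
  then show ?thesis
    using orb_closure[OF assms(1) subset_trans[OF assms(2,3)] subsetD[OF assms(3,4)]] assms(4)
    by (simp add: closure_of_subtopology)
qed

lemma orb_restrict_open_map:
  assumes "invariant G \<alpha> X" "X \<subseteq> topspace T"
  shows "continuous_map (subtopology T X) (subtopology TQ (orb ` X)) orb"
    "open_map (subtopology T X) (subtopology TQ (orb ` X)) orb"
proof -
  show "continuous_map (subtopology T X) (subtopology TQ (orb ` X)) orb"
    by (auto simp: continuous_map_in_subtopology continuous_map_from_subtopology orb_continuous)
  show "open_map (subtopology T X) (subtopology TQ (orb ` X)) orb"
    unfolding open_map_def
  proof (intro allI impI)
    fix W assume "openin (subtopology T X) W"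
    then obtain N where N: "openin T N" "W = N \<inter> X" by (auto simp: openin_subtopology)
    have "orb ` W = orb ` N \<inter> orb ` X"
      using orb_mem_image[OF assms] openin_subset[OF N(1)] N(2) by blast
    then show "openin (subtopology TQ (orb ` X)) (orb ` W)"
      using orb_open_map N(1) by (auto simp: open_map_def openin_subtopology)
  qed
qed

text \<open>The open and the closed set that cut out A need not be invariant, and the image of an
  intersection can be smaller than the intersection of the images. Replacing the closed set by the
  closure of A repairs this, because \<open>orb_closure\<close> decides membership there orbit by
  orbit.\<close>

lemma locally_closed_quotient:
  assumes X: "invariant G \<alpha> X" "closedin T X" and A: "invariant G \<alpha> A" "locally_closed_in (subtopology T X) A"
  shows "locally_closed_in (subtopology TQ (orb ` X)) (orb ` A)"
proof -
  have XT: "X \<subseteq> topspace T" using X(2) by (rule closedin_subset)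
  obtain W C where W: "openin (subtopology T X) W" "closedin (subtopology T X) C" "A = W \<inter> C"
    using A(2) by (auto simp: locally_closed_in_def)
  obtain N where N: "openin T N" "W = N \<inter> X" using W(1) by (auto simp: openin_subtopology)
  have C: "closedin T C" "C \<subseteq> X"
    using closedin_trans_full[OF W(2) X(2)] closedin_subset[OF W(2)] by auto
  have AX: "A \<subseteq> X" using W(3) C(2) by blast
  then have AT: "A \<subseteq> topspace T" using XT by blast
  have K: "T closure_of A \<subseteq> C" using closure_of_minimal[OF _ C(1)] W(3) by blast
  have "orb ` A = (orb ` N \<inter> orb ` X) \<inter> (TQ closure_of (orb ` A) \<inter> orb ` X)"
  proof (intro equalityI subsetI)
    fix q assume "q \<in> orb ` A"
    moreover have "orb ` A \<subseteq> TQ closure_of (orb ` A)"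
      using AT by (intro closure_of_subset) (auto simp: topspace_TQ)
    moreover have "A \<subseteq> N" using W(3) N(2) by blast
    ultimately show "q \<in> (orb ` N \<inter> orb ` X) \<inter> (TQ closure_of (orb ` A) \<inter> orb ` X)" using AX by blast
  next
    fix q assume q: "q \<in> (orb ` N \<inter> orb ` X) \<inter> (TQ closure_of (orb ` A) \<inter> orb ` X)"
    then obtain n where n: "n \<in> N" "q = orb n" by blast
    then have nT: "n \<in> topspace T" using openin_subset[OF N(1)] by blast
    then have "n \<in> T closure_of A" using orb_closure[OF A(1) AT nT] q n(2) by simp
    then have "n \<in> A" using K C(2) n(1) W(3) N(2) by blast
    then show "q \<in> orb ` A" using n(2) by simp
  qed
  moreover have "openin (subtopology TQ (orb ` X)) (orb ` N \<inter> orb ` X)"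
    using orb_open_map N(1) by (auto simp: open_map_def openin_subtopology)
  moreover have "closedin (subtopology TQ (orb ` X)) (TQ closure_of (orb ` A) \<inter> orb ` X)"
    unfolding closedin_subtopology using closedin_closure_of by blast
  ultimately show ?thesis unfolding locally_closed_in_def by blast
qed

text \<open>The topological conditions on the strata, including the frontier condition, pass to the
  quotient because \<open>orb\<close> is a continuous open surjection from X onto its image and a
  stratum contains x exactly when its image contains orb x.\<close>

lemma whitney_stratified_quotient:
  assumes wh: "whitney_stratified M X P leq S" and X: "invariant G \<alpha> X" and S: "\<And>i. i \<in> P \<Longrightarrow> invariant G \<alpha> (S i)"
  shows "whitney_stratified Q (orb ` X) P leq (\<lambda>i. orb ` S i)"
proof -
  have Xc: "closedin T X" and subm: "\<And>i. i \<in> P \<Longrightarrow> \<exists>k. submanifold M k (S i)"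
    and st: "stratification (subtopology T X) P leq S (\<lambda>i. induced_manifold M (S i))"
    and wB: "\<And>i j x. i \<in> P \<Longrightarrow> j \<in> P \<Longrightarrow> S i \<noteq> S j \<Longrightarrow> S i \<subseteq> T closure_of S j \<Longrightarrow> x \<in> S i \<Longrightarrow> whitney_B M (S i) (S j) x"
    using wh by (auto simp: whitney_stratified_def)
  have XT: "X \<subseteq> topspace T" using Xc by (rule closedin_subset)
  have tX: "topspace (subtopology T X) = X" using XT by auto
  have tQ: "topspace (subtopology TQ (orb ` X)) = orb ` X" using XT topspace_TQ by auto
  have st': "separable_space (subtopology T X)" "locally_compact_space (subtopology T X)"
    "partial_order_on P leq" "(\<Union>i\<in>P. S i) = X" "disjoint_family_on S P"
    "\<And>i. i \<in> P \<Longrightarrow> S i \<noteq> {}" "\<And>i. i \<in> P \<Longrightarrow> locally_closed_in (subtopology T X) (S i)"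
    "locally_finite_in (subtopology T X) (S ` P)"
    "\<And>i j. i \<in> P \<Longrightarrow> j \<in> P \<Longrightarrow> S i \<inter> subtopology T X closure_of S j \<noteq> {} \<longleftrightarrow> S i \<subseteq> subtopology T X closure_of S j"
    "\<And>i j. i \<in> P \<Longrightarrow> j \<in> P \<Longrightarrow> S i \<subseteq> subtopology T X closure_of S j \<longleftrightarrow> (i, j) \<in> leq"
    using st unfolding stratification_def tX by blast+
  have SX: "S i \<subseteq> X" if "i \<in> P" for i using st'(4) that by blast
  have ST: "S i \<subseteq> topspace T" if "i \<in> P" for i using SX[OF that] XT by blast
  note om = orb_restrict_open_map[OF X XT]
  have surj: "orb ` topspace (subtopology T X) = topspace (subtopology TQ (orb ` X))" unfolding tX tQ ..
  have mem: "orb x \<in> orb ` S i \<longleftrightarrow> x \<in> S i" if "i \<in> P" "x \<in> X" for i x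
    using orb_mem_image[OF S[OF that(1)] ST[OF that(1)]] that(2) XT by blast
  have clos: "orb x \<in> subtopology TQ (orb ` X) closure_of (orb ` S j) \<longleftrightarrow> x \<in> subtopology T X closure_of S j"
    if "j \<in> P" "x \<in> X" for j x
    by (rule orb_closure_subtopology[OF S[OF that(1)] SX[OF that(1)] XT that(2)])
  have sub_iff: "orb ` S i \<subseteq> subtopology TQ (orb ` X) closure_of (orb ` S j) \<longleftrightarrow> S i \<subseteq> subtopology T X closure_of S j"
    if "i \<in> P" "j \<in> P" for i j
    using clos[OF that(2)] SX[OF that(1)] by blast
  have int_iff: "orb ` S i \<inter> subtopology TQ (orb ` X) closure_of (orb ` S j) \<noteq> {} \<longleftrightarrow> S i \<inter> subtopology T X closure_of S j \<noteq> {}"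
    if "i \<in> P" "j \<in> P" for i j
    using clos[OF that(2)] SX[OF that(1)] by blast
  have strat: "stratification (subtopology TQ (orb ` X)) P leq (\<lambda>i. orb ` S i) (\<lambda>i. induced_manifold Q (orb ` S i))"
    unfolding stratification_def tQ
  proof (intro conjI ballI)
    show "separable_space (subtopology TQ (orb ` X))"
      by (rule separable_space_continuous_map_image[OF st'(1) om(1) surj])
    show "locally_compact_space (subtopology TQ (orb ` X))"
      by (rule locally_compact_space_continuous_open_map_image[OF om surj st'(2)])
    show "Hausdorff_space (subtopology TQ (orb ` X))" by (rule Hausdorff_space_subtopology[OF Hausdorff_TQ])
    show "partial_order_on P leq" by (rule st'(3))
    show "(\<Union>i\<in>P. orb ` S i) = orb ` X" using st'(4) by blast
    show "disjoint_family_on (\<lambda>i. orb ` S i) P"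
      unfolding disjoint_family_on_def
    proof (intro ballI impI)
      fix i j assume ij: "i \<in> P" "j \<in> P" "i \<noteq> j"
      then have "S i \<inter> S j = {}" using st'(5) by (auto simp: disjoint_family_on_def)
      then show "orb ` S i \<inter> orb ` S j = {}" using mem[OF ij(2)] SX[OF ij(1)] by blast
    qed
    show "locally_finite_in (subtopology TQ (orb ` X)) ((\<lambda>i. orb ` S i) ` P)"
      unfolding locally_finite_in_def tQ
    proof (intro conjI ballI)
      show "\<Union> ((\<lambda>i. orb ` S i) ` P) \<subseteq> orb ` X" using st'(4) by blast
      fix q assume "q \<in> orb ` X"
      then obtain x where x: "x \<in> X" "q = orb x" by blast
      then obtain W where W: "openin (subtopology T X) W" "x \<in> W" "finite {A \<in> S ` P. A \<inter> W \<noteq> {}}"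
        using st'(8) unfolding locally_finite_in_def tX by blast
      \<comment> \<open>By invariance, a stratum whose image meets the image of W meets W
        itself.\<close>
      have "{A \<in> (\<lambda>i. orb ` S i) ` P. A \<inter> orb ` W \<noteq> {}} \<subseteq> (\<lambda>A. orb ` A) ` {A \<in> S ` P. A \<inter> W \<noteq> {}}"
      proof
        fix A assume "A \<in> {A \<in> (\<lambda>i. orb ` S i) ` P. A \<inter> orb ` W \<noteq> {}}"
        then obtain i w where i: "i \<in> P" "A = orb ` S i" "w \<in> W" "orb w \<in> orb ` S i" by blast
        moreover have "w \<in> X" using i(3) openin_subset[OF W(1)] tX by blast
        ultimately have "w \<in> S i" using mem by blast
        then show "A \<in> (\<lambda>A. orb ` A) ` {A \<in> S ` P. A \<inter> W \<noteq> {}}" using i by blast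
      qed
      then have "finite {A \<in> (\<lambda>i. orb ` S i) ` P. A \<inter> orb ` W \<noteq> {}}"
        by (rule finite_subset) (rule finite_imageI[OF W(3)])
      moreover have "openin (subtopology TQ (orb ` X)) (orb ` W)" using om(2) W(1) by (simp add: open_map_def)
      ultimately show "\<exists>V. openin (subtopology TQ (orb ` X)) V \<and> q \<in> V \<and> finite {A \<in> (\<lambda>i. orb ` S i) ` P. A \<inter> V \<noteq> {}}"
        using W(2) x(2) by (intro exI[of _ "orb ` W"]) auto
    qed
  next
    fix i assume i: "i \<in> P"
    show "orb ` S i \<noteq> {}" using st'(6)[OF i] by simp
    show "locally_closed_in (subtopology TQ (orb ` X)) (orb ` S i)"
      by (rule locally_closed_quotient[OF X Xc S[OF i] st'(7)[OF i]])
    obtain k where k: "submanifold M k (S i)" using subm[OF i] by blast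
    show "smooth_manifold (induced_manifold Q (orb ` S i))"
      by (rule smooth_manifold_induced[OF smooth_manifold_Q submanifold_quotient(1)[OF k S[OF i]]]) (use st'(6)[OF i] in simp)
    have "orb ` X \<inter> orb ` S i = orb ` S i" using SX[OF i] by blast
    then show "mspace (induced_manifold Q (orb ` S i)) = subtopology (subtopology TQ (orb ` X)) (orb ` S i)"
      by (simp add: induced_manifold_def mspace_Q subtopology_subtopology)
  next
    fix i j assume ij: "i \<in> P" "j \<in> P"
    show "orb ` S i \<inter> subtopology TQ (orb ` X) closure_of (orb ` S j) \<noteq> {} \<longleftrightarrow>
      orb ` S i \<subseteq> subtopology TQ (orb ` X) closure_of (orb ` S j)"
      unfolding sub_iff[OF ij] int_iff[OF ij] by (rule st'(9)[OF ij])
    show "orb ` S i \<subseteq> subtopology TQ (orb ` X) closure_of (orb ` S j) \<longleftrightarrow> (i, j) \<in> leq"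
      unfolding sub_iff[OF ij] by (rule st'(10)[OF ij])
  qed
  show ?thesis
    unfolding whitney_stratified_def mspace_Q
  proof (intro conjI ballI impI smooth_manifold_Q strat)
    show "closedin TQ (orb ` X)" by (rule orb_closed[OF X Xc])
    show "\<exists>k. submanifold Q k (orb ` S i)" if "i \<in> P" for i
      using subm[OF that] submanifold_quotient(1)[OF _ S[OF that]] by blast
  next
    fix i j p assume ij: "i \<in> P" "j \<in> P" and ne: "orb ` S i \<noteq> orb ` S j \<and> orb ` S i \<subseteq> TQ closure_of (orb ` S j)"
      and p: "p \<in> orb ` S i"
    obtain x where x: "x \<in> S i" "p = orb x" using p by blast
    obtain k where k: "submanifold M k (S j)" using subm[OF ij(2)] by blast
    have "S i \<subseteq> T closure_of S j"
    proof
      fix y assume y: "y \<in> S i"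
      then have "orb y \<in> TQ closure_of (orb ` S j)" using ne by blast
      then show "y \<in> T closure_of S j"
        using orb_closure[OF S[OF ij(2)] ST[OF ij(2)] subsetD[OF ST[OF ij(1)] y]] by simp
    qed
    then have "whitney_B M (S i) (S j) x" using wB[OF ij] ne x(1) by blast
    then show "whitney_B Q (orb ` S i) (orb ` S j) p"
      unfolding x(2) by (rule whitney_B_quotient[OF _ S[OF ij(1)] ST[OF ij(1)] S[OF ij(2)] k st'(6)[OF ij(2)]])
  qed
qed

text \<open>All comparisons between dimensions survive the subtraction of dim G, which is at most
  the dimension of every stratum; so no difference of natural numbers is truncated.\<close>

lemma pseudomanifold_quotient:
  assumes pm: "pseudomanifold M X P leq S" and X: "invariant G \<alpha> X" and S: "\<And>i. i \<in> P \<Longrightarrow> invariant G \<alpha> (S i)"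
  shows "pseudomanifold Q (orb ` X) P leq (\<lambda>i. orb ` S i)"
proof -
  have wh: "whitney_stratified M X P leq S" using pm by (simp add: pseudomanifold_def)
  obtain n where n: "stratified_dim M P S n" "subtopology T X closure_of regular_set M X P S n = X"
    "\<And>i. i \<in> P \<Longrightarrow> \<not> S i \<subseteq> regular_set M X P S n \<Longrightarrow> submanifold_dim M (S i) + 2 \<le> n"
    using pm by (auto simp: pseudomanifold_def)
  have XT: "X \<subseteq> topspace T" using wh closedin_subset by (auto simp: whitney_stratified_def)
  have "topspace (subtopology T X) = X" using XT by auto
  then have SX: "S i \<subseteq> X" and ne: "S i \<noteq> {}" if "i \<in> P" for i
    using wh that by (auto simp: whitney_stratified_def stratification_def)
  have dim: "submanifold_dim Q (orb ` S i) = submanifold_dim M (S i) - mdim L" "mdim L \<le> submanifold_dim M (S i)"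
    if i: "i \<in> P" for i
  proof -
    obtain k where "submanifold M k (S i)" using wh i by (auto simp: whitney_stratified_def)
    then show "submanifold_dim Q (orb ` S i) = submanifold_dim M (S i) - mdim L" "mdim L \<le> submanifold_dim M (S i)"
      using submanifold_dim_quotient[OF _ S[OF i] ne[OF i]] by blast+
  qed
  have dn: "\<And>i. i \<in> P \<Longrightarrow> submanifold_dim M (S i) \<le> n" "\<exists>i\<in>P. submanifold_dim M (S i) = n"
    using n(1) by (auto simp: stratified_dim_def)
  then have Ln: "mdim L \<le> n" using dim(2) by force
  let ?R = "regular_set M X P S n"
  have RX: "?R \<subseteq> X" by (auto simp: regular_set_def)
  have mem: "orb x \<in> orb ` S i \<longleftrightarrow> x \<in> S i" if "i \<in> P" "x \<in> X" for i x
    using orb_mem_image[OF S[OF that(1)]] SX[OF that(1)] that(2) XT by blast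
  have low: "submanifold_dim Q (orb ` S i) < n - mdim L \<longleftrightarrow> submanifold_dim M (S i) < n" if "i \<in> P" for i
    using dim[OF that] dn(1)[OF that] Ln by linarith
  have reg: "regular_set Q (orb ` X) P (\<lambda>i. orb ` S i) (n - mdim L) = orb ` ?R"
  proof (intro equalityI subsetI)
    fix q assume q: "q \<in> regular_set Q (orb ` X) P (\<lambda>i. orb ` S i) (n - mdim L)"
    then obtain x where x: "x \<in> X" "q = orb x" by (auto simp: regular_set_def)
    have "x \<notin> S i" if "i \<in> P" "submanifold_dim M (S i) < n" for i
      using q that low[OF that(1)] x by (auto simp: regular_set_def)
    then show "q \<in> orb ` ?R" using x by (auto simp: regular_set_def)
  next
    fix q assume "q \<in> orb ` ?R"
    then obtain x where x: "x \<in> ?R" "q = orb x" by blast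
    then have xX: "x \<in> X" using RX by blast
    have "orb x \<notin> orb ` S i" if "i \<in> P" "submanifold_dim Q (orb ` S i) < n - mdim L" for i
      unfolding mem[OF that(1) xX] using x(1) that low[OF that(1)] by (auto simp: regular_set_def)
    then show "q \<in> regular_set Q (orb ` X) P (\<lambda>i. orb ` S i) (n - mdim L)"
      unfolding x(2) regular_set_def using xX by blast
  qed
  \<comment> \<open>The complement of the regular set in X is a union of invariant strata.
    Invariance is what lets density pass to the orbit space through
    \<open>orb_closure_subtopology\<close>.\<close>
  have Rinv: "invariant G \<alpha> ?R"
    unfolding invariant_def
  proof (intro ballI)
    fix g x assume g: "g \<in> carrier G" and x: "x \<in> ?R"
    have xX: "x \<in> X" "\<alpha> g x \<in> X" using x RX X g by (auto simp: invariant_def)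
    have "\<alpha> g x \<notin> S i" if i: "i \<in> P" "submanifold_dim M (S i) < n" for i
    proof -
      have "orb (\<alpha> g x) = orb x" using orb_translate[OF g] xX(1) XT by blast
      then have "\<alpha> g x \<in> S i \<longleftrightarrow> x \<in> S i" using mem[OF i(1) xX(1)] mem[OF i(1) xX(2)] by simp
      then show ?thesis using x i by (auto simp: regular_set_def)
    qed
    then show "\<alpha> g x \<in> ?R" using xX(2) by (auto simp: regular_set_def)
  qed
  have "subtopology TQ (orb ` X) closure_of (orb ` ?R) = orb ` X"
  proof (intro equalityI subsetI)
    fix q assume "q \<in> subtopology TQ (orb ` X) closure_of (orb ` ?R)"
    then show "q \<in> orb ` X" by (simp add: in_closure_of)
  next
    fix q assume "q \<in> orb ` X"
    then obtain x where x: "x \<in> X" "q = orb x" by blast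
    then show "q \<in> subtopology TQ (orb ` X) closure_of (orb ` ?R)"
      using orb_closure_subtopology[OF Rinv RX XT x(1)] n(2) by simp
  qed
  moreover have "stratified_dim Q P (\<lambda>i. orb ` S i) (n - mdim L)"
  proof -
    obtain i where i: "i \<in> P" "submanifold_dim M (S i) = n" using dn(2) by blast
    have "submanifold_dim Q (orb ` S i) = n - mdim L" using dim(1)[OF i(1)] i(2) by simp
    then show ?thesis
      unfolding stratified_dim_def using i(1) dim dn(1) by (metis diff_le_mono)
  qed
  moreover have "submanifold_dim Q (orb ` S i) + 2 \<le> n - mdim L"
    if i: "i \<in> P" "\<not> orb ` S i \<subseteq> orb ` ?R" for i
  proof -
    have "\<not> S i \<subseteq> ?R" using i(2) by blast
    then show ?thesis using n(3)[OF i(1)] dim[OF i(1)] by linarith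
  qed
  ultimately show ?thesis
    using whitney_stratified_quotient[OF wh X S] unfolding pseudomanifold_def mspace_Q
    by (intro conjI exI[of _ "n - mdim L"]) (simp_all add: reg)
qed

end

theorem lemma4p4:
  fixes G :: "'g monoid" and L :: "('g, 'b::euclidean_space) manifold"
    and M :: "('p, 'e::euclidean_space) manifold" and \<alpha> :: "'g \<Rightarrow> 'p \<Rightarrow> 'p"
    and X :: "'p set" and P :: "'i set" and leq :: "'i rel" and S :: "'i \<Rightarrow> 'p set"
  assumes "lie_group G L" and "compact_space (mspace L)"
    and "smooth_manifold M"
    and "smooth_action G L M \<alpha>" and "free_action G (topspace (mspace M)) \<alpha>"
    and "whitney_stratified M X P leq S"
    and "invariant G \<alpha> X" and "compatible_action G L M \<alpha> P S"
    and "pseudomanifold M X P leq S"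
  shows "pseudomanifold (quotient_manifold G L M \<alpha>) (orbit G \<alpha> ` X) P leq (\<lambda>i. orbit G \<alpha> ` S i)"
proof -
  interpret free_compact_action G L M \<alpha>
    using assms(1-5) by unfold_locales
  show ?thesis
    using assms(7-9) by (intro pseudomanifold_quotient) (auto simp: compatible_action_def)
qed

end
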